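(* Let $H$ be a reproducing kernel Hilbert space on a set $X$ with a complete Nevanlinna-Pick kernel and let $\mathfrak{A}\subset M(H)$ be a dual algebra of multipliers on $H$. If $F\in R(\mathfrak{A})$ and $\delta>0$ are such that $$M_F^L(M_F^L)^*\geq\delta^2I_L$$ for every $L=\mathfrak{A}[h]$ where $h\in H$ is a cyclic vector for $M(H)$, then there is a $G\in C(\mathfrak{A})$ such that $FG=1$ and $\|M_G\|\leq\delta^{-1}$.
   Context: A reproducing kernel Hilbert space $H$ on $X$ is a Hilbert space of complex-valued functions on $X$ with continuous point evaluations; $k_x\in H$ satisfies $f(x)=\langle f,k_x\rangle$ for $f\in H$, and $K(x,y)=\langle k_y,k_x\rangle$ is the kernel. $M(H)$ is the algebra of functions $f$ on $X$ with $fH\subseteq H$; each $f\in M(H)$ is identified with the bounded multiplication operator $M_f\in B(H)$. A dual algebra of multipliers is a unital weak-$*$-closed subalgebra $\mathfrak{A}$ of $M(H)\subseteq B(H)$. The kernel is a complete Nevanlinna-Pick (NP) kernel if the matrix-valued Nevanlinna-Pick theorem holds for $M(H)$: for all $m,n\ge1$, points $x_1,\dots,x_n\in X$ and $m\times m$ complex matrices $W_1,\dots,W_n$, there is an $m\times m$ matrix $\Phi$ with entries in $M(H)$, of norm at most $1$ as a multiplication operator on $H\otimes\mathbb{C}^m$, with $\Phi(x_i)=W_i$ for all $i$ if and only if the block matrix $[(I-W_iW_j^* )K(x_i,x_j)]_{i,j}$ is positive semidefinite. $C(\mathfrak{A})$ (column space) is the set of operators in $B(H,H\otimes\ell^2)$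 with entries from $\mathfrak{A}$: $G=[g_1,g_2,\dots]^T$ acts by $M_Gh=(g_1h,g_2h,\dots)$. $R(\mathfrak{A})$ (row space) is the set of operators in $B(H\otimes\ell^2,H)$ with entries from $\mathfrak{A}$: $F=[f_1,f_2,\dots]$ acts by $M_F(h_1,h_2,\dots)=\sum_i f_ih_i$. $FG=1$ means $\sum_i f_ig_i=1$ on $X$, the constant function $1$. For a closed $\mathfrak{A}$-invariant subspace $L\subseteq H$, $M_F^L=M_F|_{L\otimes\ell^2}$ is the multiplication operator from $L\otimes\ell^2$ into $L$. For $h\in H$, $\mathfrak{A}[h]$ is the closure of $\{fh:f\in\mathfrak{A}\}$ in $H$; $h$ is cyclic for $M(H)$ if $M(H)[h]=H$.
   Formalization: Assumes in addition a countable S in X such that every x has some s in S with K(x,s) nonzero; otherwise M(H) has no cyclic vector, the hypothesis is vacuous and F=0 is a counterexample (e.g. l^2(X), X uncountable). *)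

theory Defs
  imports "HOL-Analysis.Analysis" "HOL-Library.Function_Algebras" "HOL-Library.Complex_Order"
begin

text \<open>
  Spaces are given by a carrier and an inner product, linear in the first argument; the vector
  operations are the pointwise ones of \<^theory>\<open>HOL-Library.Function_Algebras\<close>. The scalar multiple
  of a function is the pointwise product with a constant function.
\<close>

record 'v hspace =
  carr :: "'v set"
  ip :: "'v \<Rightarrow> 'v \<Rightarrow> complex"

definition hnorm :: "'v hspace \<Rightarrow> 'v \<Rightarrow> real"
  where "hnorm S v = sqrt (Re (ip S v v))"

text \<open>The value \<open>0\<close> off the carrier is what \<^locale>\<open>Metric_space\<close> needs, whose nonnegativity and
  symmetry axioms are not relativised.\<close>

definition hdist :: "'v::minus hspace \<Rightarrow> 'v \<Rightarrow> 'v \<Rightarrow> real"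
  where "hdist S u v = (if u \<in> carr S \<and> v \<in> carr S then hnorm S (u - v) else 0)"

text \<open>The underlying set \<open>X\<close> is the type \<open>'x\<close>.\<close>

locale rkhs =
  fixes H :: "('x \<Rightarrow> complex) hspace"
  assumes zero_mem: "0 \<in> carr H"
    and add_mem: "f \<in> carr H \<Longrightarrow> g \<in> carr H \<Longrightarrow> f + g \<in> carr H"
    and scale_mem: "f \<in> carr H \<Longrightarrow> (\<lambda>_. c) * f \<in> carr H"
    and ip_add: "f \<in> carr H \<Longrightarrow> g \<in> carr H \<Longrightarrow> h \<in> carr H \<Longrightarrow>
                   ip H (f + g) h = ip H f h + ip H g h"
    and ip_scale: "f \<in> carr H \<Longrightarrow> h \<in> carr H \<Longrightarrow> ip H ((\<lambda>_. c) * f) h = c * ip H f h"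
    and ip_cnj: "f \<in> carr H \<Longrightarrow> g \<in> carr H \<Longrightarrow> ip H g f = cnj (ip H f g)"
    and ip_nonneg: "f \<in> carr H \<Longrightarrow> 0 \<le> ip H f f"
    and ip_definite: "f \<in> carr H \<Longrightarrow> ip H f f = 0 \<Longrightarrow> f = 0"
    and complete: "Metric_space.mcomplete (carr H) (hdist H)"
    and eval_bounded: "\<exists>C. \<forall>f\<in>carr H. cmod (f x) \<le> C * hnorm H f"

definition kfun :: "('x \<Rightarrow> complex) hspace \<Rightarrow> 'x \<Rightarrow> 'x \<Rightarrow> complex"
  where "kfun H x = (THE k. k \<in> carr H \<and> (\<forall>f\<in>carr H. f x = ip H f k))"

definition kernel :: "('x \<Rightarrow> complex) hspace \<Rightarrow> 'x \<Rightarrow> 'x \<Rightarrow> complex"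
  where "kernel H x y = ip H (kfun H y) (kfun H x)"


text \<open>\<open>S \<otimes> \<ell>\<^sup>2\<close> and \<open>S \<otimes> \<complex>\<^sup>m\<close> are Hilbert space direct sums of copies of \<open>S\<close>.\<close>

definition tensor_l2 :: "'v hspace \<Rightarrow> (nat \<Rightarrow> 'v) hspace"
  where "tensor_l2 S =
    \<lparr>carr = {h. (\<forall>i. h i \<in> carr S) \<and> summable (\<lambda>i. (hnorm S (h i))\<^sup>2)},
     ip = (\<lambda>h k. \<Sum>i. ip S (h i) (k i))\<rparr>"

definition tensor_fin :: "nat \<Rightarrow> 'v::zero hspace \<Rightarrow> (nat \<Rightarrow> 'v) hspace"
  where "tensor_fin m S =
    \<lparr>carr = {h. (\<forall>i<m. h i \<in> carr S) \<and> (\<forall>i\<ge>m. h i = 0)},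
     ip = (\<lambda>h k. \<Sum>i<m. ip S (h i) (k i))\<rparr>"

text \<open>Linearity is not part of this predicate; it is only used for multiplication operators.\<close>

definition bounded_op :: "'v hspace \<Rightarrow> 'w hspace \<Rightarrow> ('v \<Rightarrow> 'w) \<Rightarrow> bool"
  where "bounded_op S T A \<longleftrightarrow>
    (\<forall>v\<in>carr S. A v \<in> carr T) \<and> (\<exists>C. \<forall>v\<in>carr S. hnorm T (A v) \<le> C * hnorm S v)"

definition op_norm :: "'v hspace \<Rightarrow> 'w hspace \<Rightarrow> ('v \<Rightarrow> 'w) \<Rightarrow> real"
  where "op_norm S T A = (SUP v\<in>{v \<in> carr S. hnorm S v \<le> 1}. hnorm T (A v))"

definition adj :: "'v hspace \<Rightarrow> 'w hspace \<Rightarrow> ('v \<Rightarrow> 'w) \<Rightarrow> 'w \<Rightarrow> 'v"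
  where "adj S T A u = (THE v. v \<in> carr S \<and> (\<forall>w\<in>carr S. ip T (A w) u = ip S w v))"

definition op_le :: "'v::minus hspace \<Rightarrow> ('v \<Rightarrow> 'v) \<Rightarrow> ('v \<Rightarrow> 'v) \<Rightarrow> bool"
  where "op_le S A B \<longleftrightarrow> (\<forall>u\<in>carr S. 0 \<le> ip S (B u - A u) u)"


text \<open>The operators \<open>M\<^sub>f\<close> with \<open>f \<in> multipliers H\<close> are bounded by the closed graph theorem.\<close>

definition multipliers :: "('x \<Rightarrow> complex) hspace \<Rightarrow> ('x \<Rightarrow> complex) set"
  where "multipliers H = {f. \<forall>h\<in>carr H. f * h \<in> carr H}"

definition mult_op :: "('x \<Rightarrow> complex) hspace \<Rightarrow> ('x \<Rightarrow> complex) \<Rightarrow> ('x \<Rightarrow> complex) \<Rightarrow> ('x \<Rightarrow> complex)"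
  where "mult_op H f = (\<lambda>h\<in>carr H. f * h)"

definition matrix_mult_op ::
    "nat \<Rightarrow> (nat \<Rightarrow> nat \<Rightarrow> 'x \<Rightarrow> complex) \<Rightarrow> (nat \<Rightarrow> 'x \<Rightarrow> complex) \<Rightarrow> (nat \<Rightarrow> 'x \<Rightarrow> complex)"
  where "matrix_mult_op m \<Phi> h = (\<lambda>a. if a < m then \<Sum>b<m. \<Phi> a b * h b else 0)"

text \<open>
  Matrices are functions of their indices \<open>a, b < m\<close>; the points and matrices are indexed by
  \<open>i < n\<close>.
\<close>

definition np_solvable ::
    "('x \<Rightarrow> complex) hspace \<Rightarrow> nat \<Rightarrow> nat \<Rightarrow> (nat \<Rightarrow> 'x) \<Rightarrow> (nat \<Rightarrow> nat \<Rightarrow> nat \<Rightarrow> complex) \<Rightarrow> bool"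
  where "np_solvable H m n x W \<longleftrightarrow>
    (\<exists>\<Phi>. (\<forall>a<m. \<forall>b<m. \<Phi> a b \<in> multipliers H) \<and>
         bounded_op (tensor_fin m H) (tensor_fin m H) (matrix_mult_op m \<Phi>) \<and>
         op_norm (tensor_fin m H) (tensor_fin m H) (matrix_mult_op m \<Phi>) \<le> 1 \<and>
         (\<forall>i<n. \<forall>a<m. \<forall>b<m. \<Phi> a b (x i) = W i a b))"

text \<open>Entry \<open>(a, b)\<close> of the block \<open>(I - W\<^sub>i W\<^sub>j\<^sup>*) K(x\<^sub>i, x\<^sub>j)\<close>.\<close>

definition pick_entry ::
    "('x \<Rightarrow> complex) hspace \<Rightarrow> nat \<Rightarrow> (nat \<Rightarrow> 'x) \<Rightarrow> (nat \<Rightarrow> nat \<Rightarrow> nat \<Rightarrow> complex) \<Rightarrow>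
      nat \<Rightarrow> nat \<Rightarrow> nat \<Rightarrow> nat \<Rightarrow> complex"
  where "pick_entry H m x W i j a b =
    (of_bool (a = b) - (\<Sum>c<m. W i a c * cnj (W j b c))) * kernel H (x i) (x j)"

definition pick_psd ::
    "('x \<Rightarrow> complex) hspace \<Rightarrow> nat \<Rightarrow> nat \<Rightarrow> (nat \<Rightarrow> 'x) \<Rightarrow> (nat \<Rightarrow> nat \<Rightarrow> nat \<Rightarrow> complex) \<Rightarrow> bool"
  where "pick_psd H m n x W \<longleftrightarrow>
    (\<forall>v :: nat \<Rightarrow> nat \<Rightarrow> complex.
       0 \<le> (\<Sum>i<n. \<Sum>j<n. \<Sum>a<m. \<Sum>b<m. cnj (v i a) * pick_entry H m x W i j a b * v j b))"

definition complete_np :: "('x \<Rightarrow> complex) hspace \<Rightarrow> bool"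
  where "complete_np H \<longleftrightarrow>
    (\<forall>m\<ge>1. \<forall>n\<ge>1. \<forall>x W. np_solvable H m n x W \<longleftrightarrow> pick_psd H m n x W)"


text \<open>
  \<open>B(H)\<close>; operators are extensional, so that equality is equality on \<open>carr H\<close>.
\<close>

definition bounded_ops :: "('x \<Rightarrow> complex) hspace \<Rightarrow> (('x \<Rightarrow> complex) \<Rightarrow> ('x \<Rightarrow> complex)) set"
  where "bounded_ops H = {T \<in> extensional (carr H). bounded_op H H T \<and>
    (\<forall>f\<in>carr H. \<forall>g\<in>carr H. T (f + g) = T f + T g) \<and>
    (\<forall>f\<in>carr H. \<forall>c. T ((\<lambda>_. c) * f) = (\<lambda>_. c) * T f)}"

text \<open>
  The predual of \<open>B(H)\<close> is the space of trace class operators, acting by \<open>T \<mapsto> tr (T Q)\<close>. A trace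
  class \<open>Q\<close> is \<open>\<Sum>n. \<langle>\<cdot>, v\<^sub>n\<rangle> u\<^sub>n\<close> with square summable sequences \<open>u\<close>, \<open>v\<close>, so these functionals
  are \<open>T \<mapsto> \<Sum>n. \<langle>T u\<^sub>n, v\<^sub>n\<rangle>\<close>.
\<close>

definition weak_star_topology ::
    "('x \<Rightarrow> complex) hspace \<Rightarrow> (('x \<Rightarrow> complex) \<Rightarrow> ('x \<Rightarrow> complex)) topology"
  where "weak_star_topology H = topology_generated_by
    {{T \<in> bounded_ops H. (\<Sum>n. ip H (T (u n)) (v n)) \<in> U} | u v U.
       u \<in> carr (tensor_l2 H) \<and> v \<in> carr (tensor_l2 H) \<and> open U}"

definition dual_algebra :: "('x \<Rightarrow> complex) hspace \<Rightarrow> ('x \<Rightarrow> complex) set \<Rightarrow> bool"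
  where "dual_algebra H A \<longleftrightarrow>
    A \<subseteq> multipliers H \<and> 1 \<in> A \<and>
    (\<forall>f\<in>A. \<forall>g\<in>A. f + g \<in> A \<and> f * g \<in> A) \<and> (\<forall>f\<in>A. \<forall>c. (\<lambda>_. c) * f \<in> A) \<and>
    closedin (weak_star_topology H) (mult_op H ` A)"


definition col_op :: "(nat \<Rightarrow> 'x \<Rightarrow> complex) \<Rightarrow> ('x \<Rightarrow> complex) \<Rightarrow> (nat \<Rightarrow> 'x \<Rightarrow> complex)"
  where "col_op G h = (\<lambda>i. G i * h)"

definition row_op :: "(nat \<Rightarrow> 'x \<Rightarrow> complex) \<Rightarrow> (nat \<Rightarrow> 'x \<Rightarrow> complex) \<Rightarrow> ('x \<Rightarrow> complex)"
  where "row_op F h = (\<lambda>x. \<Sum>i. F i x * h i x)"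

definition col_space ::
    "('x \<Rightarrow> complex) hspace \<Rightarrow> ('x \<Rightarrow> complex) set \<Rightarrow> (nat \<Rightarrow> 'x \<Rightarrow> complex) set"
  where "col_space H A = {G. (\<forall>i. G i \<in> A) \<and> bounded_op H (tensor_l2 H) (col_op G)}"

text \<open>
  The summability clause guards against the arbitrary value of a divergent \<^const>\<open>suminf\<close>; for a
  bounded row the series converges in \<open>H\<close>, hence pointwise.
\<close>

definition row_space ::
    "('x \<Rightarrow> complex) hspace \<Rightarrow> ('x \<Rightarrow> complex) set \<Rightarrow> (nat \<Rightarrow> 'x \<Rightarrow> complex) set"
  where "row_space H A = {F. (\<forall>i. F i \<in> A) \<and>
    (\<forall>h\<in>carr (tensor_l2 H). \<forall>x. summable (\<lambda>i. F i x * h i x)) \<and>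
    bounded_op (tensor_l2 H) H (row_op F)}"

definition cyclic_subspace ::
    "('x \<Rightarrow> complex) hspace \<Rightarrow> ('x \<Rightarrow> complex) set \<Rightarrow> ('x \<Rightarrow> complex) \<Rightarrow> ('x \<Rightarrow> complex) hspace"
  where "cyclic_subspace H A h =
    H\<lparr>carr := Metric_space.mtopology (carr H) (hdist H) closure_of {f * h | f. f \<in> A}\<rparr>"

definition cyclic_vector :: "('x \<Rightarrow> complex) hspace \<Rightarrow> ('x \<Rightarrow> complex) \<Rightarrow> bool"
  where "cyclic_vector H h \<longleftrightarrow>
    h \<in> carr H \<and> carr (cyclic_subspace H (multipliers H) h) = carr H"

text \<open>
  The kernel has at most countably many irreducible components and vanishes nowhere on the diagonal.
  This holds if \<open>K(x, y) \<noteq> 0\<close> for all \<open>x, y\<close>, and also if \<open>H\<close> is separable and no point is a common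
  zero of \<open>H\<close> (choose \<open>S\<close> such that the \<open>k\<^sub>s\<close> with \<open>s \<in> S\<close> are dense among all \<open>k\<^sub>x\<close>).
  At a common zero, \<open>f(x)\<close> is not determined by \<open>M\<^sub>f\<close>. For \<open>\<ell>\<^sup>2(X)\<close> with \<open>X\<close> uncountable, whose
  kernel is a complete Nevanlinna-Pick kernel, \<open>M(H)\<close> has no cyclic vector.
\<close>

definition countably_connected :: "('x \<Rightarrow> complex) hspace \<Rightarrow> bool"
  where "countably_connected H \<longleftrightarrow> (\<exists>S. countable S \<and> (\<forall>x. \<exists>s\<in>S. kernel H x s \<noteq> 0))"

end

theory Submission
  imports Defs "HOL-Library.Nat_Bijection"
begin

text \<open>
  On a finite set of points the complete Nevanlinna-Pick property forces a kernel of the form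
  \<open>c(x) cnj (c(y)) / (1 - \<langle>b(x), b(y)\<rangle>)\<close> (McCullough-Quiggin). The inner-outer factorization in the full
  Fock space, followed by a compactness argument, then writes each \<open>a \<in> H \<otimes> \<ell>\<^sup>2\<close> as \<open>\<Phi> h\<close> with
  \<open>\<parallel>h\<parallel> \<le> \<parallel>a\<parallel>\<close> and \<open>\<Phi>\<close> a contractive column multiplier. Adding small multiples of kernel functions to
  \<open>a\<close> makes \<open>h\<close> cyclic, so that \<open>\<Sum>\<^sub>n \<parallel>f a\<^sub>n\<parallel>\<^sup>2 \<le> \<parallel>f h\<parallel>\<^sup>2\<close> for all multipliers \<open>f\<close>: a single cyclic vector
  controls any sequence.

  Two consequences give the theorem. First, since \<open>\<AA>\<close> is weak-star closed, a multiplier \<open>f\<close> lies in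
  \<open>\<AA>\<close> as soon as \<open>f h \<in> \<AA>[h]\<close> for all cyclic \<open>h\<close>. Second, a minimax principle reduces the search for
  columns \<open>G\<close> that are good at finitely many vectors to a single cyclic vector, where the lower bound
  for \<open>M\<^sub>F\<^sup>L\<close> yields approximate solutions; a Tychonoff limit of these is the required \<open>G\<close>.
\<close>

text \<open>The Nevanlinna-Pick hypothesis speaks of finitely many points only, and \<open>H\<close>
  need not be separable. Factorizations are therefore solved on finite sets, and the requirements on
  the factors are phrased as closed conditions on point values, tested against finite combinations
  of kernel functions, so that they survive a pointwise limit.

  The Fock space is the noncommutative one because its creation operators are isometries with
  mutually orthogonal ranges: the shifts of a wandering vector are orthogonal, so a vector of its
  cyclic subspace is described by a scalar coefficient sequence of the same norm, up to
  normalisation. Commuting shifts lack this property.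

  The obstacle in the corona part is that a column adapted to one vector may be bad at another. The
  requirements are convex in \<open>G\<close>, so minimax asks only for columns with a small
  weighted sum of squared errors, and such a sum is at most the squared error at one cyclic vector
  \<open>h\<close>. Since \<open>\<parallel>h\<parallel>\<^sup>2\<close> exceeds the weighted sum of
  squared norms by an arbitrarily small amount only, the constant \<open>1 / \<delta>\<close> is not
  enlarged.\<close>

section \<open>Hilbert spaces given by a carrier\<close>

text \<open>Scalar multiplication is a parameter, so that one locale covers \<open>H\<close>, the
  spaces \<open>tensor_l2 S\<close> and the scalars. Apart from \<open>minus_sc\<close> no module
  law is assumed: further laws hold on the carrier because they can be tested against the inner
  product, see \<open>eqI\<close>.\<close>

locale prehilbert =
  fixes S :: "'v::ab_group_add hspace" and sc :: "complex \<Rightarrow> 'v \<Rightarrow> 'v"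
  assumes zero_mem [simp, intro]: "0 \<in> carr S"
    and add_mem [simp, intro]: "u \<in> carr S \<Longrightarrow> v \<in> carr S \<Longrightarrow> u + v \<in> carr S"
    and sc_mem [simp, intro]: "u \<in> carr S \<Longrightarrow> sc c u \<in> carr S"
    and minus_sc: "u \<in> carr S \<Longrightarrow> - u = sc (-1) u"
    and ip_add: "u \<in> carr S \<Longrightarrow> v \<in> carr S \<Longrightarrow> w \<in> carr S \<Longrightarrow> ip S (u + v) w = ip S u w + ip S v w"
    and ip_sc: "u \<in> carr S \<Longrightarrow> w \<in> carr S \<Longrightarrow> ip S (sc c u) w = c * ip S u w"
    and ip_cnj: "u \<in> carr S \<Longrightarrow> v \<in> carr S \<Longrightarrow> ip S v u = cnj (ip S u v)"
    and ip_nonneg: "u \<in> carr S \<Longrightarrow> 0 \<le> Re (ip S u u)"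
    and ip_definite: "u \<in> carr S \<Longrightarrow> ip S u u = 0 \<Longrightarrow> u = 0"
begin

abbreviation nrm :: "'v \<Rightarrow> real" where "nrm \<equiv> hnorm S"

lemma neg_mem [simp, intro]: "u \<in> carr S \<Longrightarrow> - u \<in> carr S"
  by (simp add: minus_sc)

lemma diff_mem [simp, intro]: "u \<in> carr S \<Longrightarrow> v \<in> carr S \<Longrightarrow> u - v \<in> carr S"
  by (metis add_mem neg_mem diff_conv_add_uminus)

lemma sum_mem [simp, intro]: "(\<And>i. i \<in> I \<Longrightarrow> f i \<in> carr S) \<Longrightarrow> sum f I \<in> carr S"
  by (induction I rule: infinite_finite_induct) auto

lemma ip_neg: "u \<in> carr S \<Longrightarrow> w \<in> carr S \<Longrightarrow> ip S (- u) w = - ip S u w"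
  by (simp add: minus_sc ip_sc)

lemma ip_diff: "u \<in> carr S \<Longrightarrow> v \<in> carr S \<Longrightarrow> w \<in> carr S \<Longrightarrow> ip S (u - v) w = ip S u w - ip S v w"
  by (metis ip_add ip_neg neg_mem diff_conv_add_uminus)

lemma ip_zero [simp]: "w \<in> carr S \<Longrightarrow> ip S 0 w = 0"
  using ip_diff[of 0 0 w] by simp

lemma ip_add_right: "u \<in> carr S \<Longrightarrow> v \<in> carr S \<Longrightarrow> w \<in> carr S \<Longrightarrow> ip S w (u + v) = ip S w u + ip S w v"
  using ip_cnj[of "u + v" w] ip_cnj[of u w] ip_cnj[of v w] by (simp add: ip_add)

lemma ip_sc_right: "u \<in> carr S \<Longrightarrow> w \<in> carr S \<Longrightarrow> ip S w (sc c u) = cnj c * ip S w u"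
  using ip_cnj[of "sc c u" w] ip_cnj[of u w] by (simp add: ip_sc)

lemma ip_diff_right: "u \<in> carr S \<Longrightarrow> v \<in> carr S \<Longrightarrow> w \<in> carr S \<Longrightarrow> ip S w (u - v) = ip S w u - ip S w v"
  using ip_cnj[of "u - v" w] ip_cnj[of u w] ip_cnj[of v w] by (simp add: ip_diff)

lemma ip_zero_right [simp]: "w \<in> carr S \<Longrightarrow> ip S w 0 = 0"
  using ip_cnj[of 0 w] by simp

lemma ip_sum: "(\<And>i. i \<in> I \<Longrightarrow> f i \<in> carr S) \<Longrightarrow> w \<in> carr S \<Longrightarrow> ip S (sum f I) w = (\<Sum>i\<in>I. ip S (f i) w)"
  by (induction I rule: infinite_finite_induct) (auto simp: ip_add)

lemma ip_sum_right: "(\<And>i. i \<in> I \<Longrightarrow> f i \<in> carr S) \<Longrightarrow> w \<in> carr S \<Longrightarrow> ip S w (sum f I) = (\<Sum>i\<in>I. ip S w (f i))"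
  by (induction I rule: infinite_finite_induct) (auto simp: ip_add_right)

lemma nrm_nonneg [simp]: "u \<in> carr S \<Longrightarrow> 0 \<le> nrm u"
  by (simp add: hnorm_def ip_nonneg)

lemma nrm_sq: "u \<in> carr S \<Longrightarrow> (nrm u)\<^sup>2 = Re (ip S u u)"
  by (simp add: hnorm_def ip_nonneg)

lemma ip_self: "u \<in> carr S \<Longrightarrow> ip S u u = complex_of_real ((nrm u)\<^sup>2)"
  using ip_cnj[of u u] by (simp add: nrm_sq complex_eq_iff)

lemma nrm_zero [simp]: "nrm 0 = 0"
  by (simp add: hnorm_def)

lemma nrm_eq_0: "u \<in> carr S \<Longrightarrow> nrm u = 0 \<Longrightarrow> u = 0"
  by (rule ip_definite) (simp_all add: ip_self)

lemma eqI: "u \<in> carr S \<Longrightarrow> v \<in> carr S \<Longrightarrow> (\<And>w. w \<in> carr S \<Longrightarrow> ip S u w = ip S v w) \<Longrightarrow> u = v"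
  using ip_definite[of "u - v"] by (simp add: ip_diff)

lemma sc_0 [simp]: "u \<in> carr S \<Longrightarrow> sc 0 u = 0"
  by (rule eqI) (auto simp: ip_sc)

lemma sc_zero [simp]: "sc c 0 = 0"
  by (rule eqI) (auto simp: ip_sc)

lemma sc_1 [simp]: "u \<in> carr S \<Longrightarrow> sc 1 u = u"
  by (rule eqI) (auto simp: ip_sc)

lemma nrm_sc: "u \<in> carr S \<Longrightarrow> nrm (sc c u) = cmod c * nrm u"
proof -
  assume u: "u \<in> carr S"
  have "ip S (sc c u) (sc c u) = complex_of_real ((cmod c)\<^sup>2 * (nrm u)\<^sup>2)"
    using u unfolding of_real_mult complex_norm_square ip_self[OF u, symmetric] by (simp add: ip_sc ip_sc_right)
  then have "(nrm (sc c u))\<^sup>2 = (cmod c * nrm u)\<^sup>2"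
    using u by (simp add: nrm_sq[of "sc c u"] power_mult_distrib)
  then show ?thesis
    using u by (metis nrm_nonneg sc_mem norm_ge_zero power2_eq_imp_eq mult_nonneg_nonneg)
qed

lemma nrm_neg: "u \<in> carr S \<Longrightarrow> nrm (- u) = nrm u"
  by (simp add: minus_sc nrm_sc)

lemma nrm_diff_commute: "u \<in> carr S \<Longrightarrow> v \<in> carr S \<Longrightarrow> nrm (u - v) = nrm (v - u)"
  by (metis nrm_neg diff_mem minus_diff_eq)

lemma nrm_add_sq: "u \<in> carr S \<Longrightarrow> v \<in> carr S \<Longrightarrow> (nrm (u + v))\<^sup>2 = (nrm u)\<^sup>2 + (nrm v)\<^sup>2 + 2 * Re (ip S u v)"
  using ip_cnj[of u v] by (simp add: nrm_sq ip_add ip_add_right)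

lemma nrm_diff_sq: "u \<in> carr S \<Longrightarrow> v \<in> carr S \<Longrightarrow> (nrm (u - v))\<^sup>2 = (nrm u)\<^sup>2 + (nrm v)\<^sup>2 - 2 * Re (ip S u v)"
  using ip_cnj[of u v] by (simp add: nrm_sq ip_diff ip_diff_right)

lemma cauchy_schwarz:
  assumes u: "u \<in> carr S" and v: "v \<in> carr S"
  shows "cmod (ip S u v) \<le> nrm u * nrm v"
proof (cases "nrm v = 0")
  case True
  then have "v = 0" using nrm_eq_0 v by blast
  then show ?thesis using u by simp
next
  case False
  define a where "a = ip S u v"
  define r where "r = (nrm v)\<^sup>2"
  have r: "r > 0" using False by (simp add: r_def)
  \<comment> \<open>This is \<open>r\<close> times the component of \<open>u\<close> orthogonal to
    \<open>v\<close>, with the denominator cleared.\<close>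
  define w where "w = sc (complex_of_real r) u - sc a v"
  have "0 \<le> (nrm w)\<^sup>2" by simp
  also have "(nrm w)\<^sup>2 = r\<^sup>2 * (nrm u)\<^sup>2 + (cmod a)\<^sup>2 * r - 2 * Re (r * cnj a * a)"
  proof -
    have "ip S (sc (complex_of_real r) u) (sc a v) = r * cnj a * a"
      using u v by (simp add: ip_sc ip_sc_right a_def)
    moreover have "(nrm (sc (complex_of_real r) u))\<^sup>2 = r\<^sup>2 * (nrm u)\<^sup>2" "(nrm (sc a v))\<^sup>2 = (cmod a)\<^sup>2 * r"
      using u v r by (simp_all add: nrm_sc power_mult_distrib flip: r_def)
    ultimately show ?thesis using nrm_diff_sq[of "sc (complex_of_real r) u" "sc a v"] u v by (simp add: w_def)
  qed
  also have "Re (r * cnj a * a) = r * (cmod a)\<^sup>2"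
  proof -
    have "r * cnj a * a = complex_of_real (r * (cmod a)\<^sup>2)"
      unfolding of_real_mult complex_norm_square by (simp add: mult_ac)
    then show ?thesis by (metis Re_complex_of_real)
  qed
  finally have "r * (cmod a)\<^sup>2 \<le> r * (r * (nrm u)\<^sup>2)" by (simp add: algebra_simps power2_eq_square)
  then have "(cmod a)\<^sup>2 \<le> (nrm u * nrm v)\<^sup>2"
    using r by (simp add: r_def power_mult_distrib mult.commute)
  then show ?thesis using u v unfolding a_def by (auto intro: power2_le_imp_le)
qed

lemma nrm_triangle: "u \<in> carr S \<Longrightarrow> v \<in> carr S \<Longrightarrow> nrm (u + v) \<le> nrm u + nrm v"
proof -
  assume u: "u \<in> carr S" and v: "v \<in> carr S"
  have "Re (ip S u v) \<le> nrm u * nrm v"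
    using cauchy_schwarz[OF u v] complex_Re_le_cmod order_trans by blast
  then have "(nrm (u + v))\<^sup>2 \<le> (nrm u + nrm v)\<^sup>2"
    using u v by (simp add: nrm_add_sq power2_sum)
  then show ?thesis by (rule power2_le_imp_le) (use u v in simp)
qed

lemma nrm_diff_triangle: "u \<in> carr S \<Longrightarrow> v \<in> carr S \<Longrightarrow> w \<in> carr S \<Longrightarrow> nrm (u - w) \<le> nrm (u - v) + nrm (v - w)"
  using nrm_triangle[of "u - v" "v - w"] by simp

lemma nrm_sum: "(\<And>i. i \<in> I \<Longrightarrow> f i \<in> carr S) \<Longrightarrow> nrm (sum f I) \<le> (\<Sum>i\<in>I. nrm (f i))"
proof (induction I rule: infinite_finite_induct)
  case (insert x F)
  then show ?case using nrm_triangle[of "f x" "sum f F"] by force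
qed auto

lemma nrm_lincomb_sq:
  assumes "\<And>x. x \<in> I \<Longrightarrow> v x \<in> carr S"
  shows "(nrm (\<Sum>x\<in>I. sc (c x) (v x)))\<^sup>2 = Re (\<Sum>x\<in>I. \<Sum>y\<in>I. c x * cnj (c y) * ip S (v x) (v y))"
proof -
  have "ip S (\<Sum>x\<in>I. sc (c x) (v x)) (\<Sum>x\<in>I. sc (c x) (v x)) =
      (\<Sum>x\<in>I. ip S (sc (c x) (v x)) (\<Sum>y\<in>I. sc (c y) (v y)))"
    using assms by (intro ip_sum) auto
  also have "\<dots> = (\<Sum>x\<in>I. \<Sum>y\<in>I. c x * cnj (c y) * ip S (v x) (v y))"
    using assms by (intro sum.cong refl) (simp add: ip_sum_right ip_sc ip_sc_right mult_ac sum_distrib_left)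
  finally show ?thesis using assms by (simp add: nrm_sq)
qed

lemma ip_tendsto:
  assumes "\<And>n. \<sigma> n \<in> carr S" "l \<in> carr S" "(\<lambda>n. nrm (\<sigma> n - l)) \<longlonglongrightarrow> 0" "v \<in> carr S"
  shows "(\<lambda>n. ip S (\<sigma> n) v) \<longlonglongrightarrow> ip S l v"
proof -
  have "(\<lambda>n. nrm (\<sigma> n - l) * nrm v) \<longlonglongrightarrow> 0"
    using tendsto_mult_right[OF assms(3), of "nrm v"] by simp
  then have "(\<lambda>n. ip S (\<sigma> n) v - ip S l v) \<longlonglongrightarrow> 0"
    by (rule Lim_null_comparison[rotated]) (use assms cauchy_schwarz in \<open>simp add: ip_diff[symmetric]\<close>)
  then show ?thesis by (simp add: LIM_zero_iff)
qed

lemma ip_tendsto_right: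
  assumes "\<And>n. \<sigma> n \<in> carr S" "l \<in> carr S" "(\<lambda>n. nrm (\<sigma> n - l)) \<longlonglongrightarrow> 0" "v \<in> carr S"
  shows "(\<lambda>n. ip S v (\<sigma> n)) \<longlonglongrightarrow> ip S v l"
  using tendsto_cnj[OF ip_tendsto[OF assms]] assms by (simp add: ip_cnj[symmetric])

lemma nrm_tendsto:
  assumes "\<And>n. \<sigma> n \<in> carr S" "l \<in> carr S" "(\<lambda>n. nrm (\<sigma> n - l)) \<longlonglongrightarrow> 0"
  shows "(\<lambda>n. nrm (\<sigma> n)) \<longlonglongrightarrow> nrm l"
proof -
  have "(\<lambda>n. nrm (\<sigma> n) - nrm l) \<longlonglongrightarrow> 0"
  proof (rule Lim_null_comparison[OF _ assms(3)], rule always_eventually, rule allI)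
    fix n
    show "norm (nrm (\<sigma> n) - nrm l) \<le> nrm (\<sigma> n - l)"
      using assms(1)[of n] assms(2) nrm_triangle[of "\<sigma> n - l" l] nrm_triangle[of "l - \<sigma> n" "\<sigma> n"]
        nrm_diff_commute[of "\<sigma> n" l]
      by (simp add: abs_le_iff)
  qed
  then show ?thesis by (simp add: LIM_zero_iff)
qed

end

locale hilbert = prehilbert S sc for S :: "'v::ab_group_add hspace" and sc +
  assumes complete: "(\<And>n. \<sigma> n \<in> carr S) \<Longrightarrow>
          (\<And>e. e > 0 \<Longrightarrow> \<exists>N. \<forall>m\<ge>N. \<forall>n\<ge>N. hnorm S (\<sigma> m - \<sigma> n) < e) \<Longrightarrow>
          \<exists>l\<in>carr S. (\<lambda>n. hnorm S (\<sigma> n - l)) \<longlonglongrightarrow> 0"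
begin

text \<open>
  Both the Riesz representation and the nearest point in a convex set are minimisers of a functional
  \<open>\<parallel>u\<parallel>\<^sup>2 - 2 \<lambda> u\<close>; the parallelogram law makes minimising sequences Cauchy.
\<close>

lemma minimizing_sequence:
  fixes lam :: "'v \<Rightarrow> real"
  assumes M: "M \<subseteq> carr S" "M \<noteq> {}"
    and mid: "\<And>u v. u \<in> M \<Longrightarrow> v \<in> M \<Longrightarrow> sc (1/2) (u + v) \<in> M"
    and lam: "\<And>u v. u \<in> M \<Longrightarrow> v \<in> M \<Longrightarrow> lam (sc (1/2) (u + v)) = (lam u + lam v) / 2"
    and bdd: "\<And>u. u \<in> M \<Longrightarrow> b \<le> (nrm u)\<^sup>2 - 2 * lam u"
  obtains \<sigma> l d where "\<And>n. \<sigma> n \<in> M" "l \<in> carr S" "(\<lambda>n. nrm (\<sigma> n - l)) \<longlonglongrightarrow> 0"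
    "\<And>u. u \<in> M \<Longrightarrow> d \<le> (nrm u)\<^sup>2 - 2 * lam u" "(\<lambda>n. (nrm (\<sigma> n))\<^sup>2 - 2 * lam (\<sigma> n)) \<longlonglongrightarrow> d"
proof -
  define J where "J u = (nrm u)\<^sup>2 - 2 * lam u" for u
  define d where "d = Inf (J ` M)"
  have bb: "bdd_below (J ` M)" using bdd by (intro bdd_belowI[of _ b]) (auto simp: J_def)
  have d: "d \<le> J u" if "u \<in> M" for u
    unfolding d_def by (rule cINF_lower[OF bb that])
  have "\<exists>u\<in>M. J u < d + 1 / Suc n" for n
    using cINF_less_iff[OF M(2) bb, of "d + 1 / Suc n"] by (auto simp: d_def)
  then obtain \<sigma> where \<sigma>: "\<And>n. \<sigma> n \<in> M" "\<And>n. J (\<sigma> n) < d + 1 / Suc n" by metis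
  have \<sigma>S: "\<sigma> n \<in> carr S" for n using \<sigma> M by blast
  have par: "(nrm (\<sigma> m - \<sigma> n))\<^sup>2 \<le> 2 / Suc m + 2 / Suc n" for m n
  proof -
    let ?w = "sc (1/2) (\<sigma> m + \<sigma> n)"
    have "(nrm ?w)\<^sup>2 = (nrm (\<sigma> m + \<sigma> n))\<^sup>2 / 4"
      using \<sigma>S by (simp add: nrm_sc power_mult_distrib power_divide)
    then have "(nrm (\<sigma> m - \<sigma> n))\<^sup>2 = 2 * J (\<sigma> m) + 2 * J (\<sigma> n) - 4 * J ?w"
      using \<sigma>S lam[OF \<sigma>(1) \<sigma>(1), of m n] by (simp add: J_def nrm_diff_sq nrm_add_sq)
    also have "\<dots> \<le> 2 / Suc m + 2 / Suc n"
      using \<sigma>(2)[of m] \<sigma>(2)[of n] d[OF mid[OF \<sigma>(1) \<sigma>(1), of m n]] by simp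
    finally show ?thesis .
  qed
  have "\<exists>N. \<forall>m\<ge>N. \<forall>n\<ge>N. nrm (\<sigma> m - \<sigma> n) < e" if e: "e > 0" for e
  proof -
    obtain N where N: "4 / Suc N < e\<^sup>2"
      using reals_Archimedean[of "e\<^sup>2 / 4"] e by (auto simp: field_simps)
    show ?thesis
    proof (intro exI allI impI)
      fix m n assume mn: "m \<ge> N" "n \<ge> N"
      have "(nrm (\<sigma> m - \<sigma> n))\<^sup>2 \<le> 2 / Suc m + 2 / Suc n" by (rule par)
      also have "\<dots> \<le> 2 / Suc N + 2 / Suc N"
        using mn by (intro add_mono divide_left_mono) auto
      also have "\<dots> < e\<^sup>2" using N by simp
      finally show "nrm (\<sigma> m - \<sigma> n) < e" by (rule power2_less_imp_less) (use e in simp)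
    qed
  qed
  from complete[OF \<sigma>S this] obtain l where l: "l \<in> carr S" "(\<lambda>n. nrm (\<sigma> n - l)) \<longlonglongrightarrow> 0" by blast
  have lim: "(\<lambda>n. d + 1 / Suc n) \<longlonglongrightarrow> d"
    using tendsto_add[OF tendsto_const[of d] LIMSEQ_inverse_real_of_nat] by (simp add: field_simps)
  have "(\<lambda>n. J (\<sigma> n)) \<longlonglongrightarrow> d"
    by (rule tendsto_sandwich[OF _ _ tendsto_const lim]) (use d \<sigma> in \<open>auto intro!: always_eventually less_imp_le simp del: of_nat_Suc\<close>)
  then show thesis using that[of \<sigma> l d] \<sigma> l d by (simp add: J_def)
qed

end

text \<open>First variation: for small \<open>t\<close> the linear term dominates. The range
  \<open>0 < t \<le> 1\<close> is what moving inside a convex set allows, as in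
  \<open>nearest_point\<close>.\<close>

lemma quadratic_nonneg_imp:
  fixes a b :: real
  assumes "\<And>t. 0 < t \<Longrightarrow> t \<le> 1 \<Longrightarrow> 0 \<le> 2 * t * a + t\<^sup>2 * b"
  shows "0 \<le> a"
proof (rule ccontr)
  assume "\<not> 0 \<le> a"
  then have a: "a < 0" by simp
  \<comment> \<open>For this \<open>t\<close> one has \<open>t * b \<le> - a\<close>, hence
    \<open>2 * a + t * b \<le> a < 0\<close>.\<close>
  define t where "t = min 1 (- a / (\<bar>b\<bar> + 1))"
  have t: "0 < t" "t \<le> 1" using a by (auto simp: t_def intro!: divide_neg_pos)
  have "t * (\<bar>b\<bar> + 1) \<le> - a / (\<bar>b\<bar> + 1) * (\<bar>b\<bar> + 1)"
    unfolding t_def by (intro mult_right_mono) auto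
  then have "t * (\<bar>b\<bar> + 1) \<le> - a" by simp
  then have "t * b \<le> - a" using t by (smt (verit) mult_left_mono)
  moreover have "0 \<le> t * (2 * a + t * b)" using assms[OF t] by (simp add: power2_eq_square algebra_simps)
  then have "0 \<le> 2 * a + t * b" using t by (simp add: zero_le_mult_iff)
  ultimately show False using a by linarith
qed

section \<open>Riesz representation, nearest points and orthogonal projections\<close>

context hilbert begin

text \<open>\<open>M\<close> is not assumed closed. The representing vector minimises
  \<open>\<parallel>u\<parallel>\<^sup>2 - 2 Re (Lam u)\<close> and is a limit of vectors
  \<open>\<sigma> n\<close> in \<open>M\<close>; the sequence is kept in the conclusion so that
  \<open>projection_closed\<close> can place \<open>l\<close> in a closed \<open>M\<close>.\<close>

lemma riesz:
  assumes M: "M \<subseteq> carr S" "0 \<in> M" "\<And>u v. u \<in> M \<Longrightarrow> v \<in> M \<Longrightarrow> u + v \<in> M" "\<And>u c. u \<in> M \<Longrightarrow> sc c u \<in> M"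
    and Lam: "\<And>u v. u \<in> M \<Longrightarrow> v \<in> M \<Longrightarrow> Lam (u + v) = Lam u + Lam v"
      "\<And>u c. u \<in> M \<Longrightarrow> Lam (sc c u) = c * Lam u"
    and bdd: "\<And>u. u \<in> M \<Longrightarrow> cmod (Lam u) \<le> C * nrm u" "0 \<le> C"
  obtains \<sigma> l where "\<And>n. \<sigma> n \<in> M" "l \<in> carr S" "(\<lambda>n. nrm (\<sigma> n - l)) \<longlonglongrightarrow> 0"
    "\<And>v. v \<in> M \<Longrightarrow> Lam v = ip S v l" "nrm l \<le> C"
proof -
  have low: "- C\<^sup>2 \<le> (nrm u)\<^sup>2 - 2 * Re (Lam u)" if "u \<in> M" for u
  proof -
    have "Re (Lam u) \<le> C * nrm u" using bdd(1)[OF that] complex_Re_le_cmod order_trans by blast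
    moreover have "0 \<le> (nrm u - C)\<^sup>2" by simp
    ultimately show ?thesis by (simp add: power2_diff algebra_simps)
  qed
  obtain \<sigma> l d where \<sigma>: "\<And>n. \<sigma> n \<in> M" and l: "l \<in> carr S" "(\<lambda>n. nrm (\<sigma> n - l)) \<longlonglongrightarrow> 0"
    and d: "\<And>u. u \<in> M \<Longrightarrow> d \<le> (nrm u)\<^sup>2 - 2 * Re (Lam u)" 
    and lim: "(\<lambda>n. (nrm (\<sigma> n))\<^sup>2 - 2 * Re (Lam (\<sigma> n))) \<longlonglongrightarrow> d"
    using minimizing_sequence[of M "\<lambda>u. Re (Lam u)" "- C\<^sup>2"] M Lam low
    by (auto simp: subset_iff)
  have \<sigma>S: "\<sigma> n \<in> carr S" for n using \<sigma> M by blast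
  have ge: "0 \<le> Re (ip S l v) - Re (Lam v)" if v: "v \<in> M" for v
  proof (rule quadratic_nonneg_imp)
    fix t :: real
    have vS: "v \<in> carr S" using v M by blast
    have "(\<lambda>n. (nrm (\<sigma> n))\<^sup>2 - 2 * Re (Lam (\<sigma> n)) + 2 * t * (Re (ip S (\<sigma> n) v) - Re (Lam v)) + t\<^sup>2 * (nrm v)\<^sup>2)
        \<longlonglongrightarrow> d + 2 * t * (Re (ip S l v) - Re (Lam v)) + t\<^sup>2 * (nrm v)\<^sup>2"
      by (intro tendsto_intros lim ip_tendsto \<sigma>S l vS)
    moreover have "d \<le> (nrm (\<sigma> n))\<^sup>2 - 2 * Re (Lam (\<sigma> n)) + 2 * t * (Re (ip S (\<sigma> n) v) - Re (Lam v)) + t\<^sup>2 * (nrm v)\<^sup>2" for n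
    proof -
      have "d \<le> (nrm (\<sigma> n + sc t v))\<^sup>2 - 2 * Re (Lam (\<sigma> n + sc t v))"
        by (intro d M \<sigma> v)
      also have "\<dots> = (nrm (\<sigma> n))\<^sup>2 - 2 * Re (Lam (\<sigma> n)) + 2 * t * (Re (ip S (\<sigma> n) v) - Re (Lam v)) + t\<^sup>2 * (nrm v)\<^sup>2"
        using \<sigma>S vS v \<sigma> M by (simp add: nrm_add_sq nrm_sc Lam ip_sc_right power_mult_distrib algebra_simps)
      finally show ?thesis .
    qed
    ultimately have "d \<le> d + 2 * t * (Re (ip S l v) - Re (Lam v)) + t\<^sup>2 * (nrm v)\<^sup>2"
      by (meson LIMSEQ_le_const)
    then show "0 \<le> 2 * t * (Re (ip S l v) - Re (Lam v)) + t\<^sup>2 * (nrm v)\<^sup>2" by simp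
  qed
  have Re_eq: "Re (Lam v) = Re (ip S v l)" if v: "v \<in> M" for v
  proof -
    have vS: "v \<in> carr S" using v M by blast
    have "0 \<le> Re (ip S l (sc (-1) v)) - Re (Lam (sc (-1) v))" using ge M v by blast
    then show ?thesis using ge[OF v] v vS l ip_cnj[OF vS l(1)] by (simp add: Lam ip_sc_right)
  qed
  have eq: "Lam v = ip S v l" if v: "v \<in> M" for v
  proof -
    have vS: "v \<in> carr S" using v M by blast
    \<comment> \<open>The imaginary part at \<open>v\<close> is the real part at
      \<open>-\<i> v\<close>.\<close>
    have "Re (Lam (sc (- \<i>) v)) = Re (ip S (sc (- \<i>) v) l)" using Re_eq M v by blast
    then have "Im (Lam v) = Im (ip S v l)" using v vS l by (simp add: Lam ip_sc)
    then show ?thesis using Re_eq[OF v] complex_eqI by blast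
  qed
  \<comment> \<open>\<open>l\<close> may lie outside \<open>M\<close>, so the bound is applied to
    \<open>\<sigma> n\<close> and passes to the limit.\<close>
  have "(\<lambda>n. cmod (ip S (\<sigma> n) l)) \<longlonglongrightarrow> cmod (ip S l l)"
    by (intro tendsto_norm ip_tendsto \<sigma>S l)
  moreover have "(\<lambda>n. C * nrm (\<sigma> n)) \<longlonglongrightarrow> C * nrm l"
    by (intro tendsto_mult tendsto_const nrm_tendsto \<sigma>S l)
  moreover have "cmod (ip S (\<sigma> n) l) \<le> C * nrm (\<sigma> n)" for n
    using bdd(1)[OF \<sigma>] eq[OF \<sigma>] by metis
  ultimately have "cmod (ip S l l) \<le> C * nrm l" by (meson LIMSEQ_le)
  then have "nrm l * nrm l \<le> C * nrm l" using l by (simp add: ip_self power2_eq_square norm_mult)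
  then have "nrm l \<le> C" using bdd(2) l(1) nrm_nonneg[OF l(1)] by (metis mult_le_cancel_right order_le_less not_le)
  then show thesis using that \<sigma> l eq by blast
qed

text \<open>The functional is given by its graph because it may be specified through a
  representation of \<open>u\<close>, such as a combination of kernel functions, that is not unique.
  The bound makes it well defined: two values \<open>a\<close>, \<open>b\<close> at \<open>u\<close>
  give the value \<open>a - b\<close> at \<open>0\<close>.\<close>

lemma riesz_relation:
  assumes R: "R 0 0" "\<And>u v a b. R u a \<Longrightarrow> R v b \<Longrightarrow> R (u + v) (a + b)" "\<And>u a c. R u a \<Longrightarrow> R (sc c u) (c * a)"
    and bdd: "\<And>u a. R u a \<Longrightarrow> u \<in> carr S \<and> cmod a \<le> C * nrm u" "0 \<le> C"
  obtains l where "l \<in> carr S" "nrm l \<le> C" "\<And>u a. R u a \<Longrightarrow> a = ip S u l"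
proof -
  define Lam where "Lam u = (THE a. R u a)" for u
  have uniq: "a = b" if "R u a" "R u b" for u a b
  proof -
    have u: "u \<in> carr S" using bdd that by blast
    then have "u + sc (-1) u = 0" by (simp add: minus_sc[symmetric])
    then have "R 0 (a + (-1) * b)" using R(2)[OF that(1) R(3)[OF that(2), of "-1"]] by simp
    then show ?thesis using bdd(1)[of 0 "a + (-1) * b"] by simp
  qed
  have Lam: "Lam u = a" if "R u a" for u a
    unfolding Lam_def using that uniq by blast
  obtain \<sigma> l where "l \<in> carr S" "nrm l \<le> C" "\<And>v. v \<in> {u. \<exists>a. R u a} \<Longrightarrow> Lam v = ip S v l"
  proof (rule riesz[of "{u. \<exists>a. R u a}" Lam C])
    show "{u. \<exists>a. R u a} \<subseteq> carr S" using bdd by blast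
    show "0 \<in> {u. \<exists>a. R u a}" using R(1) by blast
    show "u + v \<in> {u. \<exists>a. R u a}" if "u \<in> {u. \<exists>a. R u a}" "v \<in> {u. \<exists>a. R u a}" for u v
      using that R(2) by blast
    show "sc c u \<in> {u. \<exists>a. R u a}" if "u \<in> {u. \<exists>a. R u a}" for u c using that R(3) by blast
    show "Lam (u + v) = Lam u + Lam v" if "u \<in> {u. \<exists>a. R u a}" "v \<in> {u. \<exists>a. R u a}" for u v
      using that R(2) Lam by fastforce
    show "Lam (sc c u) = c * Lam u" if "u \<in> {u. \<exists>a. R u a}" for u c using that R(3) Lam by fastforce
    show "cmod (Lam u) \<le> C * nrm u" if "u \<in> {u. \<exists>a. R u a}" for u using that bdd(1) Lam by fastforce
  qed (use bdd in auto)
  then show thesis using that Lam by blast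
qed

text \<open>The functional \<open>\<parallel>u\<parallel>\<^sup>2 - 2 Re \<langle>u,
  z\<rangle>\<close> differs from \<open>\<parallel>u - z\<parallel>\<^sup>2\<close> by a constant.
  \<open>M\<close> is convex but not assumed closed, so \<open>p\<close> is a limit of points of
  \<open>M\<close>; the last conclusion is the obtuse angle condition at \<open>p\<close>.\<close>

lemma nearest_point:
  assumes M: "M \<subseteq> carr S" "M \<noteq> {}" and z: "z \<in> carr S"
    and conv: "\<And>u v t. u \<in> M \<Longrightarrow> v \<in> M \<Longrightarrow> 0 \<le> t \<Longrightarrow> t \<le> 1 \<Longrightarrow> u + sc (complex_of_real t) (v - u) \<in> M"
  obtains \<sigma> p where "\<And>n. \<sigma> n \<in> M" "p \<in> carr S" "(\<lambda>n. nrm (\<sigma> n - p)) \<longlonglongrightarrow> 0"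
    "\<And>y. y \<in> M \<Longrightarrow> Re (ip S (y - p) (z - p)) \<le> 0"
proof -
  have half: "sc (1/2) (u + v) = u + sc (complex_of_real (1/2)) (v - u)" if "u \<in> M" "v \<in> M" for u v
    using that M z by (intro eqI) (auto simp: subset_iff ip_add ip_diff ip_sc algebra_simps)
  have low: "- (nrm z)\<^sup>2 \<le> (nrm u)\<^sup>2 - 2 * Re (ip S u z)" if "u \<in> M" for u
  proof -
    have "u \<in> carr S" using that M by blast
    then show ?thesis using nrm_diff_sq[of u z] zero_le_power2[of "nrm (u - z)"] z by linarith
  qed
  obtain \<sigma> p d where \<sigma>: "\<And>n. \<sigma> n \<in> M" and p: "p \<in> carr S" "(\<lambda>n. nrm (\<sigma> n - p)) \<longlonglongrightarrow> 0"
    and d: "\<And>u. u \<in> M \<Longrightarrow> d \<le> (nrm u)\<^sup>2 - 2 * Re (ip S u z)"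
    and lim: "(\<lambda>n. (nrm (\<sigma> n))\<^sup>2 - 2 * Re (ip S (\<sigma> n) z)) \<longlonglongrightarrow> d"
  proof (rule minimizing_sequence[of M "\<lambda>u. Re (ip S u z)" "- (nrm z)\<^sup>2"])
    show "sc (1/2) (u + v) \<in> M" if "u \<in> M" "v \<in> M" for u v
      using that half conv[of u v "1/2"] by simp
    show "Re (ip S (sc (1/2) (u + v)) z) = (Re (ip S u z) + Re (ip S v z)) / 2" if "u \<in> M" "v \<in> M" for u v
      using that M z by (simp add: subset_iff ip_sc ip_add)
  qed (use M low in auto)
  have \<sigma>S: "\<sigma> n \<in> carr S" for n using \<sigma> M by blast
  have "Re (ip S (y - p) (z - p)) \<le> 0" if y: "y \<in> M" for y
  proof -
    have yS: "y \<in> carr S" using y M by blast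
    have "0 \<le> Re (ip S p (y - p)) - Re (ip S z (y - p))"
    proof (rule quadratic_nonneg_imp)
      fix t :: real assume t: "0 < t" "t \<le> 1"
      have lim1: "(\<lambda>n. nrm ((y - \<sigma> n) - (y - p))) \<longlonglongrightarrow> 0"
        using p(2) nrm_diff_commute[OF \<sigma>S p(1)] by simp
      have lim2: "(\<lambda>n. Re (ip S (\<sigma> n) (y - \<sigma> n))) \<longlonglongrightarrow> Re (ip S p (y - p))"
      proof -
        have "(\<lambda>n. Re (ip S (\<sigma> n) y) - (nrm (\<sigma> n))\<^sup>2) \<longlonglongrightarrow> Re (ip S p y) - (nrm p)\<^sup>2"
          by (intro tendsto_intros ip_tendsto nrm_tendsto \<sigma>S p yS)
        then show ?thesis using \<sigma>S yS p by (simp add: ip_diff_right nrm_sq)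
      qed
      have "(\<lambda>n. (nrm (\<sigma> n))\<^sup>2 - 2 * Re (ip S (\<sigma> n) z) + 2 * t * (Re (ip S (\<sigma> n) (y - \<sigma> n)) - Re (ip S z (y - \<sigma> n)))
                + t\<^sup>2 * (nrm (y - \<sigma> n))\<^sup>2)
          \<longlonglongrightarrow> d + 2 * t * (Re (ip S p (y - p)) - Re (ip S z (y - p))) + t\<^sup>2 * (nrm (y - p))\<^sup>2"
        by (intro tendsto_intros lim lim2 ip_tendsto_right nrm_tendsto diff_mem \<sigma>S p yS z lim1)
      moreover have "d \<le> (nrm (\<sigma> n))\<^sup>2 - 2 * Re (ip S (\<sigma> n) z)
          + 2 * t * (Re (ip S (\<sigma> n) (y - \<sigma> n)) - Re (ip S z (y - \<sigma> n))) + t\<^sup>2 * (nrm (y - \<sigma> n))\<^sup>2" for n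
      proof -
        have w: "y - \<sigma> n \<in> carr S" using yS \<sigma>S by simp
        have "d \<le> (nrm (\<sigma> n + sc t (y - \<sigma> n)))\<^sup>2 - 2 * Re (ip S (\<sigma> n + sc t (y - \<sigma> n)) z)"
          using t by (intro d conv \<sigma> y) auto
        also have "\<dots> = (nrm (\<sigma> n))\<^sup>2 - 2 * Re (ip S (\<sigma> n) z)
          + 2 * t * (Re (ip S (\<sigma> n) (y - \<sigma> n)) - Re (ip S (y - \<sigma> n) z)) + t\<^sup>2 * (nrm (y - \<sigma> n))\<^sup>2"
          using \<sigma>S w z nrm_add_sq[OF \<sigma>S[of n] sc_mem[OF w, of t]] nrm_sc[OF w, of t] ip_sc_right[OF w \<sigma>S[of n], of t]
            ip_add[OF \<sigma>S[of n] sc_mem[OF w, of t] z] ip_sc[OF w z, of t]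
          by (simp add: power_mult_distrib algebra_simps)
        also have "Re (ip S (y - \<sigma> n) z) = Re (ip S z (y - \<sigma> n))"
          using ip_cnj[OF w z] by simp
        finally show ?thesis .
      qed
      ultimately have "d \<le> d + 2 * t * (Re (ip S p (y - p)) - Re (ip S z (y - p))) + t\<^sup>2 * (nrm (y - p))\<^sup>2"
        by (meson LIMSEQ_le_const)
      then show "0 \<le> 2 * t * (Re (ip S p (y - p)) - Re (ip S z (y - p))) + t\<^sup>2 * (nrm (y - p))\<^sup>2" by simp
    qed
    moreover have "ip S (y - p) (z - p) = cnj (ip S z (y - p)) - cnj (ip S p (y - p))"
      using yS p(1) z ip_diff_right[OF z p(1) diff_mem[OF yS p(1)]] ip_cnj[OF z diff_mem[OF yS p(1)]]
        ip_cnj[OF p(1) diff_mem[OF yS p(1)]] by simp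
    ultimately show ?thesis by simp
  qed
  then show thesis using that \<sigma> p by blast
qed

definition orth :: "'v set \<Rightarrow> 'v set"
  where "orth B = {v \<in> carr S. \<forall>u\<in>B. ip S u v = 0}"

lemma orth_carr: "orth B \<subseteq> carr S" by (auto simp: orth_def)

lemma orth_mem: "v \<in> orth B \<Longrightarrow> v \<in> carr S" by (simp add: orth_def)

lemma orthD: "v \<in> orth B \<Longrightarrow> u \<in> B \<Longrightarrow> ip S u v = 0" by (simp add: orth_def)

lemma orth_zero [simp]: "B \<subseteq> carr S \<Longrightarrow> 0 \<in> orth B"
  by (auto simp: orth_def)

lemma orth_add: "B \<subseteq> carr S \<Longrightarrow> u \<in> orth B \<Longrightarrow> v \<in> orth B \<Longrightarrow> u + v \<in> orth B"
  by (auto simp: orth_def subset_iff ip_add_right)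

lemma orth_diff: "B \<subseteq> carr S \<Longrightarrow> u \<in> orth B \<Longrightarrow> v \<in> orth B \<Longrightarrow> u - v \<in> orth B"
  by (auto simp: orth_def subset_iff ip_diff_right)

lemma orth_sc: "B \<subseteq> carr S \<Longrightarrow> u \<in> orth B \<Longrightarrow> sc c u \<in> orth B"
  by (auto simp: orth_def subset_iff ip_sc_right)

lemma orth_closed:
  assumes "B \<subseteq> carr S" "\<And>n. \<sigma> n \<in> orth B" "l \<in> carr S" "(\<lambda>n. nrm (\<sigma> n - l)) \<longlonglongrightarrow> 0"
  shows "l \<in> orth B"
proof -
  have "ip S u l = 0" if u: "u \<in> B" for u
  proof -
    have "(\<lambda>n. ip S u (\<sigma> n)) \<longlonglongrightarrow> ip S u l"
      by (rule ip_tendsto_right) (use assms u orth_mem in auto)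
    moreover have "ip S u (\<sigma> n) = 0" for n using assms(2) u orthD by blast
    ultimately show ?thesis by (simp add: LIMSEQ_const_iff)
  qed
  then show ?thesis using assms by (simp add: orth_def)
qed

lemma orth_orth_sup: "B \<subseteq> carr S \<Longrightarrow> u \<in> B \<Longrightarrow> u \<in> orth (orth B)"
  using ip_cnj by (fastforce simp: orth_def)

lemma orth_mono: "B \<subseteq> B' \<Longrightarrow> orth B' \<subseteq> orth B"
  by (auto simp: orth_def)

lemma orth_inter: "B \<subseteq> carr S \<Longrightarrow> u \<in> orth B \<Longrightarrow> u \<in> orth (orth B) \<Longrightarrow> u = 0"
  by (metis ip_definite orthD orth_mem)

lemma ip_orth_orth: "u \<in> orth (orth B) \<Longrightarrow> v \<in> orth B \<Longrightarrow> ip S u v = 0"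
  by (metis complex_cnj_zero ip_cnj orthD orth_mem)

lemma projection_closed:
  assumes M: "M \<subseteq> carr S" "0 \<in> M" "\<And>u v. u \<in> M \<Longrightarrow> v \<in> M \<Longrightarrow> u + v \<in> M" "\<And>u c. u \<in> M \<Longrightarrow> sc c u \<in> M"
    and cl: "\<And>\<sigma> l. (\<And>n. \<sigma> n \<in> M) \<Longrightarrow> l \<in> carr S \<Longrightarrow> (\<lambda>n. nrm (\<sigma> n - l)) \<longlonglongrightarrow> 0 \<Longrightarrow> l \<in> M"
    and a: "a \<in> carr S"
  shows "\<exists>p\<in>M. a - p \<in> orth M"
proof -
  obtain \<sigma> p where *: "\<And>n. \<sigma> n \<in> M" "p \<in> carr S" "(\<lambda>n. nrm (\<sigma> n - p)) \<longlonglongrightarrow> 0"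
    "\<And>v. v \<in> M \<Longrightarrow> ip S v a = ip S v p"
  proof (rule riesz[of M "\<lambda>v. ip S v a" "nrm a"])
    show "cmod (ip S u a) \<le> nrm a * nrm u" if "u \<in> M" for u
      using cauchy_schwarz[of u a] that M a by (auto simp: mult.commute)
  qed (use M a in \<open>auto simp: subset_iff ip_add ip_sc\<close>)
  then have "p \<in> M" using cl by blast
  moreover have "a - p \<in> orth M" using * M a by (auto simp: orth_def subset_iff ip_diff_right)
  ultimately show ?thesis by blast
qed

text \<open>Double orthogonal complements serve as closed linear spans; the triple complement
  \<open>orth (orth (orth B))\<close> reduces to \<open>orth B\<close>.\<close>

lemma projection:
  assumes B: "B \<subseteq> carr S" and a: "a \<in> carr S"
  obtains p where "p \<in> orth (orth B)" "a - p \<in> orth B"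
proof -
  have "\<exists>p\<in>orth (orth B). a - p \<in> orth (orth (orth B))"
    using orth_closed[OF orth_carr] orth_add[OF orth_carr] orth_sc[OF orth_carr] orth_carr a
    by (intro projection_closed) (auto simp: orth_carr intro: orth_zero[OF orth_carr])
  moreover have "orth (orth (orth B)) \<subseteq> orth B"
    using B by (intro orth_mono) (auto intro: orth_orth_sup)
  ultimately show thesis using that by blast
qed

lemma orth_orth_closed:
  assumes M: "M \<subseteq> carr S" "0 \<in> M" "\<And>u v. u \<in> M \<Longrightarrow> v \<in> M \<Longrightarrow> u + v \<in> M" "\<And>u c. u \<in> M \<Longrightarrow> sc c u \<in> M"
    and cl: "\<And>\<sigma> l. (\<And>n. \<sigma> n \<in> M) \<Longrightarrow> l \<in> carr S \<Longrightarrow> (\<lambda>n. nrm (\<sigma> n - l)) \<longlonglongrightarrow> 0 \<Longrightarrow> l \<in> M"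
  shows "orth (orth M) \<subseteq> M"
proof
  fix v assume v: "v \<in> orth (orth M)"
  obtain p where p: "p \<in> M" "v - p \<in> orth M" proof -
    have "\<exists>p\<in>M. v - p \<in> orth M" by (rule projection_closed) (fact M cl orth_mem[OF v])+
    then show thesis using that by blast
  qed
  have "v - p \<in> orth (orth M)"
    using v p orth_diff[OF orth_carr] orth_orth_sup[OF M(1)] by blast
  then have "v - p = 0" using orth_inter[OF M(1) p(2)] by blast
  then show "v \<in> M" using p by simp
qed

lemma subspace_hilbert:
  assumes M: "M \<subseteq> carr S" "0 \<in> M" "\<And>u v. u \<in> M \<Longrightarrow> v \<in> M \<Longrightarrow> u + v \<in> M" "\<And>u c. u \<in> M \<Longrightarrow> sc c u \<in> M"
    and cl: "\<And>\<sigma> l. (\<And>n. \<sigma> n \<in> M) \<Longrightarrow> l \<in> carr S \<Longrightarrow> (\<lambda>n. nrm (\<sigma> n - l)) \<longlonglongrightarrow> 0 \<Longrightarrow> l \<in> M"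
  shows "hilbert (S\<lparr>carr := M\<rparr>) sc"
proof -
  have nrm_eq: "hnorm (S\<lparr>carr := M\<rparr>) v = nrm v" for v by (simp add: hnorm_def)
  show ?thesis
  proof (unfold_locales; (unfold nrm_eq)?)
    fix \<sigma> :: "nat \<Rightarrow> 'v"
    assume \<sigma>: "\<And>n. \<sigma> n \<in> carr (S\<lparr>carr := M\<rparr>)"
      and c: "\<And>e. 0 < e \<Longrightarrow> \<exists>N. \<forall>m\<ge>N. \<forall>n\<ge>N. nrm (\<sigma> m - \<sigma> n) < e"
    have "\<sigma> n \<in> carr S" for n using \<sigma> M(1) by auto
    from complete[OF this c] obtain l where "l \<in> carr S" "(\<lambda>n. nrm (\<sigma> n - l)) \<longlonglongrightarrow> 0" by blast
    then show "\<exists>l\<in>carr (S\<lparr>carr := M\<rparr>). (\<lambda>n. nrm (\<sigma> n - l)) \<longlonglongrightarrow> 0" using cl \<sigma> by auto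
  qed (use M minus_sc in \<open>auto simp: subset_iff ip_add ip_sc ip_nonneg intro: ip_cnj ip_definite\<close>)
qed

lemma orthonormal_partial:
  assumes e: "\<And>n. e n \<in> carr S" and on: "\<And>m n. ip S (e m) (e n) = of_bool (m = n)"
  shows "finite I \<Longrightarrow> nrm (\<Sum>w\<in>I. sc (c w) (e w)) ^ 2 = (\<Sum>w\<in>I. (cmod (c w))\<^sup>2)"
proof -
  assume I: "finite I"
  have "(\<Sum>y\<in>I. c x * cnj (c y) * ip S (e x) (e y)) = complex_of_real ((cmod (c x))\<^sup>2)" if "x \<in> I" for x
  proof -
    have "(\<Sum>y\<in>I. c x * cnj (c y) * ip S (e x) (e y)) = (\<Sum>y\<in>I. if x = y then c x * cnj (c y) else 0)"
      by (intro sum.cong refl) (simp add: on)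
    then show ?thesis using I that unfolding complex_norm_square by simp
  qed
  then show ?thesis using e by (simp add: nrm_lincomb_sq)
qed

lemma bessel:
  assumes e: "\<And>n. e n \<in> carr S" and on: "\<And>m n. ip S (e m) (e n) = of_bool (m = n)"
    and a: "a \<in> carr S" and I: "finite I"
  shows "(\<Sum>w\<in>I. (cmod (ip S a (e w)))\<^sup>2) \<le> (nrm a)\<^sup>2"
proof -
  define p where "p = (\<Sum>w\<in>I. sc (ip S a (e w)) (e w))"
  have p: "p \<in> carr S" using e by (simp add: p_def)
  have s: "(nrm p)\<^sup>2 = (\<Sum>w\<in>I. (cmod (ip S a (e w)))\<^sup>2)"
    unfolding p_def using e on I by (rule orthonormal_partial)
  have "ip S a p = complex_of_real (\<Sum>w\<in>I. (cmod (ip S a (e w)))\<^sup>2)"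
    unfolding p_def of_real_sum complex_norm_square using a e by (simp add: ip_sum_right ip_sc_right mult.commute)
  then have "Re (ip S a p) = (\<Sum>w\<in>I. (cmod (ip S a (e w)))\<^sup>2)" by simp
  then have "(nrm (a - p))\<^sup>2 = (nrm a)\<^sup>2 - (\<Sum>w\<in>I. (cmod (ip S a (e w)))\<^sup>2)"
    using a p s by (simp add: nrm_diff_sq)
  then show ?thesis by (metis diff_ge_0_iff_ge zero_le_power2)
qed

text \<open>The partial sums of the expansion are Cauchy by Bessel's inequality. Their limit has the
  same coefficients as \<open>a\<close>, so the difference is orthogonal to all \<open>e n\<close>
  while lying in their closed span.\<close>

lemma parseval:
  assumes e: "\<And>n::nat. e n \<in> carr S" and on: "\<And>m n. ip S (e m) (e n) = of_bool (m = n)"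
    and a: "a \<in> orth (orth (range e))" and z: "z \<in> carr S"
  shows "(\<lambda>n. ip S a (e n) * ip S (e n) z) sums ip S a z"
proof -
  have aS: "a \<in> carr S" using a orth_mem by blast
  define \<sigma> where "\<sigma> n = (\<Sum>w<n. sc (ip S a (e w)) (e w))" for n
  have \<sigma>S: "\<sigma> n \<in> carr S" for n using e by (simp add: \<sigma>_def)
  have sm: "summable (\<lambda>w. (cmod (ip S a (e w)))\<^sup>2)"
    by (rule bounded_imp_summable[of _ "(nrm a)\<^sup>2"]) (use bessel[OF e on aS, of "{.._}"] in auto)
  have dist: "(nrm (\<sigma> n - \<sigma> m))\<^sup>2 = (\<Sum>w\<in>{m..<n}. (cmod (ip S a (e w)))\<^sup>2)" if "m \<le> n" for m n
  proof -
    have "{..<n} - {..<m} = {m..<n}" by auto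
    then have "\<sigma> n - \<sigma> m = (\<Sum>w\<in>{m..<n}. sc (ip S a (e w)) (e w))"
      using that sum_diff[of "{..<n}" "{..<m}" "\<lambda>w. sc (ip S a (e w)) (e w)"] by (auto simp: \<sigma>_def)
    then show ?thesis using orthonormal_partial[OF e on, of "{m..<n}" "\<lambda>w. ip S a (e w)"] by simp
  qed
  have "\<exists>N. \<forall>m\<ge>N. \<forall>n\<ge>N. nrm (\<sigma> m - \<sigma> n) < d" if d: "d > 0" for d
  proof -
    obtain N where N: "\<And>m n. m \<ge> N \<Longrightarrow> norm (\<Sum>w\<in>{m..<n}. (cmod (ip S a (e w)))\<^sup>2) < d\<^sup>2"
      using sm d unfolding summable_Cauchy by (meson zero_less_power)
    have *: "nrm (\<sigma> n - \<sigma> m) < d" if "N \<le> m" "m \<le> n" for m n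
      by (rule power2_less_imp_less) (use N[OF that(1), of n] dist[OF that(2)] d in simp_all)
    have "nrm (\<sigma> m - \<sigma> n) < d" if "N \<le> m" "N \<le> n" for m n
      using *[of m n] *[of n m] that nrm_diff_commute[OF \<sigma>S \<sigma>S] by (metis nat_le_linear)
    then show ?thesis by blast
  qed
  from complete[OF \<sigma>S this] obtain l where l: "l \<in> carr S" "(\<lambda>n. nrm (\<sigma> n - l)) \<longlonglongrightarrow> 0" by blast
  have rng: "range e \<subseteq> carr S" using e by auto
  have e_in: "e n \<in> orth (orth (range e))" for n using orth_orth_sup[OF rng] by blast
  have "\<sigma> n \<in> orth (orth (range e))" for n
    unfolding \<sigma>_def
    by (induction n) (auto intro!: orth_add[OF orth_carr] orth_sc[OF orth_carr] e_in orth_zero[OF orth_carr])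
  then have l2: "l \<in> orth (orth (range e))" using orth_closed[OF orth_carr _ l] by blast
  have "ip S (e w) l = ip S (e w) a" for w
  proof -
    have "(\<lambda>n. ip S (e w) (\<sigma> n)) \<longlonglongrightarrow> ip S (e w) l" by (rule ip_tendsto_right[OF \<sigma>S l e])
    moreover have "ip S (e w) (\<sigma> n) = ip S (e w) a" if "n > w" for n
    proof -
      have "ip S (e w) (\<sigma> n) = (\<Sum>v<n. cnj (ip S a (e v)) * of_bool (w = v))"
        unfolding \<sigma>_def using e on by (simp add: ip_sum_right ip_sc_right)
      also have "\<dots> = cnj (ip S a (e w))" using that by (simp add: of_bool_def if_distrib cong: if_cong)
      finally show ?thesis using ip_cnj[OF aS e] by simp
    qed
    then have "(\<lambda>n. ip S (e w) (\<sigma> n)) \<longlonglongrightarrow> ip S (e w) a"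
      by (intro tendsto_eventually eventually_at_top_dense[THEN iffD2]) auto
    ultimately show ?thesis using LIMSEQ_unique by blast
  qed
  then have "a - l \<in> orth (range e)" using aS l e by (auto simp: orth_def ip_diff_right)
  moreover have "a - l \<in> orth (orth (range e))" using a l2 orth_diff[OF orth_carr] by blast
  ultimately have "a = l" using orth_inter[OF rng] by (metis eq_iff_diff_eq_0)
  have "(\<lambda>n. ip S (\<sigma> n) z) \<longlonglongrightarrow> ip S a z" using ip_tendsto[OF \<sigma>S l z] \<open>a = l\<close> by simp
  moreover have "ip S (\<sigma> n) z = (\<Sum>w<n. ip S a (e w) * ip S (e w) z)" for n
    unfolding \<sigma>_def using e z by (simp add: ip_sum ip_sc)
  ultimately show ?thesis by (simp add: sums_def)
qed

end

section \<open>Square summable sequences over a Hilbert space\<close>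

context hilbert begin

abbreviation T :: "(nat \<Rightarrow> 'v) hspace" where "T \<equiv> tensor_l2 S"

lemma tensor_mem_iff: "h \<in> carr T \<longleftrightarrow> (\<forall>i. h i \<in> carr S) \<and> summable (\<lambda>i. (nrm (h i))\<^sup>2)"
  by (simp add: tensor_l2_def)

lemma tensor_memD: "h \<in> carr T \<Longrightarrow> h i \<in> carr S"
  by (simp add: tensor_mem_iff)

lemma tensor_summable: "h \<in> carr T \<Longrightarrow> summable (\<lambda>i. (nrm (h i))\<^sup>2)"
  by (simp add: tensor_mem_iff)

lemma ip_tensor: "ip T h k = (\<Sum>i. ip S (h i) (k i))"
  by (simp add: tensor_l2_def)

lemma tensor_ip_summable:
  assumes "h \<in> carr T" "k \<in> carr T"
  shows "summable (\<lambda>i. ip S (h i) (k i))"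
proof (rule summable_comparison_test)
  show "\<exists>N. \<forall>i\<ge>N. cmod (ip S (h i) (k i)) \<le> (nrm (h i))\<^sup>2 + (nrm (k i))\<^sup>2"
  proof (intro exI allI impI)
    fix i
    have hk: "h i \<in> carr S" "k i \<in> carr S" using assms tensor_memD by auto
    have "cmod (ip S (h i) (k i)) \<le> nrm (h i) * nrm (k i)" using cauchy_schwarz hk by blast
    also have "\<dots> \<le> (nrm (h i))\<^sup>2 + (nrm (k i))\<^sup>2"
      using sum_squares_bound[of "nrm (h i)" "nrm (k i)"] mult_nonneg_nonneg[OF nrm_nonneg nrm_nonneg, OF hk]
      by linarith
    finally show "cmod (ip S (h i) (k i)) \<le> (nrm (h i))\<^sup>2 + (nrm (k i))\<^sup>2" .
  qed
  show "summable (\<lambda>i. (nrm (h i))\<^sup>2 + (nrm (k i))\<^sup>2)"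
    using assms tensor_summable by (intro summable_add) auto
qed

lemma tensor_ip_sums: "h \<in> carr T \<Longrightarrow> k \<in> carr T \<Longrightarrow> (\<lambda>i. ip S (h i) (k i)) sums ip T h k"
  using tensor_ip_summable by (simp add: ip_tensor summable_sums)

lemma tensor_self_sums:
  assumes "h \<in> carr T" shows "(\<lambda>i. (nrm (h i))\<^sup>2) sums Re (ip T h h)"
  using sums_Re[OF tensor_ip_sums[OF assms assms]] assms tensor_memD nrm_sq by simp

lemma tensor_ip_self: "h \<in> carr T \<Longrightarrow> Re (ip T h h) = (\<Sum>i. (nrm (h i))\<^sup>2)"
  by (rule sums_unique[OF tensor_self_sums])

lemma tensor_ip_self_nonneg: "h \<in> carr T \<Longrightarrow> 0 \<le> Re (ip T h h)"
  by (simp add: tensor_ip_self suminf_nonneg[OF tensor_summable])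

lemma tensor_nrm_sq: "h \<in> carr T \<Longrightarrow> (hnorm T h)\<^sup>2 = (\<Sum>i. (nrm (h i))\<^sup>2)"
  using tensor_ip_self_nonneg tensor_ip_self by (simp add: hnorm_def[of T])

lemma tensor_nrm_sums: "h \<in> carr T \<Longrightarrow> (\<lambda>i. (nrm (h i))\<^sup>2) sums (hnorm T h)\<^sup>2"
  using tensor_nrm_sq tensor_summable summable_sums by metis

lemma tensor_partial_le: "h \<in> carr T \<Longrightarrow> finite I \<Longrightarrow> (\<Sum>i\<in>I. (nrm (h i))\<^sup>2) \<le> (hnorm T h)\<^sup>2"
  using sum_le_suminf[OF tensor_summable] by (simp add: tensor_nrm_sq)

lemma tensor_nrm_nonneg: "h \<in> carr T \<Longrightarrow> 0 \<le> hnorm T h"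
  by (simp add: hnorm_def tensor_ip_self_nonneg)

lemma tensor_coord_le: "h \<in> carr T \<Longrightarrow> nrm (h i) \<le> hnorm T h"
  by (rule power2_le_imp_le) (use tensor_partial_le[of h "{i}"] tensor_nrm_nonneg in auto)

lemma tensor_memI:
  assumes "\<And>i. h i \<in> carr S" "\<And>n. (\<Sum>i<n. (nrm (h i))\<^sup>2) \<le> B\<^sup>2" "0 \<le> B"
  shows "h \<in> carr T" "hnorm T h \<le> B"
proof -
  have s: "summable (\<lambda>i. (nrm (h i))\<^sup>2)"
    by (rule bounded_imp_summable[of _ "B\<^sup>2"]) (use assms(2)[of "Suc _"] in \<open>auto simp: lessThan_Suc_atMost\<close>)
  then show h: "h \<in> carr T" using assms by (simp add: tensor_mem_iff)
  have "(hnorm T h)\<^sup>2 \<le> B\<^sup>2"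
    unfolding tensor_nrm_sq[OF h] by (rule suminf_le_const[OF s]) (rule assms(2))
  then show "hnorm T h \<le> B" using assms(3) by (rule power2_le_imp_le)
qed

lemma tensor_add_mem:
  assumes "h \<in> carr T" "k \<in> carr T" shows "h + k \<in> carr T"
proof -
  have "summable (\<lambda>i. (nrm (h i + k i))\<^sup>2)"
  proof (rule summable_comparison_test)
    show "summable (\<lambda>i. 2 * (nrm (h i))\<^sup>2 + 2 * (nrm (k i))\<^sup>2)"
      using assms tensor_summable by (intro summable_add summable_mult) auto
    show "\<exists>N. \<forall>i\<ge>N. norm ((nrm (h i + k i))\<^sup>2) \<le> 2 * (nrm (h i))\<^sup>2 + 2 * (nrm (k i))\<^sup>2"
    proof (intro exI allI impI)
      fix i
      have hk: "h i \<in> carr S" "k i \<in> carr S" using assms tensor_memD by auto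
      have "(nrm (h i + k i))\<^sup>2 \<le> (nrm (h i) + nrm (k i))\<^sup>2"
        using hk by (intro power_mono nrm_triangle) auto
      also have "\<dots> \<le> 2 * (nrm (h i))\<^sup>2 + 2 * (nrm (k i))\<^sup>2"
        using sum_squares_bound[of "nrm (h i)" "nrm (k i)"] by (simp add: power2_sum)
      finally show "norm ((nrm (h i + k i))\<^sup>2) \<le> 2 * (nrm (h i))\<^sup>2 + 2 * (nrm (k i))\<^sup>2" by simp
    qed
  qed
  then show ?thesis using assms by (simp add: tensor_mem_iff)
qed

lemma tensor_sc_mem: "h \<in> carr T \<Longrightarrow> (\<lambda>i. sc c (h i)) \<in> carr T"
  using summable_mult[of "\<lambda>i. (nrm (h i))\<^sup>2" "(cmod c)\<^sup>2"] by (simp add: tensor_mem_iff nrm_sc power_mult_distrib)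

lemma tensor_diff_mem:
  assumes "h \<in> carr T" "k \<in> carr T" shows "h - k \<in> carr T"
proof -
  have "h - k = h + (\<lambda>i. sc (-1) (k i))"
    using assms(2)[THEN tensor_memD] by (simp add: fun_eq_iff minus_sc[symmetric])
  then show ?thesis by (simp only: tensor_add_mem[OF assms(1) tensor_sc_mem[OF assms(2)]])
qed

lemma tensor_complete:
  assumes \<sigma>: "\<And>n. \<sigma> n \<in> carr T"
    and cauchy: "\<And>e. e > 0 \<Longrightarrow> \<exists>N. \<forall>m\<ge>N. \<forall>n\<ge>N. hnorm T (\<sigma> m - \<sigma> n) < e"
  shows "\<exists>l\<in>carr T. (\<lambda>n. hnorm T (\<sigma> n - l)) \<longlonglongrightarrow> 0"
proof -
  have \<sigma>S: "\<sigma> n i \<in> carr S" for n i using \<sigma> tensor_memD by blast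
  have dT: "\<sigma> m - \<sigma> n \<in> carr T" for m n using \<sigma> tensor_diff_mem by blast
  have "\<exists>l\<in>carr S. (\<lambda>n. nrm (\<sigma> n i - l)) \<longlonglongrightarrow> 0" for i
  proof (rule complete[OF \<sigma>S])
    fix e :: real assume "e > 0"
    then obtain N where "\<forall>m\<ge>N. \<forall>n\<ge>N. hnorm T (\<sigma> m - \<sigma> n) < e" using cauchy by blast
    then show "\<exists>N. \<forall>m\<ge>N. \<forall>n\<ge>N. nrm (\<sigma> m i - \<sigma> n i) < e"
      using tensor_coord_le[OF dT, of _ _ i] by (metis fun_diff_def order_le_less_trans)
  qed
  then obtain l where l: "\<And>i. l i \<in> carr S" "\<And>i. (\<lambda>n. nrm (\<sigma> n i - l i)) \<longlonglongrightarrow> 0" by metis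
  \<comment> \<open>The Cauchy estimate is passed to the limit in \<open>n\<close> on the first
    \<open>K\<close> coordinates; \<open>tensor_memI\<close> then yields membership and norm bound
    at once.\<close>
  have key: "\<exists>N. \<forall>m\<ge>N. \<sigma> m - l \<in> carr T \<and> hnorm T (\<sigma> m - l) \<le> e" if e: "e > 0" for e
  proof -
    obtain N where N: "\<And>m n. m \<ge> N \<Longrightarrow> n \<ge> N \<Longrightarrow> hnorm T (\<sigma> m - \<sigma> n) < e" using cauchy[OF e] by blast
    have "\<sigma> m - l \<in> carr T \<and> hnorm T (\<sigma> m - l) \<le> e" if m: "m \<ge> N" for m
    proof -
      have "(\<Sum>i<K. (nrm ((\<sigma> m - l) i))\<^sup>2) \<le> e\<^sup>2" for K
      proof (rule LIMSEQ_le_const2)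
        show "(\<lambda>n. \<Sum>i<K. (nrm (\<sigma> m i - \<sigma> n i))\<^sup>2) \<longlonglongrightarrow> (\<Sum>i<K. (nrm ((\<sigma> m - l) i))\<^sup>2)"
        proof (intro tendsto_sum tendsto_power)
          fix i
          have "(\<lambda>n. nrm ((\<sigma> m i - \<sigma> n i) - (\<sigma> m i - l i))) \<longlonglongrightarrow> 0"
            using l(2)[of i] nrm_diff_commute[OF \<sigma>S l(1)] by simp
          then show "(\<lambda>n. nrm (\<sigma> m i - \<sigma> n i)) \<longlonglongrightarrow> nrm ((\<sigma> m - l) i)"
            using nrm_tendsto[of "\<lambda>n. \<sigma> m i - \<sigma> n i" "\<sigma> m i - l i"] \<sigma>S l(1) by simp
        qed
        show "\<exists>M. \<forall>n\<ge>M. (\<Sum>i<K. (nrm (\<sigma> m i - \<sigma> n i))\<^sup>2) \<le> e\<^sup>2"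
        proof (intro exI allI impI)
          fix n assume n: "n \<ge> N"
          have "(\<Sum>i<K. (nrm (\<sigma> m i - \<sigma> n i))\<^sup>2) \<le> (hnorm T (\<sigma> m - \<sigma> n))\<^sup>2"
            using tensor_partial_le[OF dT, of "{..<K}" m n] by simp
          also have "\<dots> \<le> e\<^sup>2"
            using N[OF m n] tensor_nrm_nonneg[OF dT] by (intro power_mono) auto
          finally show "(\<Sum>i<K. (nrm (\<sigma> m i - \<sigma> n i))\<^sup>2) \<le> e\<^sup>2" .
        qed
      qed
      then show ?thesis using tensor_memI[of "\<sigma> m - l" e] \<sigma>S l(1) e by simp
    qed
    then show ?thesis by blast
  qed
  have lT: "l \<in> carr T"
  proof -
    obtain m where "\<sigma> m - l \<in> carr T" using key[of 1] by auto
    then have "\<sigma> m - (\<sigma> m - l) \<in> carr T" using \<sigma> tensor_diff_mem by blast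
    then show ?thesis by simp
  qed
  moreover have "(\<lambda>n. hnorm T (\<sigma> n - l)) \<longlonglongrightarrow> 0"
  proof (rule LIMSEQ_I)
    fix r :: real assume "r > 0"
    then obtain N where N: "\<forall>m\<ge>N. hnorm T (\<sigma> m - l) \<le> r / 2" using key[of "r / 2"] by auto
    have "norm (hnorm T (\<sigma> m - l) - 0) < r" if "m \<ge> N" for m
      using N that \<open>r > 0\<close> tensor_nrm_nonneg[OF tensor_diff_mem[OF \<sigma> lT], of m] by fastforce
    then show "\<exists>N. \<forall>m\<ge>N. norm (hnorm T (\<sigma> m - l) - 0) < r" by blast
  qed
  ultimately show ?thesis by blast
qed

lemma tensor_hilbert: "hilbert T (\<lambda>c h i. sc c (h i))"
proof
  show "0 \<in> carr T" by (simp add: tensor_mem_iff)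
  show "- u = (\<lambda>i. sc (-1) (u i))" if "u \<in> carr T" for u
    using tensor_memD[OF that] by (simp add: fun_eq_iff minus_sc[symmetric])
  show "ip T (u + v) w = ip T u w + ip T v w" if "u \<in> carr T" "v \<in> carr T" "w \<in> carr T" for u v w
    using sums_add[OF tensor_ip_sums[OF that(1,3)] tensor_ip_sums[OF that(2,3)]] that[THEN tensor_memD]
    by (simp add: ip_tensor[of "u + v"] ip_add sums_iff)
  show "ip T (\<lambda>i. sc c (u i)) w = c * ip T u w" if "u \<in> carr T" "w \<in> carr T" for u w c
    using sums_mult[OF tensor_ip_sums[OF that], of c] that[THEN tensor_memD]
    by (simp add: ip_tensor[of "\<lambda>i. sc c (u i)"] ip_sc sums_iff)
  show "ip T v u = cnj (ip T u v)" if "u \<in> carr T" "v \<in> carr T" for u v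
  proof -
    have "(\<lambda>i. ip S (v i) (u i)) = (\<lambda>i. cnj (ip S (u i) (v i)))"
      using that[THEN tensor_memD] ip_cnj by blast
    then have "(\<lambda>i. ip S (v i) (u i)) sums cnj (ip T u v)"
      using tensor_ip_sums[OF that] by (simp add: sums_cnj)
    then show ?thesis by (simp add: ip_tensor[of v] sums_iff)
  qed
  show "u = 0" if u: "u \<in> carr T" and 0: "ip T u u = 0" for u
  proof -
    have "hnorm T u = 0" using 0 by (simp add: hnorm_def)
    then have "nrm (u i) = 0" for i
      using tensor_coord_le[OF u, of i] tensor_memD[OF u, of i] by (simp add: order_antisym)
    then show ?thesis using nrm_eq_0 tensor_memD[OF u] by (simp add: fun_eq_iff)
  qed
qed (auto intro: tensor_add_mem tensor_sc_mem tensor_complete tensor_ip_self_nonneg)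

definition single :: "nat \<Rightarrow> 'v \<Rightarrow> nat \<Rightarrow> 'v"
  where "single i v = (\<lambda>n. if n = i then v else 0)"

lemma single_mem: "v \<in> carr S \<Longrightarrow> single i v \<in> carr T"
  unfolding tensor_mem_iff by (auto simp: single_def intro!: summable_finite[of "{i}"] split: if_splits)

lemma ip_single: "v \<in> carr S \<Longrightarrow> h \<in> carr T \<Longrightarrow> ip T h (single i v) = ip S (h i) v"
  unfolding ip_tensor by (subst suminf_finite[of "{i}"]) (auto simp: single_def tensor_memD)

lemma nrm_single: "v \<in> carr S \<Longrightarrow> hnorm T (single i v) = nrm v"
  unfolding hnorm_def using ip_single[OF _ single_mem, of v v i i] by (simp add: single_def)

lemma finite_support_mem: "(\<And>i. h i \<in> carr S) \<Longrightarrow> (\<And>i. i \<ge> n \<Longrightarrow> h i = 0) \<Longrightarrow> h \<in> carr T"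
  unfolding tensor_mem_iff by (auto intro!: summable_finite[of "{..<n}"]) (metis not_le nrm_zero)

text \<open>For \<open>g = cons_code i\<close> this is the creation operator of the letter
  \<open>i\<close>. It is an isometry, and by \<open>ip_push\<close> its adjoint reads off the
  entries at the positions \<open>g n\<close>.\<close>

definition push :: "(nat \<Rightarrow> nat) \<Rightarrow> (nat \<Rightarrow> 'v) \<Rightarrow> nat \<Rightarrow> 'v"
  where "push g h n = (if n \<in> range g then h (inv g n) else 0)"

lemma push_apply: "strict_mono g \<Longrightarrow> push g h (g n) = h n"
  by (simp add: push_def strict_mono_imp_inj_on)

lemma push_apply_notin: "n \<notin> range g \<Longrightarrow> push g h n = 0"
  by (simp add: push_def)

lemma push_mem:
  assumes g: "strict_mono g" and h: "h \<in> carr T" shows "push g h \<in> carr T"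
  using h summable_mono_reindex[OF g, of "\<lambda>n. (nrm (push g h n))\<^sup>2"]
  by (auto simp: tensor_mem_iff push_apply[OF g] push_apply_notin) (auto simp: push_def)

lemma pull_mem:
  assumes g: "strict_mono g" and h: "h \<in> carr T" shows "(\<lambda>n. h (g n)) \<in> carr T"
proof -
  have "summable ((\<lambda>n. (nrm (h n))\<^sup>2) \<circ> g)"
    using g h by (intro summable_reindex) (auto simp: tensor_mem_iff strict_mono_imp_inj_on)
  then show ?thesis using h by (simp add: tensor_mem_iff o_def)
qed

lemma ip_push:
  assumes g: "strict_mono g" and h: "h \<in> carr T" and k: "k \<in> carr T"
  shows "ip T (push g h) k = ip T h (\<lambda>n. k (g n))"
  unfolding ip_tensor
  by (subst suminf_mono_reindex[OF g, symmetric])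
    (auto simp: push_apply[OF g] push_apply_notin tensor_memD[OF k])

lemma push_pull: "strict_mono g \<Longrightarrow> (\<lambda>n. push g h (g n)) = h"
  by (simp add: push_apply)

lemma push_pull_disjoint: "range f \<inter> range g = {} \<Longrightarrow> (\<lambda>n. push g h (f n)) = 0"
  by (fastforce simp: push_def fun_eq_iff)

lemma nrm_push: "strict_mono g \<Longrightarrow> h \<in> carr T \<Longrightarrow> hnorm T (push g h) = hnorm T h"
  unfolding hnorm_def using ip_push[OF _ _ push_mem, of g h g h] by (simp add: push_pull)

text \<open>Squared norms add under this merge, so two sequences can be tested or dominated as
  one.\<close>

definition interleave :: "(nat \<Rightarrow> 'v) \<Rightarrow> (nat \<Rightarrow> 'v) \<Rightarrow> nat \<Rightarrow> 'v"
  where "interleave h k n = (if even n then h (n div 2) else k (n div 2))"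

lemma interleave_simps [simp]: "interleave h k (2 * n) = h n" "interleave h k (Suc (2 * n)) = k n"
  by (simp_all add: interleave_def)

lemma interleave_sums:
  fixes f :: "'v \<Rightarrow> 'a::real_normed_vector"
  assumes h: "(\<lambda>n. f (h n)) sums a" and k: "(\<lambda>n. f (k n)) sums b"
  shows "(\<lambda>n. f (interleave h k n)) sums (a + b)"
proof -
  let ?F = "\<lambda>n. f (interleave h k n)"
  have 1: "(\<lambda>n. if even n then ?F n else 0) sums a"
    by (subst sums_mono_reindex[of "\<lambda>n. 2 * n", symmetric]) (use h in \<open>auto simp: strict_mono_def elim!: evenE\<close>)
  have 2: "(\<lambda>n. if even n then 0 else ?F n) sums b"
    by (subst sums_mono_reindex[of "\<lambda>n. Suc (2 * n)", symmetric]) (use k in \<open>auto simp: strict_mono_def elim!: oddE\<close>)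
  have "(\<lambda>n. (if even n then ?F n else 0) + (if even n then 0 else ?F n)) = ?F" by auto
  then show ?thesis using sums_add[OF 1 2] by simp
qed

lemma interleave_mem:
  assumes h: "h \<in> carr T" and k: "k \<in> carr T"
  shows "interleave h k \<in> carr T" "(hnorm T (interleave h k))\<^sup>2 = (hnorm T h)\<^sup>2 + (hnorm T k)\<^sup>2"
proof -
  have s: "(\<lambda>n. (nrm (interleave h k n))\<^sup>2) sums ((hnorm T h)\<^sup>2 + (hnorm T k)\<^sup>2)"
    using interleave_sums[of "\<lambda>v. (nrm v)\<^sup>2"] tensor_nrm_sums h k by blast
  have "interleave h k n \<in> carr S" for n using h k by (simp add: interleave_def tensor_memD)
  then show m: "interleave h k \<in> carr T" using s by (simp add: tensor_mem_iff sums_summable)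
  show "(hnorm T (interleave h k))\<^sup>2 = (hnorm T h)\<^sup>2 + (hnorm T k)\<^sup>2"
    using s tensor_nrm_sums[OF m] sums_unique2 by blast
qed

end

section \<open>The scalars as a Hilbert space\<close>

definition cplx :: "complex hspace"
  where "cplx = \<lparr>carr = UNIV, ip = (\<lambda>x y. x * cnj y)\<rparr>"

lemma carr_cplx [simp]: "carr cplx = UNIV" by (simp add: cplx_def)

lemma ip_cplx [simp]: "ip cplx x y = x * cnj y" by (simp add: cplx_def)

lemma hnorm_cplx [simp]: "hnorm cplx x = cmod x"
  by (simp add: hnorm_def cmod_def flip: power2_eq_square)

lemma cplx_hilbert: "hilbert cplx (*)"
proof
  show "\<exists>l\<in>carr cplx. (\<lambda>n. hnorm cplx (\<sigma> n - l)) \<longlonglongrightarrow> 0"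
    if "\<And>e. e > 0 \<Longrightarrow> \<exists>N. \<forall>m\<ge>N. \<forall>n\<ge>N. hnorm cplx (\<sigma> m - \<sigma> n) < e" for \<sigma>
  proof -
    have "Cauchy \<sigma>" using that by (simp add: Cauchy_def dist_norm)
    then obtain l where "\<sigma> \<longlonglongrightarrow> l" using Cauchy_convergent convergent_def by blast
    then show ?thesis by (auto simp: LIM_zero_iff tendsto_norm_zero_iff)
  qed
  show "u = 0" if "ip cplx u u = 0" for u
    using that by (simp flip: complex_norm_square)
qed (auto simp: algebra_simps simp flip: power2_eq_square)

section \<open>Reproducing kernels\<close>

lemma sum_fun_apply: "(\<Sum>x\<in>F. f x) y = (\<Sum>x\<in>F. f x y)"
  by (induction F rule: infinite_finite_induct) auto

lemma (in rkhs) prehilbert: "prehilbert H (\<lambda>c f. (\<lambda>_. c) * f)"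
proof
  show "- u = (\<lambda>_. -1) * u" for u :: "'x \<Rightarrow> complex" by (simp add: fun_eq_iff)
  show "0 \<le> Re (ip H u u)" if "u \<in> carr H" for u
    using ip_nonneg[OF that] by (simp add: less_eq_complex_def)
qed (fact zero_mem add_mem scale_mem ip_add ip_scale ip_cnj ip_definite)+

sublocale rkhs \<subseteq> hs: prehilbert H "\<lambda>c f. (\<lambda>_. c) * f"
  by (rule prehilbert)

context rkhs begin

lemma metric: "Metric_space (carr H) (hdist H)"
proof
  show "0 \<le> hdist H x y" for x y by (simp add: hdist_def)
  show "hdist H x y = hdist H y x" for x y by (simp add: hdist_def hs.nrm_diff_commute)
  show "(hdist H x y = 0) = (x = y)" if "x \<in> carr H" "y \<in> carr H" for x y
    using that hs.nrm_eq_0[of "x - y"] by (auto simp: hdist_def)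
  show "hdist H x z \<le> hdist H x y + hdist H y z" if "x \<in> carr H" "y \<in> carr H" "z \<in> carr H" for x y z
    using that hs.nrm_diff_triangle by (simp add: hdist_def)
qed

lemma sequentially_complete:
  assumes "\<And>n. \<sigma> n \<in> carr H" "\<And>e. e > 0 \<Longrightarrow> \<exists>N. \<forall>m\<ge>N. \<forall>n\<ge>N. hnorm H (\<sigma> m - \<sigma> n) < e"
  shows "\<exists>l\<in>carr H. (\<lambda>n. hnorm H (\<sigma> n - l)) \<longlonglongrightarrow> 0"
proof -
  interpret Metric_space "carr H" "hdist H" by (rule metric)
  have "MCauchy \<sigma>"
    unfolding MCauchy_def using assms by (auto simp: hdist_def)
  then obtain l where "limitin mtopology \<sigma> l sequentially"
    using complete unfolding mcomplete_def by blast
  then have l: "l \<in> carr H" "(\<lambda>n. hdist H (\<sigma> n) l) \<longlonglongrightarrow> 0"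
    unfolding limitin_metric_dist_null by auto
  then show ?thesis using assms(1) by (auto simp: hdist_def)
qed

end

sublocale rkhs \<subseteq> hs: hilbert H "\<lambda>c f. (\<lambda>_. c) * f"
  by unfold_locales (rule sequentially_complete)

sublocale rkhs \<subseteq> ht: hilbert "tensor_l2 H" "\<lambda>c h i. (\<lambda>_. c) * h i"
  by (rule hs.tensor_hilbert)

context rkhs begin

abbreviation H2 :: "(nat \<Rightarrow> 'x \<Rightarrow> complex) hspace" where "H2 \<equiv> tensor_l2 H"

lemma kfun_props: "kfun H x \<in> carr H \<and> (\<forall>f\<in>carr H. f x = ip H f (kfun H x))"
proof -
  obtain C where C: "\<And>f. f \<in> carr H \<Longrightarrow> cmod (f x) \<le> C * hs.nrm f" using eval_bounded by blast
  have "\<exists>k. k \<in> carr H \<and> (\<forall>f\<in>carr H. f x = ip H f k)"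
  proof -
    obtain k where "k \<in> carr H" "\<And>f a. f \<in> carr H \<and> a = f x \<Longrightarrow> a = ip H f k"
    proof (rule hs.riesz_relation[of "\<lambda>f a. f \<in> carr H \<and> a = f x" "\<bar>C\<bar>"])
      show "f \<in> carr H \<and> cmod a \<le> \<bar>C\<bar> * hs.nrm f" if "f \<in> carr H \<and> a = f x" for f a
        using that C[of f] mult_right_mono[OF abs_ge_self[of C] hs.nrm_nonneg[of f]] by fastforce
    qed auto
    then show ?thesis by blast
  qed
  moreover have "k = k'" if "k \<in> carr H" "k' \<in> carr H" "\<forall>f\<in>carr H. f x = ip H f k" "\<forall>f\<in>carr H. f x = ip H f k'" for k k'
    using that ip_cnj by (intro hs.eqI) metis+
  ultimately have "\<exists>!k. k \<in> carr H \<and> (\<forall>f\<in>carr H. f x = ip H f k)" by blast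
  then show ?thesis unfolding kfun_def by (rule theI')
qed

lemma kfun_mem [simp, intro]: "kfun H x \<in> carr H" using kfun_props by blast

lemma reproducing: "f \<in> carr H \<Longrightarrow> ip H f (kfun H x) = f x" using kfun_props by metis

lemma reproducing': "f \<in> carr H \<Longrightarrow> ip H (kfun H x) f = cnj (f x)"
  using reproducing ip_cnj kfun_mem by metis

lemma kernel_eq: "kernel H x y = kfun H y x"
  by (simp add: kernel_def reproducing)

lemma kernel_cnj: "kernel H y x = cnj (kernel H x y)"
  using ip_cnj[of "kfun H y" "kfun H x"] by (simp add: kernel_def)

lemma kernel_diag: "kernel H x x = complex_of_real ((hs.nrm (kfun H x))\<^sup>2)"
  by (simp add: kernel_def hs.ip_self)

lemma eval_le: "f \<in> carr H \<Longrightarrow> cmod (f x) \<le> hs.nrm f * hs.nrm (kfun H x)"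
  using hs.cauchy_schwarz[of f "kfun H x"] by (simp add: reproducing)

lemma kernel_diag_ne: "kernel H x s \<noteq> 0 \<Longrightarrow> kernel H x x \<noteq> 0"
  using eval_le[of "kfun H s" x] by (auto simp: kernel_eq[of x s] kernel_diag)

definition kcomb :: "'x set \<Rightarrow> ('x \<Rightarrow> complex) \<Rightarrow> 'x \<Rightarrow> complex"
  where "kcomb F \<beta> = (\<Sum>x\<in>F. (\<lambda>_. \<beta> x) * kfun H x)"

lemma kcomb_mem [simp, intro]: "kcomb F \<beta> \<in> carr H"
  unfolding kcomb_def by (intro hs.sum_mem scale_mem kfun_mem)

lemma ip_kcomb: "f \<in> carr H \<Longrightarrow> ip H f (kcomb F \<beta>) = (\<Sum>x\<in>F. f x * cnj (\<beta> x))"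
  unfolding kcomb_def
  by (simp add: hs.ip_sum_right hs.ip_sc_right scale_mem reproducing mult.commute)

lemma kcomb_apply: "kcomb F \<beta> x = (\<Sum>y\<in>F. \<beta> y * kernel H x y)"
  unfolding kcomb_def by (simp add: kernel_eq sum_fun_apply)

lemma nrm_kcomb: "(hs.nrm (kcomb F \<beta>))\<^sup>2 = Re (\<Sum>x\<in>F. \<Sum>y\<in>F. \<beta> y * cnj (\<beta> x) * kernel H x y)"
proof -
  have "ip H (kcomb F \<beta>) (kcomb F \<beta>) = (\<Sum>x\<in>F. \<Sum>y\<in>F. \<beta> y * cnj (\<beta> x) * kernel H x y)"
    by (simp add: ip_kcomb kcomb_apply sum_distrib_left mult_ac)
  then show ?thesis by (simp add: hs.nrm_sq)
qed

lemma kcomb_superset: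
  "finite F' \<Longrightarrow> F \<subseteq> F' \<Longrightarrow> (\<And>x. x \<in> F' - F \<Longrightarrow> \<beta> x = 0) \<Longrightarrow> kcomb F' \<beta> = kcomb F \<beta>"
  unfolding kcomb_def by (rule sum.mono_neutral_right) (auto simp: fun_eq_iff)

lemma kcomb_add: "kcomb F (\<lambda>x. \<alpha> x + \<beta> x) = kcomb F \<alpha> + kcomb F \<beta>"
  by (simp add: fun_eq_iff kcomb_apply distrib_right sum.distrib)

lemma kcomb_scale: "kcomb F (\<lambda>x. c * \<beta> x) = (\<lambda>_. c) * kcomb F \<beta>"
  by (simp add: fun_eq_iff kcomb_apply sum_distrib_left mult.assoc)

text \<open>The bound makes \<open>q\<close> a functional on finitely supported sequences of finite
  kernel combinations. Riesz represents it by some \<open>l\<close>, and pairing with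
  \<open>k_x\<close> in slot \<open>n\<close> shows \<open>q n x = l n x\<close>. A combination does
  not determine its coefficients \<open>\<beta>\<close>, hence the relation
  \<open>R\<close>.\<close>

lemma tensor_membership:
  fixes q :: "nat \<Rightarrow> 'x \<Rightarrow> complex"
  assumes bdd: "\<And>F N \<beta>. finite F \<Longrightarrow> cmod (\<Sum>n<N. \<Sum>x\<in>F. q n x * cnj (\<beta> n x))
      \<le> C * sqrt (\<Sum>n<N. (hs.nrm (kcomb F (\<beta> n)))\<^sup>2)"
    and C: "0 \<le> C"
  shows "q \<in> carr H2" "ht.nrm q \<le> C"
proof -
  define good :: "'x set \<Rightarrow> nat \<Rightarrow> (nat \<Rightarrow> 'x \<Rightarrow> complex) \<Rightarrow> bool"
    where "good F N \<beta> \<longleftrightarrow> finite F \<and> (\<forall>n x. n \<ge> N \<or> x \<notin> F \<longrightarrow> \<beta> n x = 0)" for F N \<beta>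
  define E where "E F \<beta> = (\<lambda>n. kcomb F (\<beta> n))" for F and \<beta> :: "nat \<Rightarrow> 'x \<Rightarrow> complex"
  \<comment> \<open>The pairing in \<open>bdd\<close> is conjugate linear in \<open>\<beta>\<close>;
    its conjugate \<open>L\<close> is linear, as \<open>riesz_relation\<close> requires.\<close>
  define L where "L F N \<beta> = (\<Sum>n<N. \<Sum>x\<in>F. cnj (q n x) * \<beta> n x)" for F and N :: nat and \<beta> :: "nat \<Rightarrow> 'x \<Rightarrow> complex"
  define R where "R u a \<longleftrightarrow> (\<exists>F N \<beta>. good F N \<beta> \<and> u = E F \<beta> \<and> a = L F N \<beta>)" for u a
  have E_mem: "E F \<beta> \<in> carr H2" if "good F N \<beta>" for F N \<beta>
    using that by (intro hs.finite_support_mem[of _ N]) (auto simp: E_def good_def kcomb_def fun_eq_iff)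
  have E_norm: "ht.nrm (E F \<beta>) = sqrt (\<Sum>n<N. (hs.nrm (kcomb F (\<beta> n)))\<^sup>2)" if "good F N \<beta>" for F N \<beta>
  proof -
    have "kcomb F (\<beta> n) = 0" if "n \<ge> N" for n
      using that \<open>good F N \<beta>\<close> by (auto simp: good_def fun_eq_iff kcomb_apply)
    then have "(\<Sum>n. (hs.nrm (E F \<beta> n))\<^sup>2) = (\<Sum>n<N. (hs.nrm (E F \<beta> n))\<^sup>2)"
      by (intro suminf_finite) (auto simp: E_def not_less)
    then have "(ht.nrm (E F \<beta>))\<^sup>2 = (\<Sum>n<N. (hs.nrm (kcomb F (\<beta> n)))\<^sup>2)"
      using hs.tensor_nrm_sq[OF E_mem[OF that]] by (simp add: E_def)
    then show ?thesis using hs.tensor_nrm_nonneg[OF E_mem[OF that]] by (metis real_sqrt_unique)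
  qed
  have enlarge: "good F' N' \<beta> \<and> E F' \<beta> = E F \<beta> \<and> L F' N' \<beta> = L F N \<beta>"
    if "good F N \<beta>" "finite F'" "F \<subseteq> F'" "N \<le> N'" for F F' N N' \<beta>
  proof (intro conjI)
    show "good F' N' \<beta>" using that by (auto simp: good_def)
    show "E F' \<beta> = E F \<beta>" using that unfolding E_def by (intro ext kcomb_superset) (auto simp: good_def)
    have "L F' N' \<beta> = (\<Sum>n<N'. \<Sum>x\<in>F. cnj (q n x) * \<beta> n x)"
      unfolding L_def using that by (intro sum.cong sum.mono_neutral_right) (auto simp: good_def)
    also have "\<dots> = L F N \<beta>"
      unfolding L_def using that by (intro sum.mono_neutral_right) (auto simp: good_def)
    finally show "L F' N' \<beta> = L F N \<beta>" .
  qed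
  obtain l where l: "l \<in> carr H2" "ht.nrm l \<le> C"
    and lR: "\<And>u a. R u a \<Longrightarrow> a = ip H2 u l"
  proof (rule ht.riesz_relation[of R C])
    show "R 0 0" unfolding R_def
      by (rule exI[of _ "{}"], rule exI[of _ 0], rule exI[of _ "\<lambda>_ _. 0"])
        (auto simp: good_def E_def L_def kcomb_def fun_eq_iff)
    show "R (u + v) (a + b)" if "R u a" "R v b" for u v a b
    proof -
      obtain F N \<beta> F' N' \<beta>' where g: "good F N \<beta>" "u = E F \<beta>" "a = L F N \<beta>"
        "good F' N' \<beta>'" "v = E F' \<beta>'" "b = L F' N' \<beta>'"
        using \<open>R u a\<close> \<open>R v b\<close> by (auto simp: R_def)
      let ?F = "F \<union> F'" and ?N = "max N N'"
      have "finite ?F" using g by (simp add: good_def)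
      then have g': "good ?F ?N \<beta>" "u = E ?F \<beta>" "a = L ?F ?N \<beta>" "good ?F ?N \<beta>'" "v = E ?F \<beta>'" "b = L ?F ?N \<beta>'"
        using enlarge[OF g(1), of ?F ?N] enlarge[OF g(4), of ?F ?N] g by auto
      show ?thesis unfolding R_def
        by (rule exI[of _ ?F], rule exI[of _ ?N], rule exI[of _ "\<lambda>n x. \<beta> n x + \<beta>' n x"])
          (use g' in \<open>auto simp: good_def E_def L_def kcomb_add distrib_left sum.distrib fun_eq_iff\<close>)
    qed
    show "R (\<lambda>i. (\<lambda>_. c) * u i) (c * a)" if "R u a" for u a c
    proof -
      obtain F N \<beta> where g: "good F N \<beta>" "u = E F \<beta>" "a = L F N \<beta>"
        using \<open>R u a\<close> by (auto simp: R_def)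
      show ?thesis unfolding R_def
        by (rule exI[of _ F], rule exI[of _ N], rule exI[of _ "\<lambda>n x. c * \<beta> n x"])
          (use g in \<open>auto simp: good_def E_def L_def kcomb_scale sum_distrib_left mult_ac\<close>)
    qed
    show "u \<in> carr H2 \<and> cmod a \<le> C * ht.nrm u" if "R u a" for u a
    proof -
      obtain F N \<beta> where g: "good F N \<beta>" "u = E F \<beta>" "a = L F N \<beta>"
        using \<open>R u a\<close> by (auto simp: R_def)
      have "a = cnj (\<Sum>n<N. \<Sum>x\<in>F. q n x * cnj (\<beta> n x))" by (simp add: g L_def)
      then have "cmod a = cmod (\<Sum>n<N. \<Sum>x\<in>F. q n x * cnj (\<beta> n x))" by (simp only: complex_mod_cnj)
      then show ?thesis
        using bdd[where F = F and N = N and \<beta> = \<beta>] g E_mem[OF g(1)] E_norm[OF g(1)] by (simp add: good_def)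
    qed
  qed (use C in blast)+
  have "q n x = l n x" for n x
  proof -
    have "good {x} (Suc n) (\<lambda>m y. if m = n \<and> y = x then 1 else 0)" by (auto simp: good_def)
    then have "R (E {x} (\<lambda>m y. if m = n \<and> y = x then 1 else 0)) (L {x} (Suc n) (\<lambda>m y. if m = n \<and> y = x then 1 else 0))"
      unfolding R_def by blast
    moreover have "E {x} (\<lambda>m y. if m = n \<and> y = x then 1 else 0) = hs.single n (kfun H x)"
      by (auto simp: E_def hs.single_def kcomb_def fun_eq_iff)
    moreover have "L {x} (Suc n) (\<lambda>m y. if m = n \<and> y = x then 1 else 0) = cnj (q n x)"
      by (simp add: L_def)
    ultimately have "cnj (q n x) = ip H2 (hs.single n (kfun H x)) l" using lR by metis
    also have "\<dots> = cnj (l n x)"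
      using ht.ip_cnj[OF l(1) hs.single_mem[OF kfun_mem], of n x] hs.ip_single[OF kfun_mem l(1)]
        reproducing[OF hs.tensor_memD[OF l(1)]] by simp
    finally show ?thesis by simp
  qed
  then have "q = l" by (simp add: fun_eq_iff)
  then show "q \<in> carr H2" "ht.nrm q \<le> C" using l by auto
qed

lemma membership:
  assumes bdd: "\<And>F \<beta>. finite F \<Longrightarrow> cmod (\<Sum>x\<in>F. f x * cnj (\<beta> x)) \<le> C * hs.nrm (kcomb F \<beta>)"
    and C: "0 \<le> C"
  shows "f \<in> carr H" "hs.nrm f \<le> C"
proof -
  have *: "cmod (\<Sum>n<N. \<Sum>x\<in>F. hs.single 0 f n x * cnj (\<beta> n x)) \<le> C * sqrt (\<Sum>n<N. (hs.nrm (kcomb F (\<beta> n)))\<^sup>2)"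
    if F: "finite F" for F N \<beta>
  proof (cases N)
    case (Suc M)
    have "(\<Sum>n<N. \<Sum>x\<in>F. hs.single 0 f n x * cnj (\<beta> n x)) = (\<Sum>x\<in>F. f x * cnj (\<beta> 0 x))"
      unfolding Suc sum.lessThan_Suc_shift by (simp add: hs.single_def)
    moreover have "hs.nrm (kcomb F (\<beta> 0)) \<le> sqrt (\<Sum>n<N. (hs.nrm (kcomb F (\<beta> n)))\<^sup>2)"
      unfolding Suc sum.lessThan_Suc_shift by (intro real_le_rsqrt) (simp add: sum_nonneg)
    ultimately show ?thesis using bdd[OF F, of "\<beta> 0"] mult_left_mono[OF _ C] by fastforce
  qed (simp add: C)
  have m: "hs.single 0 f \<in> carr H2" "ht.nrm (hs.single 0 f) \<le> C"
    using tensor_membership[of "hs.single 0 f" C, OF * C] by auto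
  show f: "f \<in> carr H" using hs.tensor_memD[OF m(1), of 0] by (simp add: hs.single_def)
  show "hs.nrm f \<le> C" using m(2) hs.nrm_single[OF f] by simp
qed

text \<open>The interpolant is the orthogonal projection of \<open>a\<close> onto the span of the
  kernel functions at \<open>F\<close>, which gives the norm bound. These functions may be linearly
  dependent, so it is built point by point as in Gram-Schmidt instead of by inverting a Gram
  matrix.\<close>

lemma finite_projection:
  assumes a: "a \<in> carr H" and F: "finite F"
  obtains \<alpha> where "\<And>x. x \<in> F \<Longrightarrow> kcomb F \<alpha> x = a x" "hs.nrm (kcomb F \<alpha>) \<le> hs.nrm a"
proof -
  have "\<exists>\<alpha>. \<forall>x\<in>F. kcomb F \<alpha> x = a x"
    using F a
  proof (induction F arbitrary: a rule: finite_induct)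
    case (insert z F)
    obtain \<alpha> where \<alpha>: "\<And>x. x \<in> F \<Longrightarrow> kcomb F \<alpha> x = a x" using insert by blast
    obtain \<gamma> where \<gamma>: "\<And>x. x \<in> F \<Longrightarrow> kcomb F \<gamma> x = kfun H z x" using insert kfun_mem by blast
    define r where "r = kfun H z - kcomb F \<gamma>"
    define s where "s = a - kcomb F \<alpha>"
    have rs: "r \<in> carr H" "s \<in> carr H" using insert by (auto simp: r_def s_def)
    have r0: "r x = 0" if "x \<in> F" for x using \<gamma> that by (simp add: r_def)
    have s0: "s x = 0" if "x \<in> F" for x using \<alpha> that by (simp add: s_def)
    have orth: "ip H f (kcomb F \<gamma>) = 0" if "f \<in> carr H" "\<And>x. x \<in> F \<Longrightarrow> f x = 0" for f
      using that by (simp add: ip_kcomb)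
    have rz: "r z = ip H r r" "s z = ip H s r"
      using orth[OF rs(1) r0] orth[OF rs(2) s0] rs
      by (auto simp: hs.ip_diff_right reproducing r_def[symmetric] kfun_mem)
        (auto simp: r_def hs.ip_diff_right reproducing)
    \<comment> \<open>\<open>r\<close> is the part of \<open>kfun H z\<close> that vanishes on
      \<open>F\<close>. If \<open>r z = 0\<close> then \<open>r = 0\<close> and
      \<open>s z = ip H s r = 0\<close>, so the value \<open>t = 0\<close> of the division is
      right.\<close>
    define t where "t = s z / r z"
    have t: "t * r z = s z"
    proof (cases "r z = 0")
      case True
      then have "r = 0" using rz rs ip_definite by metis
      then show ?thesis using rz rs by simp
    qed (simp add: t_def)
    have "kcomb (insert z F) (\<lambda>x. if x = z then t else \<alpha> x - t * \<gamma> x) = kcomb F \<alpha> + (\<lambda>_. t) * r"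
    proof -
      have "kcomb (insert z F) (\<lambda>x. if x = z then t else \<alpha> x - t * \<gamma> x) = (\<lambda>_. t) * kfun H z + kcomb F (\<lambda>x. \<alpha> x + (-t) * \<gamma> x)"
        unfolding kcomb_def using insert by (simp, intro sum.cong) auto
      also have "\<dots> = kcomb F \<alpha> + (\<lambda>_. t) * r"
        unfolding kcomb_add kcomb_scale by (simp add: r_def fun_eq_iff algebra_simps)
      finally show ?thesis .
    qed
    moreover have "kcomb F \<alpha> x + t * r x = a x" if "x \<in> insert z F" for x
      using that \<alpha> r0 t by (auto simp: s_def)
    ultimately show ?case by (intro exI[of _ "\<lambda>x. if x = z then t else \<alpha> x - t * \<gamma> x"]) simp
  qed simp
  then obtain \<alpha> where \<alpha>: "\<And>x. x \<in> F \<Longrightarrow> kcomb F \<alpha> x = a x" by blast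
  let ?p = "kcomb F \<alpha>"
  have "ip H a ?p = ip H ?p ?p" using a \<alpha> by (simp add: ip_kcomb)
  then have "(hs.nrm ?p)\<^sup>2 \<le> hs.nrm a * hs.nrm ?p"
    using hs.cauchy_schwarz[OF a kcomb_mem, of F \<alpha>] by (simp add: hs.ip_self norm_power)
  then have "hs.nrm ?p \<le> hs.nrm a"
    using a hs.nrm_nonneg[OF kcomb_mem, of F \<alpha>]
    by (cases "hs.nrm ?p = 0") (auto simp: power2_eq_square mult_le_cancel_right)
  then show thesis using that \<alpha> by blast
qed

end

section \<open>Pick matrices and the form of the kernel\<close>

lemma complex_of_real_nonneg: "0 \<le> complex_of_real x \<longleftrightarrow> 0 \<le> x"
  by (simp add: less_eq_complex_def)

text \<open>Moving the null vector \<open>z\<close> by \<open>t\<close> in the coordinate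
  \<open>k\<close> changes the form by \<open>2 Re (t c) + |t|\<^sup>2 Re (p k k)\<close>, which
  some small \<open>t\<close> makes negative unless \<open>c = 0\<close>. This forces entries of a
  Pick matrix.\<close>

lemma psd_kernel_vector:
  fixes p :: "nat \<Rightarrow> nat \<Rightarrow> complex"
  assumes psd: "\<And>v. 0 \<le> (\<Sum>i<N. \<Sum>j<N. cnj (v i) * p i j * v j)"
    and herm: "\<And>i j. i < N \<Longrightarrow> j < N \<Longrightarrow> p j i = cnj (p i j)"
    and z: "(\<Sum>i<N. \<Sum>j<N. cnj (z i) * p i j * z j) = 0" and k: "k < N"
  shows "(\<Sum>i<N. cnj (z i) * p i k) = 0"
proof -
  define c where "c = (\<Sum>i<N. cnj (z i) * p i k)"
  have c2: "(\<Sum>j<N. p k j * z j) = cnj c"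
    using k by (simp add: c_def herm[of _ k] mult.commute)
  have q: "0 \<le> 2 * Re (t * c) + (cmod t)\<^sup>2 * Re (p k k)" for t
  proof -
    define v where "v i = z i + (if i = k then t else 0)" for i
    have "(\<Sum>i<N. \<Sum>j<N. cnj (v i) * p i j * v j) =
       (\<Sum>i<N. \<Sum>j<N. cnj (z i) * p i j * z j) + (\<Sum>i<N. \<Sum>j<N. cnj (z i) * p i j * (if j = k then t else 0))
       + ((\<Sum>i<N. \<Sum>j<N. cnj (if i = k then t else 0) * p i j * z j)
       + (\<Sum>i<N. \<Sum>j<N. cnj (if i = k then t else 0) * p i j * (if j = k then t else 0)))"
      unfolding v_def by (simp add: algebra_simps sum.distrib)
    also have "(\<Sum>i<N. \<Sum>j<N. cnj (z i) * p i j * (if j = k then t else 0)) = t * c"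
      using k by (simp add: c_def if_distrib sum_distrib_left mult_ac cong: if_cong)
    also have "(\<Sum>i<N. \<Sum>j<N. cnj (if i = k then t else 0) * p i j * z j) = cnj t * cnj c"
    proof -
      have "(\<Sum>i<N. \<Sum>j<N. cnj (if i = k then t else 0) * p i j * z j) =
          (\<Sum>i<N. if i = k then cnj t * (\<Sum>j<N. p k j * z j) else 0)"
        by (intro sum.cong) (auto simp: sum_distrib_left mult.assoc)
      then show ?thesis using k c2 by simp
    qed
    also have "(\<Sum>i<N. \<Sum>j<N. cnj (if i = k then t else 0) * p i j * (if j = k then t else 0)) = cnj t * p k k * t"
    proof -
      have "(\<Sum>j<N. cnj t * p k j * (if j = k then t else 0)) = (\<Sum>j<N. if j = k then cnj t * p k k * t else 0)"
        by (intro sum.cong) auto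
      then have "(\<Sum>j<N. cnj t * p k j * (if j = k then t else 0)) = cnj t * p k k * t" using k by simp
      moreover have "(\<Sum>i<N. \<Sum>j<N. cnj (if i = k then t else 0) * p i j * (if j = k then t else 0)) =
          (\<Sum>i<N. if i = k then \<Sum>j<N. cnj t * p k j * (if j = k then t else 0) else 0)"
        by (intro sum.cong) auto
      ultimately show ?thesis using k by simp
    qed
    finally have "0 \<le> Re (t * c + (cnj t * cnj c + cnj t * p k k * t))"
      using psd[of v] z by (simp add: less_eq_complex_def)
    moreover have "cnj t * p k k * t = complex_of_real ((cmod t)\<^sup>2) * p k k"
      unfolding complex_norm_square by (simp add: mult_ac)
    then have "Re (cnj t * p k k * t) = Re (complex_of_real ((cmod t)\<^sup>2) * p k k)" by (rule arg_cong)
    then have "Re (cnj t * p k k * t) = (cmod t)\<^sup>2 * Re (p k k)" by (simp only: Re_complex_of_real Im_complex_of_real times_complex.sel mult_zero_left diff_zero)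
    moreover have "Re (t * c + (cnj t * cnj c + X)) = 2 * Re (t * c) + Re X" for X by simp
    ultimately show ?thesis by metis
  qed
  \<comment> \<open>With \<open>t = -s cnj c\<close> the linear term becomes
    \<open>-2 s |c|\<^sup>2\<close>.\<close>
  have "0 \<le> - (cmod c)\<^sup>2"
  proof (rule quadratic_nonneg_imp)
    fix s :: real
    have "complex_of_real (- s) * cnj c * c = complex_of_real (- s * (cmod c)\<^sup>2)"
      unfolding of_real_mult complex_norm_square by (simp add: mult_ac)
    then have "Re (complex_of_real (- s) * cnj c * c) = - s * (cmod c)\<^sup>2" by (metis Re_complex_of_real)
    then show "0 \<le> 2 * s * - (cmod c)\<^sup>2 + s\<^sup>2 * ((cmod c)\<^sup>2 * Re (p k k))"
      using q[of "complex_of_real (- s) * cnj c"] by (simp add: norm_mult power_mult_distrib mult_ac)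
  qed
  then show ?thesis by (simp add: c_def)
qed

context rkhs begin

text \<open>
  Necessity of the McCullough-Quiggin condition: the Pick matrix of the rows found so far has rank
  one, so the extension of these data to one more point is forced, and it has the right inner
  products with the previous rows.
\<close>

lemma np_rows:
  assumes np: "complete_np H" and ne: "\<And>i. i < n \<Longrightarrow> kernel H (x i) (x 0) \<noteq> 0" and n: "n \<ge> 1"
  shows "\<exists>b :: nat \<Rightarrow> nat \<Rightarrow> complex. (\<forall>i c. i < c \<longrightarrow> b i c = 0) \<and> (\<forall>c. b 0 c = 0) \<and>
    (\<forall>i<n. \<forall>j<n. (1 - (\<Sum>c<n. b i c * cnj (b j c))) * kernel H (x i) (x j) =
        kernel H (x i) (x 0) * kernel H (x 0) (x j) / kernel H (x 0) (x 0))"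
  using n ne
proof (induction n rule: dec_induct)
  case base
  then show ?case by (intro exI[of _ "\<lambda>_ _. 0"]) simp
next
  case (step n)
  define K where "K i j = kernel H (x i) (x j)" for i j
  have Kc: "K j i = cnj (K i j)" for i j unfolding K_def by (rule kernel_cnj)
  have K00: "K 0 0 \<noteq> 0" using step.prems[of 0] by (simp add: K_def)
  define k0 where "k0 = (hs.nrm (kfun H (x 0)))\<^sup>2"
  have k0a: "K 0 0 = complex_of_real k0" unfolding k0_def K_def by (rule kernel_diag)
  then have "k0 > 0" using K00 by (simp add: k0_def)
  with k0a have k0: "K 0 0 = complex_of_real k0" "k0 > 0" by auto
  obtain b where b: "\<And>i c. i < c \<Longrightarrow> b i c = 0" "\<And>c. b 0 c = 0"
    and bK: "\<And>i j. i < n \<Longrightarrow> j < n \<Longrightarrow> (1 - (\<Sum>c<n. b i c * cnj (b j c))) * K i j = K i 0 * K 0 j / K 0 0"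
    using step.IH[OF step.prems[OF less_SucI]] unfolding K_def by blast
  \<comment> \<open>Only the first row is nonzero, and it is \<open>b i\<close>. The Pick matrix
    then splits into blocks: the rank one matrix \<open>K i 0 * K 0 j / K 0 0\<close> for the first
    row, and the Gram matrix of the kernel functions for each other row.\<close>
  define W where "W i a c = (if a = 0 then b i c else 0)" for i a c :: nat
  have nps: "np_solvable H n N x W' \<longleftrightarrow> pick_psd H n N x W'" if "N \<ge> 1" for N W'
    using np step.hyps that unfolding complete_np_def by blast
  have "pick_psd H n n x W"
    unfolding pick_psd_def
  proof
    fix v :: "nat \<Rightarrow> nat \<Rightarrow> complex"
    let ?s = "\<lambda>a. \<Sum>i<n. \<Sum>j<n. cnj (v i a) * pick_entry H n x W i j a a * v j a"
    have off: "pick_entry H n x W i j a c = 0" if "a \<noteq> c" for i j a c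
    proof -
      have "(\<Sum>e<n. W i a e * cnj (W j c e)) = 0"
        by (rule sum.neutral) (use that in \<open>auto simp: W_def\<close>)
      then show ?thesis using that by (simp add: pick_entry_def)
    qed
    have "(\<Sum>i<n. \<Sum>j<n. \<Sum>a<n. \<Sum>c<n. cnj (v i a) * pick_entry H n x W i j a c * v j c)
      = (\<Sum>i<n. \<Sum>j<n. \<Sum>a<n. cnj (v i a) * pick_entry H n x W i j a a * v j a)"
    proof (intro sum.cong refl)
      fix i j a assume "a \<in> {..<n}"
      have "(\<Sum>c<n. cnj (v i a) * pick_entry H n x W i j a c * v j c) =
          (\<Sum>c<n. if c = a then cnj (v i a) * pick_entry H n x W i j a a * v j a else 0)"
        by (intro sum.cong) (auto simp: off)
      then show "(\<Sum>c<n. cnj (v i a) * pick_entry H n x W i j a c * v j c) = cnj (v i a) * pick_entry H n x W i j a a * v j a"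
        using \<open>a \<in> {..<n}\<close> by simp
    qed
    also have "\<dots> = (\<Sum>i<n. \<Sum>a<n. \<Sum>j<n. cnj (v i a) * pick_entry H n x W i j a a * v j a)"
      by (intro sum.cong refl sum.swap)
    also have "\<dots> = (\<Sum>a<n. ?s a)" by (rule sum.swap)
    also have "\<dots> \<ge> 0"
    proof (rule sum_nonneg)
      fix a assume "a \<in> {..<n}"
      show "0 \<le> ?s a"
      proof (cases "a = 0")
        case True
        define w where "w = (\<Sum>j<n. K 0 j * v j 0)"
        have "?s a = (\<Sum>i<n. \<Sum>j<n. cnj (v i 0) * (K i 0 * K 0 j / K 0 0) * v j 0)"
          using True bK by (intro sum.cong refl) (simp add: pick_entry_def W_def flip: K_def)
        also have "\<dots> = (\<Sum>i<n. \<Sum>j<n. (cnj (K 0 i * v i 0) / K 0 0) * (K 0 j * v j 0))"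
        proof (intro sum.cong refl)
          fix i j
          have "K i 0 = cnj (K 0 i)" by (rule Kc)
          then show "cnj (v i 0) * (K i 0 * K 0 j / K 0 0) * v j 0 = (cnj (K 0 i * v i 0) / K 0 0) * (K 0 j * v j 0)"
            by simp
        qed
        also have "\<dots> = cnj w * w / K 0 0"
          unfolding w_def cnj_sum sum_product sum_divide_distrib by simp
        also have "\<dots> = complex_of_real ((cmod w)\<^sup>2 / k0)"
          unfolding of_real_divide complex_norm_square k0(1) by (simp add: mult.commute)
        also have "0 \<le> \<dots>" using k0(2) by (simp only: complex_of_real_nonneg) simp
        finally show ?thesis .
      next
        case False
        have "?s a = (\<Sum>i<n. \<Sum>j<n. cnj (v i a) * K i j * v j a)"
          using False by (intro sum.cong refl) (simp add: pick_entry_def W_def K_def)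
        also have "\<dots> = ip H (\<Sum>i<n. (\<lambda>_. v i a) * kfun H (x i)) (\<Sum>i<n. (\<lambda>_. v i a) * kfun H (x i))"
        proof -
          have m: "(\<lambda>_. v i a) * kfun H (x i) \<in> carr H" for i by (intro scale_mem kfun_mem)
          show ?thesis
            using m by (simp add: hs.ip_sum_right hs.ip_sc_right reproducing hs.sum_mem sum_fun_apply sum_distrib_left
                K_def kernel_eq mult_ac)
        qed
        also have "0 \<le> \<dots>" by (intro ip_nonneg hs.sum_mem scale_mem kfun_mem)
        finally show ?thesis .
      qed
    qed
    finally show "0 \<le> (\<Sum>i<n. \<Sum>j<n. \<Sum>a<n. \<Sum>c<n. cnj (v i a) * pick_entry H n x W i j a c * v j c)" .
  qed
  then have "np_solvable H n n x W" using nps step.hyps by blast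
  then obtain \<Phi> where \<Phi>: "\<forall>a<n. \<forall>c<n. \<Phi> a c \<in> multipliers H"
      "bounded_op (tensor_fin n H) (tensor_fin n H) (matrix_mult_op n \<Phi>)"
      "op_norm (tensor_fin n H) (tensor_fin n H) (matrix_mult_op n \<Phi>) \<le> 1"
      "\<forall>i<n. \<forall>a<n. \<forall>c<n. \<Phi> a c (x i) = W i a c"
    unfolding np_solvable_def by blast
  \<comment> \<open>\<open>\<Phi>\<close> also has values at \<open>x n\<close>. It solves the
    problem with these values at \<open>n + 1\<close> points, so their Pick matrix is positive; both
    directions of the equivalence have now been used.\<close>
  define W' where "W' i a c = \<Phi> a c (x i)" for i a c
  have "np_solvable H n (Suc n) x W'"
    unfolding np_solvable_def using \<Phi> by (intro exI[of _ \<Phi>]) (auto simp: W'_def)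
  then have psd: "pick_psd H n (Suc n) x W'" using nps by simp
  define p where "p i j = pick_entry H n x W' i j 0 0" for i j
  have n0: "0 < n" using step.hyps by simp
  have W'b: "W' i 0 c = b i c" if "i < n" "c < n" for i c
    using \<Phi>(4) that n0 by (simp add: W'_def W_def)
  have p_eq: "p i j = (1 - (\<Sum>c<n. W' i 0 c * cnj (W' j 0 c))) * K i j" for i j
    by (simp add: p_def pick_entry_def K_def)
  have p_psd: "0 \<le> (\<Sum>i<Suc n. \<Sum>j<Suc n. cnj (v i) * p i j * v j)" for v
  proof -
    have "(\<Sum>a<n. \<Sum>c<n. cnj (if a = 0 then v i else 0) * pick_entry H n x W' i j a c * (if c = 0 then v j else 0))
        = cnj (v i) * p i j * v j" for i j
    proof -
      have "(\<Sum>c<n. cnj (v i) * pick_entry H n x W' i j 0 c * (if c = 0 then v j else 0))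
          = (\<Sum>c<n. if c = 0 then cnj (v i) * p i j * v j else 0)"
        by (intro sum.cong) (auto simp: p_def)
      then have "(\<Sum>c<n. cnj (v i) * pick_entry H n x W' i j 0 c * (if c = 0 then v j else 0)) = cnj (v i) * p i j * v j"
        using n0 by simp
      moreover have "(\<Sum>a<n. \<Sum>c<n. cnj (if a = 0 then v i else 0) * pick_entry H n x W' i j a c * (if c = 0 then v j else 0))
        = (\<Sum>a<n. if a = 0 then \<Sum>c<n. cnj (v i) * pick_entry H n x W' i j 0 c * (if c = 0 then v j else 0) else 0)"
        by (intro sum.cong) auto
      ultimately show ?thesis using n0 by simp
    qed
    then show ?thesis
      using psd unfolding pick_psd_def by (auto dest: spec[of _ "\<lambda>i a. if a = 0 then v i else 0"] simp del: sum.lessThan_Suc)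
  qed
  have p_herm: "p j i = cnj (p i j)" for i j
    by (simp add: p_eq Kc[of j i] mult.commute)
  have p_old: "p i j = K i 0 * K 0 j / K 0 0" if "i < n" "j < n" for i j
    using that bK by (simp add: p_eq W'b)
  have p0n: "p 0 n = K 0 n" using n0 by (simp add: p_eq W'b b)
  have pin: "p i n = K i 0 * K 0 n / K 0 0" if i: "i < n" for i
  proof (cases "i = 0")
    case True
    then show ?thesis using p0n K00 by simp
  next
    case False
    \<comment> \<open>\<open>z\<close> is a null vector of the rank one block, so the form of the
      enlarged matrix vanishes at it as well; \<open>psd_kernel_vector\<close> in column
      \<open>n\<close> then gives \<open>p i n\<close>.\<close>
    define z where "z k = (if k = i then 1 else if k = 0 then - K 0 i / K 0 0 else 0)" for k
    have z_sum: "(\<Sum>k<Suc n. cnj (z k) * g k) = g i - cnj (K 0 i / K 0 0) * g 0" for g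
    proof -
      have "(\<Sum>k<Suc n. cnj (z k) * g k) = (\<Sum>k\<in>{0, i}. cnj (z k) * g k)"
        by (rule sum.mono_neutral_right) (use i in \<open>auto simp: z_def\<close>)
      then show ?thesis using False by (simp add: z_def)
    qed
    have z_sum': "(\<Sum>k<Suc n. g k * z k) = g i - g 0 * (K 0 i / K 0 0)" for g
    proof -
      have "(\<Sum>k<Suc n. g k * z k) = (\<Sum>k\<in>{0, i}. g k * z k)"
        by (rule sum.mono_neutral_right) (use i in \<open>auto simp: z_def\<close>)
      then show ?thesis using False by (simp add: z_def)
    qed
    have "(\<Sum>k<Suc n. \<Sum>j<Suc n. cnj (z k) * p k j * z j) = (\<Sum>k<Suc n. cnj (z k) * (\<Sum>j<Suc n. p k j * z j))"
      by (simp only: sum_distrib_left mult.assoc)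
    also have "\<dots> = 0"
      unfolding z_sum z_sum' using i n0 K00 by (simp add: p_old)
    finally have "(\<Sum>k<Suc n. cnj (z k) * p k n) = 0"
      using psd_kernel_vector[where N = "Suc n" and p = p and z = z and k = n] p_psd p_herm by blast
    then have "p i n = cnj (K 0 i / K 0 0) * K 0 n" unfolding z_sum p0n by simp
    then show ?thesis using Kc[of 0 i] Kc[of 0 0] by simp
  qed
  define c0 where "c0 = complex_of_real (Re (p n n)) - K n 0 * K 0 n / K 0 0"
  define knn where "knn = (hs.nrm (kfun H (x n)))\<^sup>2"
  have knna: "K n n = complex_of_real knn" unfolding knn_def K_def by (rule kernel_diag)
  have "K n n \<noteq> 0" using kernel_diag_ne[OF step.prems[of n]] by (simp add: K_def)
  then have "knn > 0" unfolding knna by (simp add: knn_def)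
  with knna have knn: "K n n = complex_of_real knn" "knn > 0" by auto
  have pnn: "p n n = complex_of_real (Re (p n n))" using p_herm[of n n] by (simp add: complex_eq_iff)
  have gap: "(cmod (K 0 n))\<^sup>2 / k0 \<le> Re (p n n)"
  proof -
    \<comment> \<open>The form at this vector is the Schur complement of the entry
      \<open>p 0 0 = K 0 0\<close>.\<close>
    define z where "z k = (if k = n then 1 else if k = 0 then - K 0 n / K 0 0 else 0)" for k
    have "(\<Sum>k<Suc n. \<Sum>j<Suc n. cnj (z k) * p k j * z j) = (\<Sum>k\<in>{0, n}. \<Sum>j<Suc n. cnj (z k) * p k j * z j)"
      by (rule sum.mono_neutral_right) (auto simp: z_def)
    also have "\<dots> = (\<Sum>k\<in>{0, n}. \<Sum>j\<in>{0, n}. cnj (z k) * p k j * z j)"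
      by (intro sum.cong refl sum.mono_neutral_right) (auto simp: z_def)
    also have "\<dots> = p n n - cnj (K 0 n) * K 0 n / K 0 0"
      using n0 p0n p_old[of 0 0] p_herm[of n 0] K00 Kc[of 0 0] by (simp add: z_def)
    also have "\<dots> = complex_of_real (Re (p n n) - (cmod (K 0 n))\<^sup>2 / k0)"
      unfolding of_real_diff of_real_divide complex_norm_square k0(1) pnn[symmetric] by (simp add: mult.commute)
    finally have "0 \<le> complex_of_real (Re (p n n) - (cmod (K 0 n))\<^sup>2 / k0)" using p_psd[of z] by simp
    then show ?thesis by (simp only: complex_of_real_nonneg)
  qed
  \<comment> \<open>The new coordinate \<open>n\<close> is carried by row \<open>n\<close> alone. It
    absorbs the excess of \<open>p n n\<close> over the rank one value and leaves the inner products
    with the earlier rows unchanged.\<close>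
  define r where "r = sqrt ((Re (p n n) - (cmod (K 0 n))\<^sup>2 / k0) / knn)"
  have r2: "complex_of_real r * complex_of_real r * K n n = p n n - K n 0 * K 0 n / K 0 0"
  proof -
    have "r * r * knn = Re (p n n) - (cmod (K 0 n))\<^sup>2 / k0" using gap knn by (simp add: r_def)
    then have "complex_of_real r * complex_of_real r * K n n = complex_of_real (Re (p n n) - (cmod (K 0 n))\<^sup>2 / k0)"
      unfolding knn(1) by (metis of_real_mult)
    also have "\<dots> = p n n - K n 0 * K 0 n / K 0 0"
      unfolding of_real_diff of_real_divide complex_norm_square k0(1) pnn[symmetric] Kc[of n 0] by (simp add: mult.commute)
    finally show ?thesis .
  qed
  define b' where "b' i c = (if i < n then b i c else if i = n then (if c < n then W' n 0 c else if c = n then complex_of_real r else 0) else 0)" for i c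
  have bn: "b i n = 0" if "i < n" for i using b that by simp
  have main: "(1 - (\<Sum>c<Suc n. b' i c * cnj (b' j c))) * K i j = K i 0 * K 0 j / K 0 0" if ij: "i < Suc n" "j < Suc n" for i j
  proof -
    have s1: "(\<Sum>c<n. b' k c * cnj (b' l c)) = (\<Sum>c<n. W' k 0 c * cnj (W' l 0 c))" if "k < Suc n" "l < Suc n" for k l
      using that by (intro sum.cong refl) (auto simp: b'_def W'b less_Suc_eq)
    have e: "(1 - (\<Sum>c<Suc n. b' i c * cnj (b' j c))) * K i j = p i j - b' i n * cnj (b' j n) * K i j"
      using s1[OF ij] by (simp add: p_eq algebra_simps)
    consider "i < n" "j < n" | "i < n" "j = n" | "i = n" "j < n" | "i = n" "j = n" using ij by linarith
    then show ?thesis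
    proof cases
      case 1 then show ?thesis unfolding e using p_old bn by (simp add: b'_def)
    next
      case 2 then show ?thesis unfolding e using pin bn by (simp add: b'_def)
    next
      case 3
      have "p n j = K n 0 * K 0 j / K 0 0"
        using p_herm[of n j] pin[OF 3(2)] Kc[of j 0] Kc[of 0 n] Kc[of 0 0] by (simp add: mult.commute)
      then show ?thesis unfolding e using 3 bn by (simp add: b'_def)
    next
      case 4 then show ?thesis unfolding e using r2 by (simp add: b'_def)
    qed
  qed
  have "b' i c = 0" if "i < c" for i c using that b by (auto simp: b'_def)
  moreover have "b' 0 c = 0" for c using n0 b by (simp add: b'_def)
  ultimately show ?case using main unfolding K_def by (intro exI[of _ b']) auto
qed

end

section \<open>The full Fock space\<close>

text \<open>Words over the alphabet \<open>\<nat>\<close> are coded by natural numbers: \<open>0\<close> is the empty word and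
  \<open>cons_code i w\<close> is \<open>w\<close> with the letter \<open>i\<close> prepended.\<close>

definition cons_code :: "nat \<Rightarrow> nat \<Rightarrow> nat"
  where "cons_code i w = Suc (prod_encode (i, w))"

definition letter :: "nat \<Rightarrow> nat" where "letter m = fst (prod_decode m)"

definition rest :: "nat \<Rightarrow> nat" where "rest m = snd (prod_decode m)"

lemma cons_letter_rest: "cons_code (letter m) (rest m) = Suc m"
  by (simp add: cons_code_def letter_def rest_def)

lemma letter_encode [simp]: "letter (prod_encode (i, w)) = i" "rest (prod_encode (i, w)) = w"
  by (simp_all add: letter_def rest_def)

lemma encode_letter [simp]: "prod_encode (letter m, rest m) = m"
  by (simp add: letter_def rest_def)

lemma rest_le: "rest m \<le> m"
  using le_prod_encode_2[of "rest m" "letter m"] by simp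

lemma word_induct [case_names zero suc]:
  assumes "P 0" "\<And>m. P (rest m) \<Longrightarrow> P (Suc m)"
  shows "P n"
proof (induction n rule: less_induct)
  case (less n)
  then show ?case using assms rest_le by (cases n) (auto simp: less_Suc_eq_le)
qed

lemma cmod_mult_le: "cmod (a * b) \<le> (cmod a)\<^sup>2 + (cmod b)\<^sup>2"
proof -
  have "0 \<le> cmod a * cmod b" by simp
  then show ?thesis using sum_squares_bound[of "cmod a" "cmod b"] unfolding norm_mult by linarith
qed

lemma strict_mono_prod_encode: "strict_mono (\<lambda>w. prod_encode (i, w))"
  by (simp add: strict_mono_Suc_iff prod_encode_def)

lemma strict_mono_cons: "strict_mono (cons_code i)"
  using strict_mono_prod_encode[of i] by (simp add: strict_mono_def cons_code_def)

lemma cons_disjoint: "i \<noteq> j \<Longrightarrow> range (cons_code i) \<inter> range (cons_code j) = {}"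
  by (auto simp: cons_code_def)

lemma zero_notin_cons: "0 \<notin> range (cons_code i)"
  by (auto simp: cons_code_def)

text \<open>The monomial of a word: the product of the \<open>\<beta> i\<close> over its letters. By
  \<open>chi_mult_cnj\<close> inner products of such families are again sums of monomials, that is,
  geometric series over words.\<close>

function chi :: "(nat \<Rightarrow> complex) \<Rightarrow> nat \<Rightarrow> complex" where
  "chi \<beta> 0 = 1"
| "chi \<beta> (Suc m) = \<beta> (letter m) * chi \<beta> (rest m)"
  by pat_completeness auto
termination by (relation "Wellfounded.measure snd") (auto simp: rest_le less_Suc_eq_le)

lemma chi_cons: "chi \<beta> (cons_code i w) = \<beta> i * chi \<beta> w"
  by (simp add: cons_code_def)

lemma chi_mult_cnj: "chi (\<lambda>c. \<beta> c * cnj (\<gamma> c)) w = chi \<beta> w * cnj (chi \<gamma> w)"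
  by (induction w rule: word_induct) auto

text \<open>Over the words of length \<open>k\<close> the sum is \<open>r ^ k\<close>. The coding
  does not order words by length, so the partial sums are bounded recursively: a nonempty word with
  code at most \<open>N\<close> has a rest with code below \<open>N\<close>, whence
  \<open>s (Suc N) \<le> 1 + r * s N\<close>, and \<open>1 / (1 - r)\<close> is the fixed point of
  this recursion.\<close>

lemma chi_summable:
  assumes fin: "\<And>c. c \<ge> m \<Longrightarrow> \<beta> c = 0" and lt: "(\<Sum>c<m. (cmod (\<beta> c))\<^sup>2) < 1"
  shows "summable (\<lambda>w. (cmod (chi \<beta> w))\<^sup>2)"
proof -
  define r where "r = (\<Sum>c<m. (cmod (\<beta> c))\<^sup>2)"
  have r: "0 \<le> r" "r < 1" using lt by (auto simp: r_def sum_nonneg)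
  define s where "s N = (\<Sum>w<N. (cmod (chi \<beta> w))\<^sup>2)" for N
  have step: "s (Suc N) \<le> 1 + r * s N" for N
  proof -
    define g where "g p = (cmod (\<beta> (fst p)))\<^sup>2 * (cmod (chi \<beta> (snd p)))\<^sup>2" for p
    have "s (Suc N) = 1 + (\<Sum>n<N. g (prod_decode n))"
      unfolding s_def sum.lessThan_Suc_shift by (simp add: g_def letter_def rest_def norm_mult power_mult_distrib)
    also have "(\<Sum>n<N. g (prod_decode n)) = (\<Sum>p\<in>prod_decode ` {..<N}. g p)"
      by (simp add: sum.reindex inj_prod_decode)
    also have "\<dots> = (\<Sum>p\<in>prod_decode ` {..<N} \<inter> ({..<m} \<times> {..<N}). g p)"
    proof (rule sum.mono_neutral_right)
      show "\<forall>p\<in>prod_decode ` {..<N} - prod_decode ` {..<N} \<inter> ({..<m} \<times> {..<N}). g p = 0"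
      proof
        fix p assume p: "p \<in> prod_decode ` {..<N} - prod_decode ` {..<N} \<inter> ({..<m} \<times> {..<N})"
        then obtain n where n: "n < N" "p = prod_decode n" by auto
        have "snd p < N" using rest_le[of n] n by (simp add: rest_def)
        then have "\<not> fst p < m" using p by (auto simp: mem_Times_iff)
        then show "g p = 0" using fin by (simp add: g_def)
      qed
    qed auto
    also have "\<dots> \<le> (\<Sum>p\<in>{..<m} \<times> {..<N}. g p)"
      by (rule sum_mono2) (auto simp: g_def)
    also have "\<dots> = r * s N"
      by (simp add: r_def s_def g_def sum_product sum.cartesian_product case_prod_beta)
    finally show ?thesis by simp
  qed
  have "s N \<le> 1 / (1 - r)" for N
  proof (induction N)
    case 0
    then show ?case using r by (simp add: s_def)
  next
    case (Suc N)
    have "s (Suc N) \<le> 1 + r * (1 / (1 - r))"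
      using step[of N] mult_left_mono[OF Suc r(1)] by linarith
    also have "\<dots> = 1 / (1 - r)" using r by (simp add: field_simps)
    finally show ?case .
  qed
  then show ?thesis
    by (intro bounded_imp_summable[of _ "1 / (1 - r)"]) (auto simp only: s_def zero_le_power2 simp flip: lessThan_Suc_atMost)
qed

text \<open>Splitting off the first letter gives \<open>Z = (\<Sum>i<m. \<zeta> i) * Z + 1\<close>
  for the sum \<open>Z\<close>.\<close>

lemma chi_sums:
  assumes fin: "\<And>c. c \<ge> m \<Longrightarrow> \<zeta> c = 0" and s: "summable (chi \<zeta>)" and ne: "(\<Sum>c<m. \<zeta> c) \<noteq> 1"
  shows "chi \<zeta> sums (1 / (1 - (\<Sum>c<m. \<zeta> c)))"
proof -
  define Z where "Z = suminf (chi \<zeta>)"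
  have Z: "chi \<zeta> sums Z" using s by (simp add: Z_def summable_sums)
  have "(\<lambda>n. \<Sum>i<m. if letter n = i then \<zeta> i * chi \<zeta> (rest n) else 0) sums (\<Sum>i<m. \<zeta> i * Z)"
  proof (rule sums_sum)
    fix i
    have "(\<lambda>w. \<zeta> i * chi \<zeta> w) sums (\<zeta> i * Z)" by (rule sums_mult[OF Z])
    then show "(\<lambda>n. if letter n = i then \<zeta> i * chi \<zeta> (rest n) else 0) sums (\<zeta> i * Z)"
      by (subst sums_mono_reindex[OF strict_mono_prod_encode[of i], symmetric])
        (auto intro: rev_image_eqI simp: image_iff, metis encode_letter)
  qed
  also have "(\<lambda>n. \<Sum>i<m. if letter n = i then \<zeta> i * chi \<zeta> (rest n) else 0) = (\<lambda>n. chi \<zeta> (Suc n))"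
    using fin by (auto simp: fun_eq_iff not_less)
  finally have "(\<lambda>n. chi \<zeta> (Suc n)) sums (\<Sum>i<m. \<zeta> i * Z)" .
  then have "chi \<zeta> sums ((\<Sum>i<m. \<zeta> i * Z) + chi \<zeta> 0)" by (rule sums_Suc)
  then have "Z = (\<Sum>i<m. \<zeta> i) * Z + 1" using Z sums_unique2 by (fastforce simp: sum_distrib_right)
  then have "Z * (1 - (\<Sum>i<m. \<zeta> i)) = 1" by (simp add: algebra_simps)
  then have "Z = 1 / (1 - (\<Sum>i<m. \<zeta> i))" using ne by (simp add: field_simps)
  then show ?thesis using Z by simp
qed

text \<open>\<open>S\<close> is the coefficient space: the indices of a vector in \<open>T\<close>
  code words, so \<open>T\<close> is the full Fock space with coefficients in
  \<open>S\<close>.\<close>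

locale fock = hilbert S sc for S :: "'v::ab_group_add hspace" and sc

sublocale fock \<subseteq> k: hilbert "tensor_l2 S" "\<lambda>c h i. sc c (h i)"
  by (rule tensor_hilbert)

context fock begin

abbreviation create :: "nat \<Rightarrow> (nat \<Rightarrow> 'v) \<Rightarrow> nat \<Rightarrow> 'v"
  where "create i \<equiv> push (cons_code i)"

function creates :: "nat \<Rightarrow> (nat \<Rightarrow> 'v) \<Rightarrow> nat \<Rightarrow> 'v" where
  "creates 0 \<xi> = \<xi>"
| "creates (Suc m) \<xi> = create (letter m) (creates (rest m) \<xi>)"
  by pat_completeness auto
termination by (relation "Wellfounded.measure fst") (auto simp: rest_le less_Suc_eq_le)

lemma creates_cons: "creates (cons_code i w) \<xi> = create i (creates w \<xi>)"
  by (simp add: cons_code_def)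

lemma create_mem: "\<xi> \<in> carr T \<Longrightarrow> create i \<xi> \<in> carr T"
  by (rule push_mem[OF strict_mono_cons])

lemma annihilate_mem: "\<xi> \<in> carr T \<Longrightarrow> (\<lambda>w. \<xi> (cons_code i w)) \<in> carr T"
  by (rule pull_mem[OF strict_mono_cons])

lemma creates_mem: "\<xi> \<in> carr T \<Longrightarrow> creates w \<xi> \<in> carr T"
  by (induction w \<xi> rule: creates.induct) (auto intro: create_mem)

lemma ip_create: "\<xi> \<in> carr T \<Longrightarrow> \<eta> \<in> carr T \<Longrightarrow> ip T (create i \<xi>) \<eta> = ip T \<xi> (\<lambda>w. \<eta> (cons_code i w))"
  by (rule ip_push[OF strict_mono_cons])

lemma ip_create_create:
  "\<xi> \<in> carr T \<Longrightarrow> \<eta> \<in> carr T \<Longrightarrow> ip T (create i \<xi>) (create j \<eta>) = (if i = j then ip T \<xi> \<eta> else 0)"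
  by (simp add: ip_create create_mem push_pull[OF strict_mono_cons] push_pull_disjoint[OF cons_disjoint])

lemma nrm_creates: "\<xi> \<in> carr T \<Longrightarrow> hnorm T (creates w \<xi>) = hnorm T \<xi>"
  by (induction w \<xi> rule: creates.induct) (auto simp: nrm_push[OF strict_mono_cons] creates_mem)

text \<open>These are joint eigenvectors of the adjoints of the creation operators, with eigenvalues
  \<open>cnj (\<beta> i)\<close>; pairing with \<open>point \<beta> l\<close> is evaluation at
  \<open>\<beta>\<close> in the direction \<open>l\<close>.\<close>

definition point :: "(nat \<Rightarrow> complex) \<Rightarrow> 'v \<Rightarrow> nat \<Rightarrow> 'v"
  where "point \<beta> l = (\<lambda>w. sc (cnj (chi \<beta> w)) l)"

lemma point_mem:
  assumes "l \<in> carr S" "summable (\<lambda>w. (cmod (chi \<beta> w))\<^sup>2)"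
  shows "point \<beta> l \<in> carr T"
  using assms summable_mult2[OF assms(2), of "(nrm l)\<^sup>2"]
  by (simp add: tensor_mem_iff point_def nrm_sc power_mult_distrib)

lemma sc_sc: "u \<in> carr S \<Longrightarrow> sc c (sc d u) = sc (c * d) u"
  by (rule eqI) (auto simp: ip_sc)

lemma ip_create_point:
  assumes "\<xi> \<in> carr T" "l \<in> carr S" "summable (\<lambda>w. (cmod (chi \<beta> w))\<^sup>2)"
  shows "ip T (create i \<xi>) (point \<beta> l) = \<beta> i * ip T \<xi> (point \<beta> l)"
proof -
  have "(\<lambda>w. point \<beta> l (cons_code i w)) = (\<lambda>w. sc (cnj (\<beta> i)) (point \<beta> l w))"
    using assms by (simp add: point_def chi_cons sc_sc fun_eq_iff)
  then show ?thesis using assms k.ip_sc_right[OF point_mem[OF assms(2,3)] assms(1)]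
    by (simp add: ip_create point_mem)
qed

lemma ip_creates_point:
  assumes "\<xi> \<in> carr T" "l \<in> carr S" "summable (\<lambda>w. (cmod (chi \<beta> w))\<^sup>2)"
  shows "ip T (creates w \<xi>) (point \<beta> l) = chi \<beta> w * ip T \<xi> (point \<beta> l)"
  by (induction w rule: word_induct) (use assms in \<open>auto simp: ip_create_point creates_mem\<close>)

text \<open>The pairing is a geometric series over words. Its value is the Drury-Arveson kernel,
  which is the form that \<open>np_rows\<close> finds in \<open>H\<close>.\<close>

lemma ip_point_point:
  assumes "l \<in> carr S" "l' \<in> carr S"
    and b: "summable (\<lambda>w. (cmod (chi \<beta> w))\<^sup>2)" and c: "summable (\<lambda>w. (cmod (chi \<gamma> w))\<^sup>2)"
    and fin: "\<And>e. e \<ge> m \<Longrightarrow> \<beta> e = 0" and ne: "(\<Sum>e<m. \<beta> e * cnj (\<gamma> e)) \<noteq> 1"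
  shows "ip T (point \<gamma> l) (point \<beta> l') = ip S l l' / (1 - (\<Sum>e<m. \<beta> e * cnj (\<gamma> e)))"
proof -
  have "summable (\<lambda>w. chi \<beta> w * cnj (chi \<gamma> w))"
  proof (rule summable_comparison_test)
    show "summable (\<lambda>w. (cmod (chi \<beta> w))\<^sup>2 + (cmod (chi \<gamma> w))\<^sup>2)" by (rule summable_add[OF b c])
    have "norm (chi \<beta> w * cnj (chi \<gamma> w)) \<le> (cmod (chi \<beta> w))\<^sup>2 + (cmod (chi \<gamma> w))\<^sup>2" for w
      using cmod_mult_le[of "chi \<beta> w" "cnj (chi \<gamma> w)"] by simp
    then show "\<exists>N. \<forall>w\<ge>N. norm (chi \<beta> w * cnj (chi \<gamma> w)) \<le> (cmod (chi \<beta> w))\<^sup>2 + (cmod (chi \<gamma> w))\<^sup>2" by blast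
  qed
  then have "(\<lambda>w. chi \<beta> w * cnj (chi \<gamma> w)) sums (1 / (1 - (\<Sum>e<m. \<beta> e * cnj (\<gamma> e))))"
    using chi_sums[of m "\<lambda>c. \<beta> c * cnj (\<gamma> c)"] fin ne by (simp add: chi_mult_cnj[abs_def])
  from sums_mult2[OF this, of "ip S l l'"]
  have "(\<lambda>w. ip S (point \<gamma> l w) (point \<beta> l' w)) sums (1 / (1 - (\<Sum>e<m. \<beta> e * cnj (\<gamma> e))) * ip S l l')"
    using assms(1,2) by (simp add: point_def ip_sc ip_sc_right mult_ac)
  then show ?thesis by (simp add: ip_tensor sums_iff)
qed

text \<open>
  The wandering subspace of the cyclic subspace of \<open>a\<close> is spanned by
  \<open>\<omega> = a - P a\<close>, with \<open>P\<close> the projection onto the span of the proper shifts of \<open>a\<close>. This is the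
  inner-outer factorization of \<open>a\<close>; the last two conclusions express it through the values at the
  points \<open>\<beta>\<close>.
\<close>

lemma inner_outer:
  assumes a: "a \<in> carr T"
  obtains \<omega> h where "\<omega> \<in> carr T" "summable (\<lambda>w. (cmod (h w))\<^sup>2)" "(\<Sum>w. (cmod (h w))\<^sup>2) \<le> (hnorm T a)\<^sup>2"
    "\<And>\<beta> l. l \<in> carr S \<Longrightarrow> summable (\<lambda>w. (cmod (chi \<beta> w))\<^sup>2) \<Longrightarrow>
        ip T a (point \<beta> l) = (\<Sum>w. h w * chi \<beta> w) * ip T \<omega> (point \<beta> l)"
    "\<And>g m. \<exists>\<xi>\<in>carr T. (hnorm T \<xi>)\<^sup>2 \<le> (\<Sum>w<m. (cmod (g w))\<^sup>2) \<and>
       (\<forall>\<beta> l. l \<in> carr S \<longrightarrow> summable (\<lambda>w. (cmod (chi \<beta> w))\<^sup>2) \<longrightarrow>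
          ip T \<xi> (point \<beta> l) = (\<Sum>w<m. g w * chi \<beta> w) * ip T \<omega> (point \<beta> l))"
proof -
  define A where "A = range (\<lambda>w. creates w a)"
  define A1 where "A1 = range (\<lambda>m. creates (Suc m) a)"
  have A: "A \<subseteq> carr T" and A1: "A1 \<subseteq> carr T" and A1A: "A1 \<subseteq> A"
    using creates_mem[OF a] by (auto simp: A_def A1_def simp del: creates.simps)
  have cA1: "creates (cons_code i w) a \<in> A1" for i w by (simp add: A1_def cons_code_def del: creates.simps)
  obtain p where p: "p \<in> k.orth (k.orth A1)" "a - p \<in> k.orth A1" using k.projection[OF A1 a] .
  define \<omega>0 where "\<omega>0 = a - p"
  have pT: "p \<in> carr T" using p k.orth_mem by blast
  have \<omega>0: "\<omega>0 \<in> carr T" using p k.orth_mem by (auto simp: \<omega>0_def)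
  have \<omega>0A1: "\<omega>0 \<in> k.orth A1" using p by (simp add: \<omega>0_def)
  have pA: "p \<in> k.orth (k.orth A)" using p k.orth_mono[OF k.orth_mono[OF A1A]] by blast
  have aA: "a \<in> A" unfolding A_def by (rule range_eqI[of _ _ 0]) simp
  have \<omega>0A: "\<omega>0 \<in> k.orth (k.orth A)"
    unfolding \<omega>0_def using pA k.orth_orth_sup[OF A aA] k.orth_diff[OF k.orth_carr] by blast
  \<comment> \<open>Adjoint form of the fact that creation maps \<open>A\<close> into
    \<open>A1\<close>.\<close>
  have ann: "(\<lambda>w. z (cons_code i w)) \<in> k.orth A" if z: "z \<in> k.orth A1" for z i
  proof -
    have zT: "z \<in> carr T" using z k.orth_mem by blast
    have "ip T (creates w a) (\<lambda>w. z (cons_code i w)) = 0" for w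
      using ip_create[OF creates_mem[OF a] zT, of i w] k.orthD[OF z cA1, of i w] by (simp add: creates_cons)
    then show ?thesis using annihilate_mem[OF zT] by (auto simp: k.orth_def A_def)
  qed
  have create_A: "create i \<xi> \<in> k.orth (k.orth A1)" if \<xi>: "\<xi> \<in> k.orth (k.orth A)" for \<xi> i
  proof -
    have \<xi>T: "\<xi> \<in> carr T" using \<xi> k.orth_mem by blast
    have "ip T z (create i \<xi>) = 0" if z: "z \<in> k.orth A1" for z
    proof -
      have zT: "z \<in> carr T" using z k.orth_mem by blast
      have "ip T (create i \<xi>) z = 0"
        using ip_create[OF \<xi>T zT] k.ip_orth_orth[OF \<xi> ann[OF z]] by simp
      then show ?thesis using k.ip_cnj[OF create_mem[OF \<xi>T, of i] zT] by simp
    qed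
    then show ?thesis using create_mem[OF \<xi>T] by (auto simp: k.orth_def)
  qed
  have A1A': "\<xi> \<in> k.orth (k.orth A)" if "\<xi> \<in> k.orth (k.orth A1)" for \<xi>
    using that k.orth_mono[OF k.orth_mono[OF A1A]] by blast
  have creates_\<omega>A: "creates w \<omega>0 \<in> k.orth (k.orth A)" for w
    by (induction w rule: word_induct) (use \<omega>0A create_A A1A' in auto)
  \<comment> \<open>Equal first letters cancel and different ones are orthogonal; what remains is a
    proper shift against \<open>\<omega>0\<close> itself.\<close>
  have orth: "ip T (creates w \<omega>0) (creates v \<omega>0) = 0" if "w \<noteq> v" for w v
    using that
  proof (induction "w + v" arbitrary: w v rule: less_induct)
    case less
    have z0: "ip T (creates (Suc m) \<omega>0) \<omega>0 = 0" for m
      using k.ip_orth_orth[OF create_A[OF creates_\<omega>A] \<omega>0A1] by simp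
    show ?case
    proof (cases w)
      case 0
      then obtain m where m: "v = Suc m" using less by (cases v) auto
      show ?thesis using z0[of m] k.ip_cnj[OF creates_mem[OF \<omega>0, of "Suc m"] \<omega>0] 0 m by simp
    next
      case (Suc m)
      show ?thesis
      proof (cases v)
        case 0
        then show ?thesis using z0[of m] Suc by simp
      next
        case (Suc n)
        have "letter m = letter n \<Longrightarrow> rest m \<noteq> rest n" using less Suc \<open>w = Suc m\<close> encode_letter by metis
        then show ?thesis
          using Suc \<open>w = Suc m\<close> less(1)[of "rest m" "rest n"] rest_le[of m] rest_le[of n]
          by (auto simp: ip_create_create creates_mem \<omega>0)
      qed
    qed
  qed
  define B where "B = range (\<lambda>w. creates w \<omega>0)"
  have B: "B \<subseteq> carr T" using creates_mem[OF \<omega>0] by (auto simp: B_def)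
  have \<omega>0B: "\<omega>0 \<in> B" unfolding B_def by (rule range_eqI[of _ _ 0]) simp
  \<comment> \<open>This excludes a remainder as in the Wold decomposition. Such a
    \<open>\<xi>\<close> lies in the closed span of \<open>A1\<close>, so its coefficient at the
    empty word vanishes; removing a first letter gives a vector with the same two properties, so
    induction on the word reaches every coefficient.\<close>
  have key: "\<xi> n = 0" if "\<xi> \<in> k.orth (k.orth A)" "\<xi> \<in> k.orth B" for \<xi> n
    using that
  proof (induction n arbitrary: \<xi> rule: less_induct)
    case (less n)
    have \<xi>T: "\<xi> \<in> carr T" using less k.orth_mem by blast
    have \<xi>A1: "ip T \<xi> z = 0" if z: "z \<in> k.orth A1" for z
    proof -
      have zT: "z \<in> carr T" using z k.orth_mem by blast
      \<comment> \<open>Subtracting \<open>\<mu>\<close> times \<open>\<omega>0\<close> makes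
        \<open>z'\<close> orthogonal to \<open>\<omega>0\<close> as well as to \<open>p\<close>,
        hence to \<open>a = p + \<omega>0\<close>.\<close>
      define \<mu> where "\<mu> = (if \<omega>0 = 0 then 0 else cnj (ip T \<omega>0 z) / complex_of_real ((hnorm T \<omega>0)\<^sup>2))"
      define z' where "z' = z - (\<lambda>i. sc \<mu> (\<omega>0 i))"
      have s\<omega>: "(\<lambda>i. sc \<mu> (\<omega>0 i)) \<in> k.orth A1" by (rule k.orth_sc[OF A1 \<omega>0A1])
      have z': "z' \<in> k.orth A1" unfolding z'_def by (rule k.orth_diff[OF A1 z s\<omega>])
      have "ip T p z' = 0" using k.ip_orth_orth[OF p(1) z'] .
      moreover have "ip T \<omega>0 z' = 0"
      proof (cases "\<omega>0 = 0")
        case True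
        then show ?thesis using k.orth_mem[OF z'] by simp
      next
        case False
        then have "hnorm T \<omega>0 \<noteq> 0" using k.nrm_eq_0[OF \<omega>0] by blast
        moreover have "ip T \<omega>0 z' = ip T \<omega>0 z - cnj \<mu> * complex_of_real ((hnorm T \<omega>0)\<^sup>2)"
          unfolding z'_def using k.ip_diff_right[OF zT _ \<omega>0] k.ip_sc_right[OF \<omega>0 \<omega>0] k.ip_self[OF \<omega>0]
          by (simp add: k.sc_mem[OF \<omega>0])
        ultimately show ?thesis using False by (simp add: \<mu>_def)
      qed
      ultimately have "ip T a z' = 0"
        using k.ip_add[OF pT \<omega>0 k.orth_mem[OF z']] by (simp add: \<omega>0_def)
      have "z' \<in> k.orth A"
      proof -
        have "ip T (creates w a) z' = 0" for w
          using \<open>ip T a z' = 0\<close> k.orthD[OF z', of "creates w a"] by (cases w) (auto simp: A1_def simp del: creates.simps(2))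
        then show ?thesis using k.orth_mem[OF z'] by (auto simp: k.orth_def A_def)
      qed
      then have "ip T \<xi> z' = 0" using less.prems k.ip_orth_orth by blast
      moreover have "ip T \<xi> \<omega>0 = 0"
        using k.orthD[OF less.prems(2) \<omega>0B] k.ip_cnj[OF \<omega>0 \<xi>T] by simp
      moreover have "ip T \<xi> z' = ip T \<xi> z - cnj \<mu> * ip T \<xi> \<omega>0"
        unfolding z'_def using k.ip_diff_right[OF zT _ \<xi>T] k.ip_sc_right[OF \<omega>0 \<xi>T] k.sc_mem[OF \<omega>0] by simp
      ultimately show ?thesis by simp
    qed
    show ?case
    proof (cases n)
      case 0
      have "ip S (\<xi> 0) l = 0" if l: "l \<in> carr S" for l
      proof -
        have "single 0 l \<in> k.orth A1"
          using single_mem[OF l, of 0] ip_single[OF l creates_mem[OF a]]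
          by (auto simp: k.orth_def A1_def ip_single[OF l] creates_mem a create_mem
              push_apply_notin[OF zero_notin_cons] l)
        then show ?thesis using \<xi>A1 ip_single[OF l \<xi>T] by metis
      qed
      then have "\<xi> 0 = 0" by (intro eqI) (auto simp: tensor_memD[OF \<xi>T])
      then show ?thesis using 0 by simp
    next
      case (Suc m)
      define \<eta> where "\<eta> = (\<lambda>w. \<xi> (cons_code (letter m) w))"
      have \<eta>T: "\<eta> \<in> carr T" unfolding \<eta>_def by (rule annihilate_mem[OF \<xi>T])
      have "\<eta> \<in> k.orth (k.orth A)"
      proof -
        have "ip T z \<eta> = 0" if z: "z \<in> k.orth A" for z
        proof -
          have zT: "z \<in> carr T" using z k.orth_mem by blast
          have "create (letter m) z \<in> k.orth A1"
          proof -
            have "ip T (creates (Suc n) a) (create (letter m) z) = 0" for n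
              using k.orthD[OF z, of "creates (rest n) a"] by (auto simp: ip_create_create creates_mem a zT A_def)
            then show ?thesis using create_mem[OF zT] by (auto simp: k.orth_def A1_def)
          qed
          then have "ip T \<xi> (create (letter m) z) = 0" by (rule \<xi>A1)
          then have "ip T (create (letter m) z) \<xi> = 0"
            using k.ip_cnj[OF \<xi>T create_mem[OF zT]] by simp
          then show ?thesis using ip_create[OF zT \<xi>T] by (simp add: \<eta>_def)
        qed
        then show ?thesis using \<eta>T by (simp add: k.orth_def)
      qed
      moreover have "\<eta> \<in> k.orth B"
      proof -
        have "ip T (creates w \<omega>0) \<eta> = 0" for w
          using ip_create[OF creates_mem[OF \<omega>0] \<xi>T, of "letter m" w]
            k.orthD[OF less.prems(2), of "creates (cons_code (letter m) w) \<omega>0"]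
          by (simp add: \<eta>_def creates_cons B_def)
             (metis creates_cons rangeI)
        then show ?thesis using \<eta>T by (auto simp: k.orth_def B_def)
      qed
      ultimately have "\<eta> (rest m) = 0" using less.IH[of "rest m" \<eta>] Suc rest_le[of m] by simp
      then show ?thesis using Suc by (simp add: \<eta>_def cons_letter_rest)
    qed
  qed
  obtain q where q: "q \<in> k.orth (k.orth B)" "a - q \<in> k.orth B" using k.projection[OF B a] .
  have BA: "k.orth (k.orth B) \<subseteq> k.orth (k.orth A)"
  proof -
    have "k.orth A \<subseteq> k.orth B"
    proof
      fix z assume z: "z \<in> k.orth A"
      then have zT: "z \<in> carr T" using k.orth_mem by blast
      have "ip T (creates w \<omega>0) z = 0" for w using k.ip_orth_orth[OF creates_\<omega>A z] .
      then show "z \<in> k.orth B" using zT by (auto simp: k.orth_def B_def)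
    qed
    then show ?thesis by (rule k.orth_mono)
  qed
  have "a - q \<in> k.orth (k.orth A)"
    using q BA k.orth_orth_sup[OF A aA] k.orth_diff[OF k.orth_carr] by blast
  then have "(a - q) n = 0" for n using key q(2) by blast
  then have "a - q = 0" by (simp only: fun_eq_iff zero_fun_def) simp
  then have aB: "a \<in> k.orth (k.orth B)" using q by simp
  show thesis
  proof (cases "\<omega>0 = 0")
    case True
    have "creates w \<omega>0 = 0" for w
      using k.nrm_eq_0[OF creates_mem[OF \<omega>0]] nrm_creates[OF \<omega>0] True by simp
    then have "B = {0}" by (auto simp: B_def)
    then have "a \<in> k.orth B" using a by (simp add: k.orth_def)
    then have "a = 0" using k.orth_inter[OF B _ aB] by blast
    have z: "ip T 0 (point \<beta> l) = 0" if "l \<in> carr S" "summable (\<lambda>w. (cmod (chi \<beta> w))\<^sup>2)" for \<beta> l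
      using point_mem[OF that] by simp
    show thesis
    proof (rule that[of 0 "\<lambda>_. 0"])
      show "\<exists>\<xi>\<in>carr T. (hnorm T \<xi>)\<^sup>2 \<le> (\<Sum>w<m. (cmod (g w))\<^sup>2) \<and>
       (\<forall>\<beta> l. l \<in> carr S \<longrightarrow> summable (\<lambda>w. (cmod (chi \<beta> w))\<^sup>2) \<longrightarrow>
          ip T \<xi> (point \<beta> l) = (\<Sum>w<m. g w * chi \<beta> w) * ip T 0 (point \<beta> l))" for g :: "nat \<Rightarrow> complex" and m
        using z by (intro bexI[of _ 0]) (auto simp: sum_nonneg)
    qed (use z \<open>a = 0\<close> in auto)
  next
    case False
    define r where "r = hnorm T \<omega>0"
    have r: "r > 0" using False k.nrm_eq_0[OF \<omega>0] k.nrm_nonneg[OF \<omega>0] by (auto simp: r_def less_le)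
    \<comment> \<open>The normalised shifts are an orthonormal basis of
      \<open>k.orth (k.orth B)\<close>, which contains \<open>a\<close>. The numbers
      \<open>h w\<close> are the coefficients of \<open>a\<close>, and by the eigenvector property
      the expansion evaluated at a point splits into the two factors.\<close>
    define e where "e w = (\<lambda>i. sc (1 / complex_of_real r) (creates w \<omega>0 i))" for w
    have e: "e w \<in> carr T" for w unfolding e_def by (rule k.sc_mem[OF creates_mem[OF \<omega>0]])
    have on: "ip T (e v) (e w) = of_bool (v = w)" for v w
    proof -
      have "ip T (e v) (e w) = ip T (creates v \<omega>0) (creates w \<omega>0) / complex_of_real (r\<^sup>2)"
        unfolding e_def using k.ip_sc[OF creates_mem[OF \<omega>0] k.sc_mem[OF creates_mem[OF \<omega>0]]]
          k.ip_sc_right[OF creates_mem[OF \<omega>0] creates_mem[OF \<omega>0]] by (simp add: power2_eq_square)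
      then show ?thesis using orth[of v w] k.ip_self[OF creates_mem[OF \<omega>0]] nrm_creates[OF \<omega>0] r
        by (auto simp: r_def[symmetric])
    qed
    have orth_e: "k.orth (range e) = k.orth B"
    proof -
      have "ip T (e w) z = 0 \<longleftrightarrow> ip T (creates w \<omega>0) z = 0" if "z \<in> carr T" for w z
        unfolding e_def using k.ip_sc[OF creates_mem[OF \<omega>0] that] r by simp
      then show ?thesis by (auto simp: k.orth_def B_def)
    qed
    define h where "h w = ip T a (e w)" for w
    have e_point: "ip T (e w) (point \<beta> l) = chi \<beta> w * ip T (e 0) (point \<beta> l)"
      if "l \<in> carr S" "summable (\<lambda>w. (cmod (chi \<beta> w))\<^sup>2)" for \<beta> l w
      unfolding e_def using k.ip_sc[OF creates_mem[OF \<omega>0] point_mem[OF that]] ip_creates_point[OF \<omega>0 that]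
        k.ip_sc[OF \<omega>0 point_mem[OF that]] by simp
    have h_part: "(\<Sum>w<N. (cmod (h w))\<^sup>2) \<le> (hnorm T a)\<^sup>2" for N
      unfolding h_def by (rule k.bessel[OF e on a]) simp
    have h_sm: "summable (\<lambda>w. (cmod (h w))\<^sup>2)"
      by (rule bounded_imp_summable[of _ "(hnorm T a)\<^sup>2"]) (simp_all only: zero_le_power2 h_part lessThan_Suc_atMost[symmetric])
    show thesis
    proof (rule that[of "e 0" h, OF e h_sm])
      show "(\<Sum>w. (cmod (h w))\<^sup>2) \<le> (hnorm T a)\<^sup>2" by (rule suminf_le_const[OF h_sm h_part])
      show "ip T a (point \<beta> l) = (\<Sum>w. h w * chi \<beta> w) * ip T (e 0) (point \<beta> l)"
        if l: "l \<in> carr S" "summable (\<lambda>w. (cmod (chi \<beta> w))\<^sup>2)" for \<beta> l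
      proof -
        have "(\<lambda>w. ip T a (e w) * ip T (e w) (point \<beta> l)) sums ip T a (point \<beta> l)"
          by (rule k.parseval[OF e on _ point_mem[OF l]]) (simp add: orth_e aB)
        moreover have "(\<lambda>w. ip T a (e w) * ip T (e w) (point \<beta> l)) = (\<lambda>w. (h w * chi \<beta> w) * ip T (e 0) (point \<beta> l))"
          unfolding h_def mult.assoc by (rule ext) (rule arg_cong[OF e_point[OF l]])
        ultimately have s1: "(\<lambda>w. (h w * chi \<beta> w) * ip T (e 0) (point \<beta> l)) sums ip T a (point \<beta> l)" by simp
        have "summable (\<lambda>w. h w * chi \<beta> w)"
        proof (rule summable_comparison_test)
          show "summable (\<lambda>w. (cmod (h w))\<^sup>2 + (cmod (chi \<beta> w))\<^sup>2)" by (rule summable_add[OF h_sm l(2)])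
          have "norm (h w * chi \<beta> w) \<le> (cmod (h w))\<^sup>2 + (cmod (chi \<beta> w))\<^sup>2" for w
            by (rule cmod_mult_le)
          then show "\<exists>N. \<forall>w\<ge>N. norm (h w * chi \<beta> w) \<le> (cmod (h w))\<^sup>2 + (cmod (chi \<beta> w))\<^sup>2" by blast
        qed
        from sums_mult2[OF summable_sums[OF this], of "ip T (e 0) (point \<beta> l)"] s1
        show ?thesis using sums_unique2 by blast
      qed
      show "\<exists>\<xi>\<in>carr T. (hnorm T \<xi>)\<^sup>2 \<le> (\<Sum>w<m. (cmod (g w))\<^sup>2) \<and>
       (\<forall>\<beta> l. l \<in> carr S \<longrightarrow> summable (\<lambda>w. (cmod (chi \<beta> w))\<^sup>2) \<longrightarrow>
          ip T \<xi> (point \<beta> l) = (\<Sum>w<m. g w * chi \<beta> w) * ip T (e 0) (point \<beta> l))" for g :: "nat \<Rightarrow> complex" and m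
      proof (intro bexI conjI allI impI)
        \<comment> \<open>The image of \<open>g\<close> under the isometry taking the
          \<open>w\<close>-th unit vector to \<open>e w\<close>; it serves to test that the inner
          factor is contractive.\<close>
        let ?\<xi> = "\<Sum>w<m. (\<lambda>i. sc (g w) (e w i))"
        show "?\<xi> \<in> carr T" by (intro k.sum_mem k.sc_mem e)
        show "(hnorm T ?\<xi>)\<^sup>2 \<le> (\<Sum>w<m. (cmod (g w))\<^sup>2)"
          using k.orthonormal_partial[OF e on, of "{..<m}" g] by simp
        fix \<beta> l assume l: "l \<in> carr S" "summable (\<lambda>w. (cmod (chi \<beta> w))\<^sup>2)"
        have "ip T ?\<xi> (point \<beta> l) = (\<Sum>w<m. g w * ip T (e w) (point \<beta> l))"
          using k.ip_sum[of "{..<m}" "\<lambda>w i. sc (g w) (e w i)"] k.sc_mem[OF e] point_mem[OF l] k.ip_sc[OF e]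
          by simp
        then show "ip T ?\<xi> (point \<beta> l) = (\<Sum>w<m. g w * chi \<beta> w) * ip T (e 0) (point \<beta> l)"
          unfolding sum_distrib_right mult.assoc using e_point[OF l] by (metis (no_types, lifting) sum.cong)
      qed
    qed
  qed
qed

end

section \<open>Factorization through a column multiplier\<close>

abbreviation l2 :: "(nat \<Rightarrow> complex) hspace" where "l2 \<equiv> tensor_l2 cplx"

abbreviation fock2 :: "(nat \<Rightarrow> nat \<Rightarrow> complex) hspace" where "fock2 \<equiv> tensor_l2 l2"

text \<open>Two Fock spaces occur. The scalar one, \<open>cf\<close>, receives the kernel functions
  and the coefficients of the common factor; \<open>lf\<close> has coefficients in
  \<open>l2\<close>, one slot for each entry of the sequence to be factorized.\<close>

interpretation cf: fock cplx "(*)"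
  by (simp add: fock_def cplx_hilbert)

interpretation lf: fock "tensor_l2 cplx" "\<lambda>c h i. c * h i"
  using cf.tensor_hilbert by (simp add: fock_def)

lemma l2_ip_finite:
  "(\<And>n. n \<ge> N \<Longrightarrow> v n = 0) \<Longrightarrow> ip (tensor_l2 cplx) u v = (\<Sum>n<N. u n * cnj (v n))"
  unfolding cf.ip_tensor by (subst suminf_finite[of "{..<N}"]) (auto simp: not_less)

lemma (in fock) point_sum:
  assumes "\<And>i. i \<in> I \<Longrightarrow> l i \<in> carr S"
  shows "point \<beta> (\<Sum>i\<in>I. sc (c i) (l i)) = (\<Sum>i\<in>I. (\<lambda>w. sc (c i) (point \<beta> (l i) w)))"
proof
  fix w
  have "sc d (\<Sum>i\<in>I. sc (c i) (l i)) = (\<Sum>i\<in>I. sc (c i) (sc d (l i)))" for d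
    using assms by (intro eqI) (auto simp: ip_sc ip_sum sum_distrib_left mult_ac)
  then show "point \<beta> (\<Sum>i\<in>I. sc (c i) (l i)) w = (\<Sum>i\<in>I. (\<lambda>w. sc (c i) (point \<beta> (l i) w))) w"
    by (simp add: point_def sum_fun_apply)
qed

context rkhs begin

lemma np_rows_set:
  assumes np: "complete_np H" and F: "finite F" "s \<in> F" and ne: "\<And>x. x \<in> F \<Longrightarrow> kernel H x s \<noteq> 0"
  obtains b :: "'x \<Rightarrow> nat \<Rightarrow> complex" and m
  where "\<And>x c. x \<in> F \<Longrightarrow> c \<ge> m \<Longrightarrow> b x c = 0"
    "\<And>x y. x \<in> F \<Longrightarrow> y \<in> F \<Longrightarrow>
      (1 - (\<Sum>c<m. b x c * cnj (b y c))) * kernel H x y = kernel H x s * kernel H s y / kernel H s s"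
proof -
  obtain xs where xs: "set xs = F" using F finite_list by blast
  \<comment> \<open>The base point \<open>s\<close> gets index \<open>0\<close>, as
    \<open>np_rows\<close> expects; it may occur again in the list.\<close>
  define x where "x i = (s # xs) ! i" for i
  define n where "n = Suc (length xs)"
  have x0: "x 0 = s" by (simp add: x_def)
  have x_im: "x i \<in> F" if "i < n" for i
    using that F xs nth_mem[of i "s # xs"] by (auto simp: x_def n_def)
  have "\<exists>i<n. x i = y" if "y \<in> F" for y
    using that xs in_set_conv_nth[of y "s # xs"] by (auto simp: x_def n_def)
  then obtain idx where idx: "\<And>y. y \<in> F \<Longrightarrow> idx y < n" "\<And>y. y \<in> F \<Longrightarrow> x (idx y) = y" by metis
  obtain b where b: "\<And>i c. i < c \<Longrightarrow> b i c = 0" 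
    "\<And>i j. i < n \<Longrightarrow> j < n \<Longrightarrow> (1 - (\<Sum>c<n. b i c * cnj (b j c))) * kernel H (x i) (x j) =
        kernel H (x i) s * kernel H s (x j) / kernel H s s"
  proof -
    have n1: "n \<ge> 1" by (simp add: n_def)
    have ne': "kernel H (x i) (x 0) \<noteq> 0" if "i < n" for i using ne x_im[OF that] x0 by simp
    from np_rows[where n = n and x = x, OF np ne' n1] show thesis using that unfolding x0 by blast
  qed
  show thesis
  proof (rule that[of n "\<lambda>y. b (idx y)"])
    show "b (idx y) c = 0" if "y \<in> F" "n \<le> c" for y c using that b(1) idx(1)[of y] by simp
    show "(1 - (\<Sum>c<n. b (idx y) c * cnj (b (idx z) c))) * kernel H y z = kernel H y s * kernel H s z / kernel H s s"
      if "y \<in> F" "z \<in> F" for y z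
      using b(2)[of "idx y" "idx z"] idx that by simp
  qed
qed

lemma kernel_sym_ne: "kernel H x y \<noteq> 0 \<Longrightarrow> kernel H y x \<noteq> 0"
  using kernel_cnj by (metis complex_cnj_zero_iff)

text \<open>In the identity at the points \<open>s\<close>, \<open>x\<close>, \<open>y\<close> the
  right side is nonzero. With symmetry, nonvanishing of the kernel becomes an equivalence relation
  among points with nonzero diagonal; its classes are treated separately.\<close>

lemma kernel_ne_trans:
  assumes np: "complete_np H" and "kernel H x s \<noteq> 0" "kernel H y s \<noteq> 0"
  shows "kernel H x y \<noteq> 0"
proof -
  have ss: "kernel H s s \<noteq> 0" using kernel_diag_ne[OF kernel_sym_ne[OF assms(2)]] .
  obtain b :: "'x \<Rightarrow> nat \<Rightarrow> complex" and m where
    "\<And>z z'. z \<in> {s, x, y} \<Longrightarrow> z' \<in> {s, x, y} \<Longrightarrow>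
      (1 - (\<Sum>c<m. b z c * cnj (b z' c))) * kernel H z z' = kernel H z s * kernel H s z' / kernel H s s"
    by (rule np_rows_set[OF np, of "{s, x, y}" s]) (use assms ss in auto)
  from this[of x y] show ?thesis using assms ss kernel_sym_ne[OF assms(3)] by auto
qed

lemma kernel_diag_pos: "kernel H x x \<noteq> 0 \<Longrightarrow> 0 < Re (kernel H x x)" "kernel H x x = complex_of_real (Re (kernel H x x))"
  by (auto simp: kernel_diag)

text \<open>This is the kernel identity on the diagonal. The second form expresses the norm of
  \<open>b\<close> by the kernel alone, which makes the bounds in
  \<open>kernel_quotient_multiplier\<close> uniform over finite sets.\<close>

lemma np_rows_lt:
  assumes "kernel H x s \<noteq> 0" "kernel H s s \<noteq> 0"
    and eq: "(1 - (\<Sum>c<m. b c * cnj (b c))) * kernel H x x = kernel H x s * kernel H s x / kernel H s s"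
  shows "(\<Sum>c<m. (cmod (b c))\<^sup>2) < 1"
    "(\<Sum>c<m. (cmod (b c))\<^sup>2) = 1 - (cmod (kernel H x s))\<^sup>2 / (Re (kernel H s s) * Re (kernel H x x))"
proof -
  have xx: "kernel H x x \<noteq> 0" using kernel_diag_ne assms(1) by blast
  let ?r = "\<Sum>c<m. (cmod (b c))\<^sup>2"
  have "complex_of_real ((1 - ?r) * Re (kernel H x x)) = (1 - (\<Sum>c<m. b c * cnj (b c))) * kernel H x x"
    using kernel_diag_pos(2)[of x] unfolding of_real_mult of_real_diff of_real_sum complex_norm_square by simp
  also have "\<dots> = complex_of_real ((cmod (kernel H x s))\<^sup>2 / Re (kernel H s s))"
    unfolding eq of_real_divide complex_norm_square kernel_diag_pos(2)[of s, symmetric]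
    by (simp add: kernel_cnj[of s x])
  finally have e: "(1 - ?r) * Re (kernel H x x) = (cmod (kernel H x s))\<^sup>2 / Re (kernel H s s)"
    by (simp only: of_real_eq_iff)
  then have "1 - ?r = (cmod (kernel H x s))\<^sup>2 / (Re (kernel H s s) * Re (kernel H x x))"
    using kernel_diag_pos(1)[OF xx] by (metis divide_divide_eq_left less_irrefl nonzero_eq_divide_eq)
  moreover have "(cmod (kernel H x s))\<^sup>2 / (Re (kernel H s s) * Re (kernel H x x)) > 0"
    using assms(1) kernel_diag_pos(1)[OF xx] kernel_diag_pos(1)[OF assms(2)] by simp
  ultimately show "?r < 1" "?r = 1 - (cmod (kernel H x s))\<^sup>2 / (Re (kernel H s s) * Re (kernel H x x))"
    by linarith+
qed

text \<open>The last two clauses are dual bounds: \<open>h\<close> has norm at most \<open>C\<close>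
  as a function on \<open>F\<close>, and the column \<open>\<theta>\<close> is contractive on
  \<open>F\<close>, stated for the adjoint, which maps \<open>k_x\<close> in slot \<open>n\<close>
  to \<open>cnj (\<theta> n x) k_x\<close>.\<close>

definition factors :: "'x set \<Rightarrow> nat \<Rightarrow> (nat \<Rightarrow> 'x \<Rightarrow> complex) \<Rightarrow> real \<Rightarrow> ('x \<Rightarrow> complex) \<Rightarrow> (nat \<Rightarrow> 'x \<Rightarrow> complex) \<Rightarrow> bool"
  where "factors F N a C h \<theta> \<longleftrightarrow>
    (\<forall>n<N. \<forall>x\<in>F. a n x = \<theta> n x * h x) \<and>
    (\<forall>\<beta>. cmod (\<Sum>x\<in>F. h x * cnj (\<beta> x)) \<le> C * hs.nrm (kcomb F \<beta>)) \<and>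
    (\<forall>\<beta>. (hs.nrm (kcomb F (\<lambda>x. \<Sum>n<N. cnj (\<theta> n x) * \<beta> n x)))\<^sup>2 \<le> (\<Sum>n<N. (hs.nrm (kcomb F (\<beta> n)))\<^sup>2))"

text \<open>Inside one component the kernel is
  \<open>c x * cnj (c y) / (1 - \<langle>b x, b y\<rangle>)\<close>, so the kernel functions map
  isometrically to the vectors \<open>v x\<close> of the Fock space. The whole sequence becomes one
  vector of \<open>fock2\<close>, whose inner-outer factorization supplies both factors.\<close>

lemma factor_component:
  assumes np: "complete_np H" and F: "finite F" "s \<in> F" and ne: "\<And>x. x \<in> F \<Longrightarrow> kernel H x s \<noteq> 0"
  shows "\<exists>h \<theta>. factors F N (\<lambda>n. kcomb F (\<alpha> n)) (sqrt (\<Sum>n<N. (hs.nrm (kcomb F (\<alpha> n)))\<^sup>2)) h \<theta>"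
proof -
  obtain b :: "'x \<Rightarrow> nat \<Rightarrow> complex" and m
    where b0: "\<And>x c. x \<in> F \<Longrightarrow> c \<ge> m \<Longrightarrow> b x c = 0"
      and bK: "\<And>x y. x \<in> F \<Longrightarrow> y \<in> F \<Longrightarrow>
      (1 - (\<Sum>c<m. b x c * cnj (b y c))) * kernel H x y = kernel H x s * kernel H s y / kernel H s s"
    by (rule np_rows_set[OF np F ne]) blast+
  have ss: "kernel H s s \<noteq> 0" using ne F by blast
  define k0 where "k0 = Re (kernel H s s)"
  have k0: "kernel H s s = complex_of_real k0" "k0 > 0" using kernel_diag_pos(1)[OF ss] kernel_diag_pos(2)[of s] by (auto simp: k0_def)
  have lt: "(\<Sum>c<m. (cmod (b x c))\<^sup>2) < 1" if "x \<in> F" for x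
    using np_rows_lt(1)[OF ne[OF that] ss bK[OF that that]] .
  have sm: "summable (\<lambda>w. (cmod (chi (b x) w))\<^sup>2)" if "x \<in> F" for x
    using chi_summable[OF b0[OF that] lt[OF that]] by blast
  have ne1: "(\<Sum>c<m. b x c * cnj (b y c)) \<noteq> 1" if "x \<in> F" "y \<in> F" for x y
    using bK[OF that] ne[OF that(1)] kernel_sym_ne[OF ne[OF that(2)]] ss by auto
  define c where "c x = kernel H x s / complex_of_real (sqrt k0)" for x
  have cK: "c x * cnj (c y) / (1 - (\<Sum>e<m. b x e * cnj (b y e))) = kernel H x y" if "x \<in> F" "y \<in> F" for x y
  proof -
    have "complex_of_real (sqrt k0) * complex_of_real (sqrt k0) = kernel H s s"
      using k0 by (simp flip: of_real_mult)
    then have "c x * cnj (c y) = kernel H x s * kernel H s y / kernel H s s"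
      by (simp add: c_def kernel_cnj[of y s])
    then have "c x * cnj (c y) = (1 - (\<Sum>e<m. b x e * cnj (b y e))) * kernel H x y" using bK[OF that] by simp
    then show ?thesis using ne1[OF that] by simp
  qed
  define v where "v x = (\<lambda>w. cnj (c x) * cf.point (b x) 1 w)" for x
  have v: "v x \<in> carr l2" if "x \<in> F" for x
    unfolding v_def by (intro cf.tensor_sc_mem cf.point_mem) (auto simp: sm that)
  have v_gram: "ip l2 (v y) (v x) = kernel H x y" if "x \<in> F" "y \<in> F" for x y
  proof -
    note px = cf.point_mem[of 1, OF _ sm[OF that(1)], simplified] and py = cf.point_mem[of 1, OF _ sm[OF that(2)], simplified]
    have "ip l2 (v y) (v x) = cnj (c y) * (c x * ip l2 (cf.point (b y) 1) (cf.point (b x) 1))"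
      unfolding v_def using cf.k.ip_sc[OF py cf.k.sc_mem[OF px]] cf.k.ip_sc_right[OF px py] by simp
    also have "ip l2 (cf.point (b y) 1) (cf.point (b x) 1) = 1 / (1 - (\<Sum>e<m. b x e * cnj (b y e)))"
      using cf.ip_point_point[of 1 1 "b x" "b y" m] sm that b0 ne1[OF that] by simp
    finally show ?thesis using cK[OF that] by (simp add: mult_ac)
  qed
  have v_nrm: "(hnorm l2 (\<Sum>x\<in>F. (\<lambda>w. t x * v x w)))\<^sup>2 = (hs.nrm (kcomb F t))\<^sup>2" for t
  proof -
    have "(hnorm l2 (\<Sum>x\<in>F. (\<lambda>w. t x * v x w)))\<^sup>2 =
       Re (\<Sum>x\<in>F. \<Sum>y\<in>F. t x * cnj (t y) * ip l2 (v x) (v y))"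
      using cf.k.nrm_lincomb_sq[of F v t] v by simp
    also have "(\<Sum>x\<in>F. \<Sum>y\<in>F. t x * cnj (t y) * ip l2 (v x) (v y)) =
       (\<Sum>x\<in>F. \<Sum>y\<in>F. t x * cnj (t y) * kernel H y x)"
      by (intro sum.cong refl) (simp add: v_gram)
    also have "\<dots> = (\<Sum>y\<in>F. \<Sum>x\<in>F. t x * cnj (t y) * kernel H y x)" by (rule sum.swap)
    finally show ?thesis by (simp add: nrm_kcomb)
  qed
  define B where "B \<beta> x = (\<lambda>n. if n < N then \<beta> n x else 0)" for \<beta> :: "nat \<Rightarrow> 'x \<Rightarrow> complex" and x
  have B: "B \<beta> x \<in> carr l2" for \<beta> x
    by (rule cf.finite_support_mem[of _ N]) (auto simp: B_def)
  have ipB: "ip l2 u (B \<beta> x) = (\<Sum>n<N. u n * cnj (\<beta> n x))" for u \<beta> x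
    by (subst l2_ip_finite[of N]) (auto simp: B_def)
  \<comment> \<open>The isometric image of the sequence of combinations
    \<open>kcomb F (\<beta> n)\<close>, \<open>n < N\<close>.\<close>
  define \<Psi> where "\<Psi> \<beta> = (\<Sum>x\<in>F. (\<lambda>w i. cnj (c x) * lf.point (b x) (B \<beta> x) w i))" for \<beta>
  have pm: "lf.point (b x) l \<in> carr fock2" if "x \<in> F" "l \<in> carr l2" for x l
    using that sm by (intro lf.point_mem) auto
  have \<Psi>m: "\<Psi> \<beta> \<in> carr fock2" for \<beta>
    unfolding \<Psi>_def by (intro lf.k.sum_mem lf.k.sc_mem pm B)
  have p_gram: "ip fock2 (lf.point (b y) l) (lf.point (b x) l') =
      ip l2 l l' / (1 - (\<Sum>e<m. b x e * cnj (b y e)))"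
    if "x \<in> F" "y \<in> F" "l \<in> carr l2" "l' \<in> carr l2" for x y l l'
    using lf.ip_point_point[of l l' "b x" "b y" m] sm that b0 ne1 by simp
  have \<Psi>_nrm: "(hnorm fock2 (\<Psi> \<beta>))\<^sup>2 = (\<Sum>n<N. (hs.nrm (kcomb F (\<beta> n)))\<^sup>2)" for \<beta>
  proof -
    have "(hnorm fock2 (\<Psi> \<beta>))\<^sup>2 = Re (\<Sum>x\<in>F. \<Sum>y\<in>F. cnj (c x) * cnj (cnj (c y)) *
        ip fock2 (lf.point (b x) (B \<beta> x)) (lf.point (b y) (B \<beta> y)))"
      unfolding \<Psi>_def using lf.k.nrm_lincomb_sq[of F "\<lambda>x. lf.point (b x) (B \<beta> x)" "\<lambda>x. cnj (c x)"] pm B by simp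
    also have "(\<Sum>x\<in>F. \<Sum>y\<in>F. cnj (c x) * cnj (cnj (c y)) *
        ip fock2 (lf.point (b x) (B \<beta> x)) (lf.point (b y) (B \<beta> y)))
        = (\<Sum>x\<in>F. \<Sum>y\<in>F. \<Sum>n<N. \<beta> n x * cnj (\<beta> n y) * kernel H y x)"
    proof (intro sum.cong refl)
      fix x y assume xy: "x \<in> F" "y \<in> F"
      have "cnj (c x) * cnj (cnj (c y)) * ip fock2 (lf.point (b x) (B \<beta> x)) (lf.point (b y) (B \<beta> y))
         = ip l2 (B \<beta> x) (B \<beta> y) * (c y * cnj (c x) / (1 - (\<Sum>e<m. b y e * cnj (b x e))))"
        using p_gram[OF xy(2,1) B B] by simp
      also have "\<dots> = (\<Sum>n<N. \<beta> n x * cnj (\<beta> n y)) * kernel H y x"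
        unfolding cK[OF xy(2,1)] ipB by (simp add: B_def)
      finally show "cnj (c x) * cnj (cnj (c y)) * ip fock2 (lf.point (b x) (B \<beta> x)) (lf.point (b y) (B \<beta> y))
         = (\<Sum>n<N. \<beta> n x * cnj (\<beta> n y) * kernel H y x)" by (simp add: sum_distrib_right)
    qed
    also have "\<dots> = (\<Sum>n<N. \<Sum>y\<in>F. \<Sum>x\<in>F. \<beta> n x * cnj (\<beta> n y) * kernel H y x)"
      by (subst sum.swap, subst sum.swap, subst (2) sum.swap) (rule refl)
    finally show ?thesis by (simp add: nrm_kcomb)
  qed
  define C where "C = sqrt (\<Sum>n<N. (hs.nrm (kcomb F (\<alpha> n)))\<^sup>2)"
  have C: "hnorm fock2 (\<Psi> \<alpha>) = C"
    unfolding C_def \<Psi>_nrm[symmetric] using \<Psi>m lf.k.nrm_nonneg by simp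
  obtain \<omega> h where \<omega>: "\<omega> \<in> carr fock2"
    and h: "summable (\<lambda>w. (cmod (h w))\<^sup>2)" "(\<Sum>w. (cmod (h w))\<^sup>2) \<le> C\<^sup>2"
    and fac: "\<And>\<beta> l. l \<in> carr l2 \<Longrightarrow> summable (\<lambda>w. (cmod (chi \<beta> w))\<^sup>2) \<Longrightarrow>
        ip fock2 (\<Psi> \<alpha>) (lf.point \<beta> l) = (\<Sum>w. h w * chi \<beta> w) * ip fock2 \<omega> (lf.point \<beta> l)"
    and iso: "\<And>g m. \<exists>\<xi>\<in>carr fock2. (hnorm fock2 \<xi>)\<^sup>2 \<le> (\<Sum>w<m. (cmod (g w))\<^sup>2) \<and>
       (\<forall>\<beta> l. l \<in> carr l2 \<longrightarrow> summable (\<lambda>w. (cmod (chi \<beta> w))\<^sup>2) \<longrightarrow>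
          ip fock2 \<xi> (lf.point \<beta> l) = (\<Sum>w<m. g w * chi \<beta> w) * ip fock2 \<omega> (lf.point \<beta> l))"
    by (rule lf.inner_outer[OF \<Psi>m, of \<alpha>, unfolded C]) blast
  have hm: "h \<in> carr l2" using h by (simp add: cf.tensor_mem_iff)
  have C0: "0 \<le> C" by (simp add: C_def sum_nonneg)
  have h_nrm: "hnorm l2 h \<le> C"
    by (rule power2_le_imp_le) (use h C0 cf.tensor_nrm_sq[OF hm] in auto)
  define hf where "hf x = c x * (\<Sum>w. h w * chi (b x) w)" for x
  have hf: "hf x = ip l2 h (v x)" if "x \<in> F" for x
  proof -
    have "(\<lambda>w. h w * chi (b x) w * c x) sums ip l2 h (v x)"
      using cf.tensor_ip_sums[OF hm v[OF that]] by (simp add: v_def cf.point_def mult_ac)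
    moreover have "summable (\<lambda>w. h w * chi (b x) w)"
    proof (rule summable_comparison_test)
      show "summable (\<lambda>w. (cmod (h w))\<^sup>2 + (cmod (chi (b x) w))\<^sup>2)" by (rule summable_add[OF h(1) sm[OF that]])
    qed (use cmod_mult_le in blast)
    ultimately show ?thesis
      by (metis hf_def mult.commute sums_unique2 summable_sums sums_mult2)
  qed
  \<comment> \<open>The value of the inner factor at the point \<open>b x\<close>, read off in slot
    \<open>n\<close>.\<close>
  define \<theta> where "\<theta> n x = ip fock2 \<omega> (lf.point (b x) (cf.single n 1))" for n x
  have e: "cf.single n 1 \<in> carr l2" for n by (rule cf.single_mem) simp
  have \<omega>B: "ip fock2 \<omega> (lf.point (b x) (B \<beta> x)) = (\<Sum>n<N. cnj (\<beta> n x) * \<theta> n x)" if "x \<in> F" for x \<beta>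
  proof -
    have "B \<beta> x = (\<Sum>n<N. (\<lambda>i. \<beta> n x * cf.single n 1 i))"
      by (auto simp: fun_eq_iff sum_fun_apply B_def cf.single_def if_distrib cong: if_cong)
    then have "lf.point (b x) (B \<beta> x) = (\<Sum>n<N. (\<lambda>w i. \<beta> n x * lf.point (b x) (cf.single n 1) w i))"
      using lf.point_sum[of "{..<N}" "\<lambda>n. cf.single n 1" "b x" "\<lambda>n. \<beta> n x"] e by simp
    then show ?thesis
      using lf.k.ip_sum_right[of "{..<N}" "\<lambda>n w i. \<beta> n x * lf.point (b x) (cf.single n 1) w i" \<omega>]
        lf.k.sc_mem[OF pm[OF that e]] \<omega> lf.k.ip_sc_right[OF pm[OF that e] \<omega>] by (simp add: \<theta>_def)
  qed
  have 1: "kcomb F (\<alpha> n) x = \<theta> n x * hf x" if n: "n < N" and x: "x \<in> F" for n x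
  proof -
    have "c x * ip fock2 (\<Psi> \<alpha>) (lf.point (b x) (cf.single n 1)) =
       (\<Sum>y\<in>F. c x * (cnj (c y) * ip fock2 (lf.point (b y) (B \<alpha> y)) (lf.point (b x) (cf.single n 1))))"
      unfolding \<Psi>_def using lf.k.ip_sum[of F "\<lambda>y w i. cnj (c y) * lf.point (b y) (B \<alpha> y) w i"] lf.k.sc_mem[OF pm[OF _ B]]
        pm[OF x e] lf.k.ip_sc[OF pm[OF _ B]] by (simp add: sum_distrib_left)
    also have "\<dots> = (\<Sum>y\<in>F. \<alpha> n y * kernel H x y)"
    proof (intro sum.cong refl)
      fix y assume y: "y \<in> F"
      have "ip l2 (B \<alpha> y) (cf.single n 1) = \<alpha> n y"
        using cf.ip_single[of 1 "B \<alpha> y" n] B n by (simp add: B_def)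
      then show "c x * (cnj (c y) * ip fock2 (lf.point (b y) (B \<alpha> y)) (lf.point (b x) (cf.single n 1)))
          = \<alpha> n y * kernel H x y"
        using p_gram[OF x y B e] by (simp add: cK[OF x y, symmetric] mult_ac)
    qed
    also have "\<dots> = kcomb F (\<alpha> n) x" by (simp add: kcomb_apply)
    finally show ?thesis using fac[OF e sm[OF x]] by (simp add: hf_def \<theta>_def mult_ac)
  qed
  have 2: "cmod (\<Sum>x\<in>F. hf x * cnj (\<beta> x)) \<le> C * hs.nrm (kcomb F \<beta>)" for \<beta>
  proof -
    have gm: "(\<Sum>x\<in>F. (\<lambda>w. \<beta> x * v x w)) \<in> carr l2" using v by (intro cf.k.sum_mem cf.k.sc_mem)
    have "(\<Sum>x\<in>F. hf x * cnj (\<beta> x)) = ip l2 h (\<Sum>x\<in>F. (\<lambda>w. \<beta> x * v x w))"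
      using cf.k.ip_sum_right[of F "\<lambda>x w. \<beta> x * v x w" h] cf.k.sc_mem[OF v] hm cf.k.ip_sc_right[OF v hm] hf
      by (simp add: mult.commute)
    then have "cmod (\<Sum>x\<in>F. hf x * cnj (\<beta> x)) \<le> hnorm l2 h * hnorm l2 (\<Sum>x\<in>F. (\<lambda>w. \<beta> x * v x w))"
      using cf.k.cauchy_schwarz[OF hm gm] by simp
    also have "hnorm l2 (\<Sum>x\<in>F. (\<lambda>w. \<beta> x * v x w)) = hs.nrm (kcomb F \<beta>)"
      using v_nrm[of \<beta>] cf.k.nrm_nonneg[OF gm] hs.nrm_nonneg[OF kcomb_mem] by (metis power2_eq_imp_eq)
    also have "hnorm l2 h * hs.nrm (kcomb F \<beta>) \<le> C * hs.nrm (kcomb F \<beta>)"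
      by (rule mult_right_mono[OF h_nrm]) simp
    finally show ?thesis .
  qed
  have 3: "(hs.nrm (kcomb F (\<lambda>x. \<Sum>n<N. cnj (\<theta> n x) * \<beta> n x)))\<^sup>2 \<le> (\<Sum>n<N. (hs.nrm (kcomb F (\<beta> n)))\<^sup>2)" for \<beta>
  proof -
    define t where "t x = (\<Sum>n<N. cnj (\<theta> n x) * \<beta> n x)" for x
    define G where "G = (\<Sum>x\<in>F. (\<lambda>w. t x * v x w))"
    have gm: "G \<in> carr l2" unfolding G_def using v by (intro cf.k.sum_mem cf.k.sc_mem)
    have part: "(\<Sum>w<M. (cmod (G w))\<^sup>2) \<le> (hnorm fock2 (\<Psi> \<beta>))\<^sup>2" for M
    proof -
      \<comment> \<open>Duality: some \<open>\<xi>\<close> of squared norm at most \<open>Q\<close>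
        satisfies \<open>\<langle>\<xi>, \<Psi> \<beta>\<rangle> = Q\<close>, so Cauchy-Schwarz
        gives \<open>Q\<^sup>2 \<le> Q \<parallel>\<Psi> \<beta>\<parallel>\<^sup>2\<close>.\<close>
      define Q where "Q = (\<Sum>w<M. (cmod (G w))\<^sup>2)"
      have Q0: "0 \<le> Q" by (simp add: Q_def sum_nonneg)
      obtain \<xi> where \<xi>: "\<xi> \<in> carr fock2" "(hnorm fock2 \<xi>)\<^sup>2 \<le> Q"
        "\<And>\<beta> l. l \<in> carr l2 \<Longrightarrow> summable (\<lambda>w. (cmod (chi \<beta> w))\<^sup>2) \<Longrightarrow>
          ip fock2 \<xi> (lf.point \<beta> l) = (\<Sum>w<M. G w * chi \<beta> w) * ip fock2 \<omega> (lf.point \<beta> l)"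
        using iso[where m = M and g = G] unfolding Q_def by blast
      have "ip fock2 \<xi> (\<Psi> \<beta>) =
          (\<Sum>x\<in>F. c x * ip fock2 \<xi> (lf.point (b x) (B \<beta> x)))"
        unfolding \<Psi>_def using lf.k.ip_sum_right[of F "\<lambda>y w i. cnj (c y) * lf.point (b y) (B \<beta> y) w i" \<xi>]
          lf.k.sc_mem[OF pm[OF _ B]] \<xi>(1) lf.k.ip_sc_right[OF pm[OF _ B] \<xi>(1)] by simp
      also have "\<dots> = (\<Sum>x\<in>F. \<Sum>w<M. G w * (c x * chi (b x) w * cnj (t x)))"
      proof (intro sum.cong refl)
        fix x assume x: "x \<in> F"
        have "cnj (t x) = ip fock2 \<omega> (lf.point (b x) (B \<beta> x))"
          unfolding \<omega>B[OF x] t_def by (simp add: mult.commute)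
        then show "c x * ip fock2 \<xi> (lf.point (b x) (B \<beta> x)) = (\<Sum>w<M. G w * (c x * chi (b x) w * cnj (t x)))"
          unfolding \<xi>(3)[OF B sm[OF x]] by (simp add: sum_distrib_left sum_distrib_right mult_ac)
      qed
      also have "\<dots> = (\<Sum>w<M. G w * (\<Sum>x\<in>F. c x * chi (b x) w * cnj (t x)))"
        by (subst sum.swap) (simp add: sum_distrib_left)
      also have "\<dots> = (\<Sum>w<M. G w * cnj (G w))"
        by (simp add: G_def sum_fun_apply v_def cf.point_def mult_ac)
      also have "\<dots> = complex_of_real Q"
        unfolding Q_def of_real_sum complex_norm_square ..
      finally have "Q = cmod (ip fock2 \<xi> (\<Psi> \<beta>))" using Q0 by simp
      also have "\<dots> \<le> hnorm fock2 \<xi> * hnorm fock2 (\<Psi> \<beta>)"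
        by (rule lf.k.cauchy_schwarz[OF \<xi>(1) \<Psi>m])
      finally have "Q\<^sup>2 \<le> (hnorm fock2 \<xi>)\<^sup>2 * (hnorm fock2 (\<Psi> \<beta>))\<^sup>2"
        using Q0 by (metis power_mono power_mult_distrib)
      also have "\<dots> \<le> Q * (hnorm fock2 (\<Psi> \<beta>))\<^sup>2"
        by (rule mult_right_mono[OF \<xi>(2)]) simp
      finally show ?thesis
        using Q0 unfolding Q_def[symmetric] power2_eq_square[of Q]
        by (cases "Q = 0") (auto simp: mult_le_cancel_left)
    qed
    have "(hnorm l2 G)\<^sup>2 \<le> (hnorm fock2 (\<Psi> \<beta>))\<^sup>2"
      unfolding cf.tensor_nrm_sq[OF gm] using suminf_le_const[OF cf.tensor_summable[OF gm]] part by simp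
    then show ?thesis unfolding G_def v_nrm \<Psi>_nrm t_def .
  qed
  show ?thesis unfolding factors_def C_def[symmetric] using 1 2 3 by blast
qed

lemma nrm_kcomb_union:
  assumes F: "finite F" "finite F'" "F \<inter> F' = {}"
    and 0: "\<And>x y. x \<in> F \<Longrightarrow> y \<in> F' \<Longrightarrow> kernel H x y = 0"
  shows "(hs.nrm (kcomb (F \<union> F') \<beta>))\<^sup>2 = (hs.nrm (kcomb F \<beta>))\<^sup>2 + (hs.nrm (kcomb F' \<beta>))\<^sup>2"
proof -
  have "kcomb (F \<union> F') \<beta> = kcomb F \<beta> + kcomb F' \<beta>"
    unfolding kcomb_def by (rule sum.union_disjoint[OF F])
  moreover have "ip H (kcomb F \<beta>) (kcomb F' \<beta>) = 0"
  proof -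
    have "kcomb F \<beta> y = 0" if "y \<in> F'" for y
      using 0 that kernel_sym_ne by (fastforce simp: kcomb_apply intro: sum.neutral)
    then show ?thesis by (simp add: ip_kcomb)
  qed
  ultimately show ?thesis by (simp add: hs.nrm_add_sq)
qed

lemma kcomb_union_apply:
  assumes F: "finite F" "finite F'" "F \<inter> F' = {}"
    and 0: "\<And>y. y \<in> F' \<Longrightarrow> kernel H x y = 0"
  shows "kcomb (F \<union> F') \<beta> x = kcomb F \<beta> x"
  using assms by (simp add: kcomb_apply sum.union_disjoint)

lemma kcomb_cong: "(\<And>x. x \<in> F \<Longrightarrow> \<alpha> x = \<beta> x) \<Longrightarrow> kcomb F \<alpha> = kcomb F \<beta>"
  unfolding kcomb_def by (intro sum.cong) (auto simp: fun_eq_iff)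

lemma sqrt_sum_cauchy:
  fixes a b c d :: real
  assumes "0 \<le> a" "0 \<le> b" "0 \<le> c" "0 \<le> d"
  shows "a * c + b * d \<le> sqrt (a\<^sup>2 + b\<^sup>2) * sqrt (c\<^sup>2 + d\<^sup>2)"
proof -
  have "(a * c + b * d)\<^sup>2 \<le> (a\<^sup>2 + b\<^sup>2) * (c\<^sup>2 + d\<^sup>2)"
    using zero_le_power2[of "a * d - b * c"] by (simp add: power2_eq_square algebra_simps)
  then show ?thesis
    using assms by (simp add: real_le_rsqrt flip: real_sqrt_mult)
qed

text \<open>Kernel combinations on different components are orthogonal, so squared norms add and
  factors found on the components can be glued pointwise. Each induction step splits off the
  component of one point.\<close>

lemma factor_finite:
  assumes np: "complete_np H" and diag: "\<And>x. kernel H x x \<noteq> 0" and F: "finite F"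
  shows "\<exists>h \<theta>. factors F N (\<lambda>n. kcomb F (\<alpha> n)) (sqrt (\<Sum>n<N. (hs.nrm (kcomb F (\<alpha> n)))\<^sup>2)) h \<theta>"
  using F
proof (induction "card F" arbitrary: F rule: less_induct)
  case less
  show ?case
  proof (cases "F = {}")
    case True
    then show ?thesis
      by (intro exI[of _ "\<lambda>_. 0"] exI[of _ "\<lambda>_ _. 0"]) (simp add: factors_def kcomb_def)
  next
    case False
    then obtain s where s: "s \<in> F" by blast
    define F1 where "F1 = {x \<in> F. kernel H x s \<noteq> 0}"
    define F2 where "F2 = {x \<in> F. kernel H x s = 0}"
    have fin: "finite F1" "finite F2" "F1 \<inter> F2 = {}" and Fu: "F = F1 \<union> F2"
      using less.prems by (auto simp: F1_def F2_def)
    have s1: "s \<in> F1" using s diag by (simp add: F1_def)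
    have "card F2 < card F"
      using s1 fin less.prems by (intro psubset_card_mono) (auto simp: Fu)
    have K0: "kernel H x y = 0" if "x \<in> F1" "y \<in> F2" for x y
    proof (rule ccontr)
      assume "kernel H x y \<noteq> 0"
      then have "kernel H s y \<noteq> 0 \<or> kernel H y s \<noteq> 0"
        using kernel_ne_trans[OF np, of y x s] kernel_sym_ne that(1) by (auto simp: F1_def)
      then show False using kernel_sym_ne[of s y] that(2) by (auto simp: F2_def)
    qed
    have K0': "kernel H y x = 0" if "x \<in> F1" "y \<in> F2" for x y using K0[OF that] kernel_sym_ne by blast
    define C where "C G = sqrt (\<Sum>n<N. (hs.nrm (kcomb G (\<alpha> n)))\<^sup>2)" for G
    have C0: "0 \<le> C G" for G by (simp add: C_def sum_nonneg)
    have split: "(hs.nrm (kcomb F \<beta>))\<^sup>2 = (hs.nrm (kcomb F1 \<beta>))\<^sup>2 + (hs.nrm (kcomb F2 \<beta>))\<^sup>2" for \<beta>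
      unfolding Fu using nrm_kcomb_union[OF fin K0] by blast
    have CF: "C F = sqrt ((C F1)\<^sup>2 + (C F2)\<^sup>2)"
      unfolding C_def by (simp add: split sum.distrib sum_nonneg)
    obtain h1 \<theta>1 where f1: "factors F1 N (\<lambda>n. kcomb F1 (\<alpha> n)) (C F1) h1 \<theta>1"
      using factor_component[OF np fin(1) s1, of N \<alpha>] unfolding C_def F1_def by auto
    obtain h2 \<theta>2 where f2: "factors F2 N (\<lambda>n. kcomb F2 (\<alpha> n)) (C F2) h2 \<theta>2"
      using less.hyps[OF \<open>card F2 < card F\<close> fin(2)] unfolding C_def by auto
    define h where "h x = (if x \<in> F1 then h1 x else h2 x)" for x
    define \<theta> where "\<theta> n x = (if x \<in> F1 then \<theta>1 n x else \<theta>2 n x)" for n x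
    have in2: "x \<notin> F1" if "x \<in> F2" for x using that fin by blast
    have sumsplit: "sum f F = sum f F1 + sum f F2" for f :: "'x \<Rightarrow> complex"
      unfolding Fu by (rule sum.union_disjoint[OF fin])
    have "factors F N (\<lambda>n. kcomb F (\<alpha> n)) (C F) h \<theta>"
      unfolding factors_def
    proof (intro conjI allI impI ballI)
      fix n x assume n: "n < N" and x: "x \<in> F"
      show "kcomb F (\<alpha> n) x = \<theta> n x * h x"
      proof (cases "x \<in> F1")
        case True
        then have "kcomb F (\<alpha> n) x = kcomb F1 (\<alpha> n) x"
          unfolding Fu by (intro kcomb_union_apply fin K0)
        then show ?thesis using f1 n True by (simp add: factors_def h_def \<theta>_def)
      next
        case False
        then have x2: "x \<in> F2" using x Fu by blast
        then have "kcomb F (\<alpha> n) x = kcomb F2 (\<alpha> n) x"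
          unfolding Fu using kcomb_union_apply[of F2 F1 x "\<alpha> n"] fin K0' by (simp add: Un_commute Int_commute)
        then show ?thesis using f2 n x2 False by (simp add: factors_def h_def \<theta>_def)
      qed
    next
      fix \<beta> :: "'x \<Rightarrow> complex"
      have "(\<Sum>x\<in>F. h x * cnj (\<beta> x)) = (\<Sum>x\<in>F1. h1 x * cnj (\<beta> x)) + (\<Sum>x\<in>F2. h2 x * cnj (\<beta> x))"
        unfolding sumsplit by (intro arg_cong2[of _ _ _ _ "(+)"] sum.cong) (auto simp: h_def in2)
      moreover have "cmod (\<Sum>x\<in>F1. h1 x * cnj (\<beta> x)) \<le> C F1 * hs.nrm (kcomb F1 \<beta>)"
          "cmod (\<Sum>x\<in>F2. h2 x * cnj (\<beta> x)) \<le> C F2 * hs.nrm (kcomb F2 \<beta>)"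
        using f1 f2 unfolding factors_def by blast+
      ultimately have "cmod (\<Sum>x\<in>F. h x * cnj (\<beta> x)) \<le> C F1 * hs.nrm (kcomb F1 \<beta>) + C F2 * hs.nrm (kcomb F2 \<beta>)"
        by (simp only: norm_triangle_mono)
      also have "\<dots> \<le> sqrt ((C F1)\<^sup>2 + (C F2)\<^sup>2) * sqrt ((hs.nrm (kcomb F1 \<beta>))\<^sup>2 + (hs.nrm (kcomb F2 \<beta>))\<^sup>2)"
        by (intro sqrt_sum_cauchy C0 hs.nrm_nonneg kcomb_mem)
      also have "\<dots> = C F * hs.nrm (kcomb F \<beta>)"
        unfolding CF split[symmetric] by simp
      finally show "cmod (\<Sum>x\<in>F. h x * cnj (\<beta> x)) \<le> C F * hs.nrm (kcomb F \<beta>)" .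
    next
      fix \<beta> :: "nat \<Rightarrow> 'x \<Rightarrow> complex"
      let ?t = "\<lambda>x. \<Sum>n<N. cnj (\<theta> n x) * \<beta> n x"
      have e1: "kcomb F1 ?t = kcomb F1 (\<lambda>x. \<Sum>n<N. cnj (\<theta>1 n x) * \<beta> n x)"
        by (rule kcomb_cong) (simp add: \<theta>_def)
      have e2: "kcomb F2 ?t = kcomb F2 (\<lambda>x. \<Sum>n<N. cnj (\<theta>2 n x) * \<beta> n x)"
        by (rule kcomb_cong) (simp add: \<theta>_def in2)
      show "(hs.nrm (kcomb F ?t))\<^sup>2 \<le> (\<Sum>n<N. (hs.nrm (kcomb F (\<beta> n)))\<^sup>2)"
        unfolding split e1 e2 sum.distrib using f1 f2 by (intro add_mono) (auto simp: factors_def)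
    qed
    then show ?thesis unfolding C_def by blast
  qed
qed

text \<open>Coefficients outside the smaller index set are put to zero. A factorization on a large
  set can thus stand for all smaller ones in the compactness argument.\<close>

lemma factors_mono:
  assumes f: "factors F N a C h \<theta>" and F: "finite F" "F0 \<subseteq> F" "N0 \<le> N"
  shows "factors F0 N0 a C h \<theta>"
  unfolding factors_def
proof (intro conjI allI impI ballI)
  show "a n x = \<theta> n x * h x" if "n < N0" "x \<in> F0" for n x
    using f that F by (auto simp: factors_def)
  have k0: "kcomb F (\<lambda>x. if x \<in> F0 then \<beta> x else 0) = kcomb F0 \<beta>" for \<beta>
  proof -
    have "kcomb F (\<lambda>x. if x \<in> F0 then \<beta> x else 0) = kcomb F0 (\<lambda>x. if x \<in> F0 then \<beta> x else 0)"
      using F by (intro kcomb_superset) auto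
    then show ?thesis using kcomb_cong[of F0 "\<lambda>x. if x \<in> F0 then \<beta> x else 0" \<beta>] by simp
  qed
  show "cmod (\<Sum>x\<in>F0. h x * cnj (\<beta> x)) \<le> C * hs.nrm (kcomb F0 \<beta>)" for \<beta>
  proof -
    have "(\<Sum>x\<in>F0. h x * cnj (\<beta> x)) = (\<Sum>x\<in>F. h x * cnj (if x \<in> F0 then \<beta> x else 0))"
      using F by (intro sum.mono_neutral_cong_left) auto
    then show ?thesis using f k0[of \<beta>] unfolding factors_def by metis
  qed
  show "(hs.nrm (kcomb F0 (\<lambda>x. \<Sum>n<N0. cnj (\<theta> n x) * \<beta> n x)))\<^sup>2 \<le> (\<Sum>n<N0. (hs.nrm (kcomb F0 (\<beta> n)))\<^sup>2)" for \<beta>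
  proof -
    define \<gamma> where "\<gamma> n x = (if n < N0 \<and> x \<in> F0 then \<beta> n x else 0)" for n x
    have "(\<lambda>x. \<Sum>n<N. cnj (\<theta> n x) * \<gamma> n x) = (\<lambda>x. if x \<in> F0 then \<Sum>n<N0. cnj (\<theta> n x) * \<beta> n x else 0)"
    proof
      fix x
      have "(\<Sum>n<N. cnj (\<theta> n x) * \<gamma> n x) = (\<Sum>n<N0. cnj (\<theta> n x) * \<gamma> n x)"
        using F by (intro sum.mono_neutral_right) (auto simp: \<gamma>_def)
      then show "(\<Sum>n<N. cnj (\<theta> n x) * \<gamma> n x) = (if x \<in> F0 then \<Sum>n<N0. cnj (\<theta> n x) * \<beta> n x else 0)"
        by (simp add: \<gamma>_def)
    qed
    moreover have "(hs.nrm (kcomb F (\<lambda>x. \<Sum>n<N. cnj (\<theta> n x) * \<gamma> n x)))\<^sup>2 \<le> (\<Sum>n<N. (hs.nrm (kcomb F (\<gamma> n)))\<^sup>2)"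
      using f unfolding factors_def by blast
    moreover have "(\<Sum>n<N. (hs.nrm (kcomb F (\<gamma> n)))\<^sup>2) = (\<Sum>n<N0. (hs.nrm (kcomb F0 (\<beta> n)))\<^sup>2)"
    proof -
      have "kcomb F (\<gamma> n) = (if n < N0 then kcomb F0 (\<beta> n) else 0)" for n
        using k0[of "\<beta> n"] by (auto simp: \<gamma>_def fun_eq_iff kcomb_apply)
      then show ?thesis using F by (intro sum.mono_neutral_cong_right) auto
    qed
    ultimately show ?thesis by (simp add: k0)
  qed
qed

text \<open>Contractivity of the adjoint, turned by duality into the hypothesis of
  \<open>tensor_membership\<close> for the sequence \<open>\<theta> n * g\<close>.\<close>

lemma factors_pairing:
  assumes f: "factors F N a C h \<theta>" and g: "g \<in> carr H"
  shows "cmod (\<Sum>n<N. \<Sum>x\<in>F. (\<theta> n x * g x) * cnj (\<beta> n x)) \<le> hs.nrm g * sqrt (\<Sum>n<N. (hs.nrm (kcomb F (\<beta> n)))\<^sup>2)"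
proof -
  let ?t = "\<lambda>x. \<Sum>n<N. cnj (\<theta> n x) * \<beta> n x"
  have "(\<Sum>n<N. \<Sum>x\<in>F. (\<theta> n x * g x) * cnj (\<beta> n x)) = ip H g (kcomb F ?t)"
    unfolding ip_kcomb[OF g] by (subst sum.swap) (simp add: sum_distrib_left mult_ac)
  then have "cmod (\<Sum>n<N. \<Sum>x\<in>F. (\<theta> n x * g x) * cnj (\<beta> n x)) \<le> hs.nrm g * hs.nrm (kcomb F ?t)"
    using hs.cauchy_schwarz[OF g kcomb_mem, of F ?t] by (simp only:)
  also have "hs.nrm (kcomb F ?t) \<le> sqrt (\<Sum>n<N. (hs.nrm (kcomb F (\<beta> n)))\<^sup>2)"
    using f unfolding factors_def by (intro real_le_rsqrt) blast
  finally show ?thesis using g by (simp add: mult_left_mono)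
qed

end

section \<open>Compactness of pointwise bounded families\<close>

lemma compact_bounded_functions: "compact {f :: 'p \<Rightarrow> complex. \<forall>p. cmod (f p) \<le> D p}"
proof -
  have "compactin (product_topology (\<lambda>p::'p. euclidean :: complex topology) UNIV) (PiE UNIV (\<lambda>p. cball 0 (D p)))"
    by (subst compactin_PiE) auto
  moreover have "PiE UNIV (\<lambda>p. cball 0 (D p)) = {f :: 'p \<Rightarrow> complex. \<forall>p. cmod (f p) \<le> D p}"
    by (auto simp: PiE_UNIV_domain Pi_iff)
  ultimately show ?thesis
    by (simp add: euclidean_product_topology)
qed

text \<open>\<open>Q E f\<close> stands for the requirements indexed by the finite set
  \<open>E\<close>. The closures of the solution sets have the finite intersection property in a
  compact product, and a common point \<open>g\<close> inherits every closed consequence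
  \<open>R\<close> of some \<open>Q E\<close>; \<open>Q E g\<close> itself may fail.\<close>

lemma compactness_principle:
  fixes D :: "'p \<Rightarrow> real" and Q :: "'e set \<Rightarrow> ('p \<Rightarrow> complex) \<Rightarrow> bool"
  assumes ex: "\<And>E. finite E \<Longrightarrow> \<exists>f. Q E f \<and> (\<forall>p. cmod (f p) \<le> D p)"
    and mono: "\<And>E E' f. E \<subseteq> E' \<Longrightarrow> Q E' f \<Longrightarrow> Q E f"
  obtains g where "\<And>p. cmod (g p) \<le> D p"
    "\<And>E R. finite E \<Longrightarrow> closed {f. R f} \<Longrightarrow> (\<And>f. Q E f \<Longrightarrow> R f) \<Longrightarrow> R g"
proof -
  define B where "B = {f :: 'p \<Rightarrow> complex. \<forall>p. cmod (f p) \<le> D p}"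
  define \<C> where "\<C> = (\<lambda>E. closure {f. Q E f}) ` {E. finite E}"
  have "B \<inter> \<Inter>\<C> \<noteq> {}"
  proof (rule compact_imp_fip)
    show "compact B" unfolding B_def by (rule compact_bounded_functions)
    show "closed T" if "T \<in> \<C>" for T using that by (auto simp: \<C>_def)
    show "B \<inter> \<Inter>\<F> \<noteq> {}" if \<F>: "finite \<F>" "\<F> \<subseteq> \<C>" for \<F>
    proof -
      obtain \<E> where \<E>: "finite \<E>" "\<E> \<subseteq> {E. finite E}" "\<F> = (\<lambda>E. closure {f. Q E f}) ` \<E>"
        using finite_subset_image[OF \<F>(1) \<F>(2)[unfolded \<C>_def]] by blast
      have "finite (\<Union>\<E>)" using \<E> by auto
      then obtain f where f: "Q (\<Union>\<E>) f" "\<forall>p. cmod (f p) \<le> D p" using ex by blast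
      have "f \<in> closure {f. Q E f}" if "E \<in> \<E>" for E
        by (rule subsetD[OF closure_subset]) (use mono[OF Union_upper[OF that] f(1)] in simp)
      then have "f \<in> B \<inter> \<Inter>\<F>" using f \<E> by (auto simp: B_def)
      then show ?thesis by blast
    qed
  qed
  then obtain g where g: "g \<in> B" "\<And>E. finite E \<Longrightarrow> g \<in> closure {f. Q E f}" by (auto simp: \<C>_def)
  show thesis
  proof (rule that)
    show "cmod (g p) \<le> D p" for p using g by (simp add: B_def)
    show "R g" if "finite E" "closed {f. R f}" "\<And>f. Q E f \<Longrightarrow> R f" for E R
      using closure_minimal[of "{f. Q E f}" "{f. R f}"] that g(2)[OF that(1)] by blast
  qed
qed

lemma continuous_on_eval: "continuous_on S (\<lambda>f :: 'p \<Rightarrow> complex. f p)"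
  by (rule continuous_on_product_coordinates[THEN continuous_on_subset]) simp

context rkhs begin

text \<open>
  On finitely many points the factorization comes from the inner-outer factorization in the Fock space.
\<close>

lemma column_factorization:
  assumes np: "complete_np H" and diag: "\<And>x. kernel H x x \<noteq> 0" and a: "a \<in> carr H2"
  obtains h \<Phi> where "h \<in> carr H" "hs.nrm h \<le> ht.nrm a" "\<And>n. a n = \<Phi> n * h"
    "\<And>g. g \<in> carr H \<Longrightarrow> (\<lambda>n. \<Phi> n * g) \<in> carr H2 \<and> ht.nrm (\<lambda>n. \<Phi> n * g) \<le> hs.nrm g"
proof -
  let ?C = "ht.nrm a"
  have C0: "0 \<le> ?C" by (rule hs.tensor_nrm_nonneg[OF a])
  have fac: "\<exists>h \<theta>. factors F N a ?C h \<theta>" if F: "finite F" for F N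
  proof -
    have "\<exists>\<alpha>. (\<forall>x\<in>F. kcomb F \<alpha> x = a n x) \<and> hs.nrm (kcomb F \<alpha>) \<le> hs.nrm (a n)" for n
      using finite_projection[OF hs.tensor_memD[OF a, of n] F] by metis
    then obtain \<alpha> where \<alpha>: "\<And>n x. x \<in> F \<Longrightarrow> kcomb F (\<alpha> n) x = a n x"
      "\<And>n. hs.nrm (kcomb F (\<alpha> n)) \<le> hs.nrm (a n)" by metis
    have le: "sqrt (\<Sum>n<N. (hs.nrm (kcomb F (\<alpha> n)))\<^sup>2) \<le> ?C"
    proof (rule real_le_lsqrt[OF C0])
      have "(\<Sum>n<N. (hs.nrm (kcomb F (\<alpha> n)))\<^sup>2) \<le> (\<Sum>n<N. (hs.nrm (a n))\<^sup>2)"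
        by (intro sum_mono power_mono \<alpha> hs.nrm_nonneg kcomb_mem)
      also have "\<dots> \<le> ?C\<^sup>2" by (rule hs.tensor_partial_le[OF a]) simp
      finally show "(\<Sum>n<N. (hs.nrm (kcomb F (\<alpha> n)))\<^sup>2) \<le> ?C\<^sup>2" .
    qed
    obtain h \<theta> where f: "factors F N (\<lambda>n. kcomb F (\<alpha> n)) (sqrt (\<Sum>n<N. (hs.nrm (kcomb F (\<alpha> n)))\<^sup>2)) h \<theta>"
      using factor_finite[OF np diag F] by blast
    have "factors F N a ?C h \<theta>"
      unfolding factors_def
    proof (intro conjI allI impI ballI)
      show "a n x = \<theta> n x * h x" if "n < N" "x \<in> F" for n x
        using f that \<alpha>(1)[OF that(2), of n] by (simp add: factors_def)
      show "cmod (\<Sum>x\<in>F. h x * cnj (\<beta> x)) \<le> ?C * hs.nrm (kcomb F \<beta>)" for \<beta>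
        using f mult_right_mono[OF le hs.nrm_nonneg[OF kcomb_mem, of F \<beta>]]
        unfolding factors_def by (meson order_trans)
    qed (use f in \<open>auto simp: factors_def\<close>)
    then show ?thesis by blast
  qed
  \<comment> \<open>The unknowns are all values \<open>h x\<close> (in \<open>Inl x\<close>) and
    \<open>\<theta> n x\<close> (in \<open>Inr (n, x)\<close>). Their bounds come from the two dual
    clauses of \<open>factors\<close> at a single kernel function.\<close>
  define D :: "'x + nat \<times> 'x \<Rightarrow> real"
    where "D p = (case p of Inl x \<Rightarrow> ?C * hs.nrm (kfun H x) | Inr _ \<Rightarrow> 1)" for p
  define Q :: "('x + nat) set \<Rightarrow> ('x + nat \<times> 'x \<Rightarrow> complex) \<Rightarrow> bool"
    where "Q E f \<longleftrightarrow> (\<exists>F N. finite F \<and> (\<forall>x. Inl x \<in> E \<longrightarrow> x \<in> F) \<and> (\<forall>n. Inr n \<in> E \<longrightarrow> n < N) \<and>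
        factors F N a ?C (\<lambda>x. f (Inl x)) (\<lambda>n x. f (Inr (n, x))))" for E f
  have ex: "\<exists>f. Q E f \<and> (\<forall>p. cmod (f p) \<le> D p)" if E: "finite E" for E
  proof -
    define F where "F = {x. Inl x \<in> E}"
    have F: "finite F" unfolding F_def using finite_vimageI[OF E, of Inl] by (simp add: vimage_def)
    have "finite {n. Inr n \<in> E}" using finite_vimageI[OF E, of Inr] by (simp add: vimage_def)
    then obtain N where N: "\<forall>n. Inr n \<in> E \<longrightarrow> n < N"
      using finite_nat_set_iff_bounded by auto
    obtain h \<theta> where f: "factors F N a ?C h \<theta>" using fac[OF F] by blast
    define f where "f p = (case p of Inl x \<Rightarrow> if x \<in> F then h x else 0 | Inr (n, x) \<Rightarrow> if x \<in> F \<and> n < N then \<theta> n x else 0)" for p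
    have "factors F N a ?C (\<lambda>x. f (Inl x)) (\<lambda>n x. f (Inr (n, x)))"
    proof -
      have "(\<Sum>x\<in>F. f (Inl x) * cnj (\<beta> x)) = (\<Sum>x\<in>F. h x * cnj (\<beta> x))" for \<beta>
        by (intro sum.cong) (auto simp: f_def)
      moreover have "kcomb F (\<lambda>x. \<Sum>n<N. cnj (f (Inr (n, x))) * \<beta> n x) = kcomb F (\<lambda>x. \<Sum>n<N. cnj (\<theta> n x) * \<beta> n x)" for \<beta>
        by (intro kcomb_cong sum.cong) (auto simp: f_def)
      ultimately show ?thesis using f by (simp add: factors_def f_def)
    qed
    moreover have "cmod (f p) \<le> D p" for p
    proof (cases p)
      case (Inl x)
      have "cmod (h x) \<le> ?C * hs.nrm (kfun H x)" if x: "x \<in> F"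
      proof -
        have "factors {x} N a ?C h \<theta>" using factors_mono[OF f F, of "{x}" N] x by simp
        then have "cmod (\<Sum>y\<in>{x}. h y * cnj 1) \<le> ?C * hs.nrm (kcomb {x} (\<lambda>_. 1))"
          unfolding factors_def by (elim conjE) (erule allE[of _ "\<lambda>_. 1"])
        moreover have "kcomb {x} (\<lambda>_. 1) = kfun H x" by (simp add: kcomb_def fun_eq_iff)
        ultimately show ?thesis by simp
      qed
      then show ?thesis using Inl C0 by (simp add: f_def D_def)
    next
      case (Inr q)
      obtain n x where q: "q = (n, x)" by force
      have "cmod (\<theta> n x) \<le> 1" if x: "x \<in> F" "n < N"
      proof -
        have "factors {x} N a ?C h \<theta>" using factors_mono[OF f F, of "{x}" N] x by simp
        then have "(hs.nrm (kcomb {x} (\<lambda>y. \<Sum>m<N. cnj (\<theta> m y) * of_bool (m = n))))\<^sup>2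
            \<le> (\<Sum>m<N. (hs.nrm (kcomb {x} (\<lambda>y. of_bool (m = n))))\<^sup>2)"
          unfolding factors_def by (elim conjE) (erule allE[of _ "\<lambda>m y. of_bool (m = n)"])
        moreover have "kcomb {x} (\<lambda>y. \<Sum>m<N. cnj (\<theta> m y) * of_bool (m = n)) = (\<lambda>_. cnj (\<theta> n x)) * kfun H x"
          using x by (simp add: kcomb_def of_bool_def if_distrib cong: if_cong)
        moreover have "(\<Sum>m<N. (hs.nrm (kcomb {x} (\<lambda>y. of_bool (m = n))))\<^sup>2) = (hs.nrm (kfun H x))\<^sup>2"
        proof -
          have "kcomb {x} (\<lambda>y. of_bool (m = n)) = (if m = n then kfun H x else 0)" for m
            by (simp add: kcomb_def fun_eq_iff)
          then show ?thesis using x by (simp add: if_distrib[of "\<lambda>v. (hs.nrm v)\<^sup>2"] cong: if_cong)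
        qed
        ultimately have "(hs.nrm ((\<lambda>_. cnj (\<theta> n x)) * kfun H x))\<^sup>2 \<le> (hs.nrm (kfun H x))\<^sup>2"
          by (simp only:)
        then have "(cmod (\<theta> n x))\<^sup>2 * (hs.nrm (kfun H x))\<^sup>2 \<le> (hs.nrm (kfun H x))\<^sup>2"
          unfolding hs.nrm_sc[OF kfun_mem] power_mult_distrib complex_mod_cnj .
        moreover have "(hs.nrm (kfun H x))\<^sup>2 > 0" using diag[of x] by (simp add: kernel_diag)
        ultimately have "(cmod (\<theta> n x))\<^sup>2 \<le> 1" by simp
        then show ?thesis by (simp add: power_le_one_iff)
      qed
      then show ?thesis using Inr q by (simp add: f_def D_def)
    qed
    ultimately show ?thesis using F N by (auto simp: Q_def F_def)
  qed
  obtain g where gD: "\<And>p. cmod (g p) \<le> D p"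
    and g: "\<And>E R. finite E \<Longrightarrow> closed {f. R f} \<Longrightarrow> (\<And>f. Q E f \<Longrightarrow> R f) \<Longrightarrow> R g"
  proof (rule compactness_principle[of Q D])
    show "Q E f" if "E \<subseteq> E'" "Q E' f" for E E' f using that unfolding Q_def by blast
  qed (use ex in blast)+
  have Qf: "factors F N a ?C (\<lambda>x. f (Inl x)) (\<lambda>n x. f (Inr (n, x)))" if QE: "Q (Inl ` F \<union> Inr ` {..<N}) f" for F N f
  proof -
    let ?E = "Inl ` F \<union> Inr ` {..<N}"
    obtain F' N' where *: "finite F' \<and> (\<forall>x. Inl x \<in> ?E \<longrightarrow> x \<in> F') \<and> (\<forall>n. Inr n \<in> ?E \<longrightarrow> n < N') \<and>
        factors F' N' a ?C (\<lambda>x. f (Inl x)) (\<lambda>n x. f (Inr (n, x)))"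
      using QE[unfolded Q_def] by (elim exE) (rule that)
    then have "F \<subseteq> F'" by (simp add: subset_iff image_iff)
    moreover have "N \<le> N'"
    proof (rule ccontr)
      assume "\<not> N \<le> N'"
      then have "(Inr N' :: 'x + nat) \<in> ?E" by simp
      then have "N' < N'" by (rule mp[OF spec[OF conjunct1[OF conjunct2[OF conjunct2[OF *]]]]])
      then show False by simp
    qed
    ultimately show ?thesis
      using factors_mono[OF conjunct2[OF conjunct2[OF conjunct2[OF *]]] conjunct1[OF *]] by simp
  qed
  define h where "h x = g (Inl x)" for x
  define \<Phi> where "\<Phi> n x = g (Inr (n, x))" for n x
  have 1: "a n x = \<Phi> n x * h x" for n x
    unfolding \<Phi>_def h_def
  proof (rule g[of "Inl ` {x} \<union> Inr ` {..<Suc n}"])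
    show "closed {f. a n x = f (Inr (n, x)) * f (Inl x)}"
      by (intro closed_Collect_eq continuous_intros continuous_on_eval)
    show "a n x = f (Inr (n, x)) * f (Inl x)" if "Q (Inl ` {x} \<union> Inr ` {..<Suc n}) f" for f
      using Qf[OF that] by (auto simp: factors_def)
  qed auto
  have 2: "cmod (\<Sum>x\<in>F. h x * cnj (\<beta> x)) \<le> ?C * hs.nrm (kcomb F \<beta>)" if F: "finite F" for F \<beta>
    unfolding h_def
  proof (rule g[of "Inl ` F \<union> Inr ` {..<0}"])
    show "closed {f. cmod (\<Sum>x\<in>F. f (Inl x) * cnj (\<beta> x)) \<le> ?C * hs.nrm (kcomb F \<beta>)}"
      by (intro closed_Collect_le continuous_intros continuous_on_eval)
    show "cmod (\<Sum>x\<in>F. f (Inl x) * cnj (\<beta> x)) \<le> ?C * hs.nrm (kcomb F \<beta>)" if "Q (Inl ` F \<union> Inr ` {..<0}) f" for f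
      using Qf[OF that] by (auto simp: factors_def)
  qed (use F in auto)
  have 3: "cmod (\<Sum>n<N. \<Sum>x\<in>F. (\<Phi> n * k) x * cnj (\<beta> n x)) \<le> hs.nrm k * sqrt (\<Sum>n<N. (hs.nrm (kcomb F (\<beta> n)))\<^sup>2)"
    if F: "finite F" and k: "k \<in> carr H" for F N \<beta> k
    unfolding \<Phi>_def times_fun_def
  proof (rule g[of "Inl ` F \<union> Inr ` {..<N}"])
    show "closed {f. cmod (\<Sum>n<N. \<Sum>x\<in>F. f (Inr (n, x)) * k x * cnj (\<beta> n x)) \<le> hs.nrm k * sqrt (\<Sum>n<N. (hs.nrm (kcomb F (\<beta> n)))\<^sup>2)}"
      by (intro closed_Collect_le continuous_intros continuous_on_eval)
    show "cmod (\<Sum>n<N. \<Sum>x\<in>F. f (Inr (n, x)) * k x * cnj (\<beta> n x)) \<le> hs.nrm k * sqrt (\<Sum>n<N. (hs.nrm (kcomb F (\<beta> n)))\<^sup>2)"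
      if "Q (Inl ` F \<union> Inr ` {..<N}) f" for f
      by (rule factors_pairing[OF Qf[OF that] k])
  qed (use F in auto)
  show thesis
  proof (rule that[of h \<Phi>])
    show "h \<in> carr H" "hs.nrm h \<le> ?C" using membership[of h ?C, OF 2 C0] by auto
    show "a n = \<Phi> n * h" for n using 1 by (simp add: fun_eq_iff)
    show "(\<lambda>n. \<Phi> n * k) \<in> carr H2 \<and> ht.nrm (\<lambda>n. \<Phi> n * k) \<le> hs.nrm k" if k: "k \<in> carr H" for k
      using tensor_membership[of "\<lambda>n. \<Phi> n * k" "hs.nrm k", OF 3[OF _ k]] k by simp
  qed
qed

end

section \<open>Domination by a cyclic vector\<close>

context rkhs begin

lemma cyclic_subspace_carr:
  assumes "h \<in> carr H" "\<And>f. f \<in> A \<Longrightarrow> f * h \<in> carr H"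
  shows "v \<in> carr (cyclic_subspace H A h) \<longleftrightarrow>
     v \<in> carr H \<and> (\<forall>e>0. \<exists>f\<in>A. hs.nrm (v - f * h) < e)"
proof -
  interpret Metric_space "carr H" "hdist H" by (rule metric)
  have "carr (cyclic_subspace H A h) = mtopology closure_of {f * h | f. f \<in> A}"
    by (simp add: cyclic_subspace_def)
  moreover have "(\<exists>y\<in>{f * h | f. f \<in> A}. y \<in> mball v r) \<longleftrightarrow> (\<exists>f\<in>A. hs.nrm (v - f * h) < r)" if "v \<in> carr H" for r
  proof -
    have "(\<exists>y\<in>{f * h | f. f \<in> A}. y \<in> mball v r) \<longleftrightarrow> (\<exists>f\<in>A. f * h \<in> mball v r)" by blast
    also have "\<dots> \<longleftrightarrow> (\<exists>f\<in>A. hs.nrm (v - f * h) < r)"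
      by (intro bex_cong refl) (simp add: that assms hdist_def)
    finally show ?thesis .
  qed
  ultimately show ?thesis unfolding metric_closure_of by auto
qed

lemma ip_cyclic_subspace [simp]: "ip (cyclic_subspace H A h) = ip H"
  by (simp add: cyclic_subspace_def)

lemma hnorm_cyclic_subspace [simp]: "hnorm (cyclic_subspace H A h) = hs.nrm"
  by (simp add: hnorm_def fun_eq_iff)

lemma hnorm_tensor_cyclic [simp]: "hnorm (tensor_l2 (cyclic_subspace H A h)) = ht.nrm"
  by (simp add: hnorm_def fun_eq_iff tensor_l2_def)

lemma ip_tensor_cyclic [simp]: "ip (tensor_l2 (cyclic_subspace H A h)) = ip H2"
  by (simp add: tensor_l2_def)

lemma cyclic_subspace_closed:
  assumes h: "h \<in> carr H" and A: "A \<subseteq> multipliers H" "A \<noteq> {}" "\<forall>f\<in>A. \<forall>g\<in>A. f + g \<in> A"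
    "\<forall>f\<in>A. \<forall>c. (\<lambda>_. c) * f \<in> A"
  defines "L \<equiv> carr (cyclic_subspace H A h)"
  shows "L \<subseteq> carr H" "0 \<in> L" "\<And>u v. u \<in> L \<Longrightarrow> v \<in> L \<Longrightarrow> u + v \<in> L"
    "\<And>u c. u \<in> L \<Longrightarrow> (\<lambda>_. c) * u \<in> L"
    "\<And>\<sigma> l. (\<And>n. \<sigma> n \<in> L) \<Longrightarrow> l \<in> carr H \<Longrightarrow> (\<lambda>n. hs.nrm (\<sigma> n - l)) \<longlonglongrightarrow> 0 \<Longrightarrow> l \<in> L"
    "\<And>f. f \<in> A \<Longrightarrow> f * h \<in> L"
proof -
  have Ah: "f * h \<in> carr H" if "f \<in> A" for f using that A(1) h by (auto simp: multipliers_def)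
  have L: "v \<in> L \<longleftrightarrow> v \<in> carr H \<and> (\<forall>e>0. \<exists>f\<in>A. hs.nrm (v - f * h) < e)" for v
    unfolding L_def by (rule cyclic_subspace_carr[OF h]) (rule Ah)
  have LH: "v \<in> carr H" if "v \<in> L" for v using that unfolding L by (rule conjunct1)
  have Le: "\<exists>f\<in>A. hs.nrm (v - f * h) < e" if "v \<in> L" "0 < e" for v e
    using that(1) unfolding L using that(2) by simp
  show "L \<subseteq> carr H" using LH by blast
  show AL: "f * h \<in> L" if "f \<in> A" for f
    unfolding L using that Ah by (auto intro!: bexI[of _ f])
  obtain f where "f \<in> A" using A(2) by blast
  then have "(\<lambda>_. 0) * f * h \<in> L" using A(4) AL by blast
  moreover have "(\<lambda>_. 0) * f * h = 0" by (simp add: fun_eq_iff)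
  ultimately show "0 \<in> L" by simp
  show "u + v \<in> L" if uv: "u \<in> L" "v \<in> L" for u v
    unfolding L
  proof (intro conjI allI impI)
    show "u + v \<in> carr H" using that LH by blast
    fix e :: real assume "e > 0"
    then obtain f g where fg: "f \<in> A" "hs.nrm (u - f * h) < e / 2" "g \<in> A" "hs.nrm (v - g * h) < e / 2"
      using Le[OF uv(1), of "e / 2"] Le[OF uv(2), of "e / 2"] by auto
    have "hs.nrm (u - f * h + (v - g * h)) \<le> hs.nrm (u - f * h) + hs.nrm (v - g * h)"
      using that LH fg Ah by (intro hs.nrm_triangle) auto
    moreover have "u - f * h + (v - g * h) = u + v - (f + g) * h" by (simp add: fun_eq_iff algebra_simps)
    ultimately show "\<exists>f\<in>A. hs.nrm (u + v - f * h) < e" using fg A(3) by (intro bexI[of _ "f + g"]) auto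
  qed
  show "(\<lambda>_. c) * u \<in> L" if uL: "u \<in> L" for u c
    unfolding L
  proof (intro conjI allI impI)
    show "(\<lambda>_. c) * u \<in> carr H" using that LH scale_mem by blast
    fix e :: real assume e: "e > 0"
    then have "e / (cmod c + 1) > 0" by (simp add: add_nonneg_pos)
    then obtain f where f: "f \<in> A" "hs.nrm (u - f * h) < e / (cmod c + 1)"
      using Le[OF uL] by blast
    have uf: "u - f * h \<in> carr H" using that LH f Ah by auto
    have "hs.nrm ((\<lambda>_. c) * u - (\<lambda>_. c) * f * h) = hs.nrm ((\<lambda>_. c) * (u - f * h))"
      by (rule arg_cong) (simp add: fun_eq_iff algebra_simps)
    also have "\<dots> = cmod c * hs.nrm (u - f * h)" by (rule hs.nrm_sc[OF uf])
    also have "\<dots> \<le> (cmod c + 1) * hs.nrm (u - f * h)" by (rule mult_right_mono) (use uf in auto)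
    also have "\<dots> < e"
    proof -
      have "0 < cmod c + 1" by (simp add: add_nonneg_pos)
      then show ?thesis using f(2) by (simp only: pos_less_divide_eq) (simp only: mult.commute)
    qed
    finally show "\<exists>f\<in>A. hs.nrm ((\<lambda>_. c) * u - f * h) < e" using f A(4) by blast
  qed
  show "l \<in> L" if \<sigma>: "\<And>n. \<sigma> n \<in> L" and l: "l \<in> carr H" "(\<lambda>n. hs.nrm (\<sigma> n - l)) \<longlonglongrightarrow> 0" for \<sigma> l
    unfolding L
  proof (intro conjI allI impI)
    fix e :: real assume e: "e > 0"
    then obtain n where "norm (hs.nrm (\<sigma> n - l) - 0) < e / 2"
      using l(2) by (meson half_gt_zero LIMSEQ_D order_refl)
    then have n: "hs.nrm (\<sigma> n - l) < e / 2" by simp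
    obtain f where f: "f \<in> A" "hs.nrm (\<sigma> n - f * h) < e / 2" using Le[OF \<sigma>[of n], of "e / 2"] e by auto
    have "\<sigma> n \<in> carr H" using \<sigma> LH by blast
    then have "hs.nrm (l - f * h) \<le> hs.nrm (l - \<sigma> n) + hs.nrm (\<sigma> n - f * h)"
      using l f Ah by (intro hs.nrm_diff_triangle) auto
    then show "\<exists>f\<in>A. hs.nrm (l - f * h) < e"
      using n f hs.nrm_diff_commute[OF \<open>\<sigma> n \<in> carr H\<close> l(1)] by (intro bexI[of _ f]) auto
  qed (use l in auto)
qed

lemma multipliers_closed:
  "f \<in> multipliers H \<Longrightarrow> g \<in> multipliers H \<Longrightarrow> f + g \<in> multipliers H"
  "f \<in> multipliers H \<Longrightarrow> (\<lambda>_. c) * f \<in> multipliers H"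
  "f \<in> multipliers H \<Longrightarrow> g \<in> multipliers H \<Longrightarrow> f * g \<in> multipliers H"
  "1 \<in> multipliers H"
  using add_mem scale_mem by (auto simp: multipliers_def distrib_right mult.assoc)

text \<open>The hypothesis makes \<open>b\<close> a row contraction on \<open>F\<close>, since
  \<open>(1 - \<langle>b y, b z\<rangle>) K\<close> is positive of rank one. Hence
  \<open>y \<mapsto> \<langle>b y, d\<rangle>\<close> multiplies with norm at most
  \<open>\<parallel>d\<parallel>\<close>, which is stated here for the adjoint.\<close>

lemma kernel_quotient_bound:
  fixes b :: "'x \<Rightarrow> nat \<Rightarrow> complex"
  assumes ss: "kernel H s s \<noteq> 0" and F: "finite F"
    and bK: "\<And>y z. y \<in> F \<Longrightarrow> z \<in> F \<Longrightarrow>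
      (1 - (\<Sum>c<m. b y c * cnj (b z c))) * kernel H y z = kernel H y s * kernel H s z / kernel H s s"
  shows "hs.nrm (kcomb F (\<lambda>y. cnj (\<Sum>c<m. b y c * cnj (d c)) * \<gamma> y))
      \<le> sqrt (\<Sum>c<m. (cmod (d c))\<^sup>2) * hs.nrm (kcomb F \<gamma>)"
proof -
  define v where "v c = kcomb F (\<lambda>y. cnj (b y c) * \<gamma> y)" for c
  have v: "v c \<in> carr H" for c by (simp add: v_def kcomb_mem)
  have "kcomb F (\<lambda>y. cnj (\<Sum>c<m. b y c * cnj (d c)) * \<gamma> y) = (\<Sum>c<m. (\<lambda>_. d c) * v c)"
  proof
    fix z
    have "kcomb F (\<lambda>y. cnj (\<Sum>c<m. b y c * cnj (d c)) * \<gamma> y) z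
        = (\<Sum>y\<in>F. \<Sum>c<m. d c * (cnj (b y c) * \<gamma> y * kernel H z y))"
      by (simp add: kcomb_apply sum_distrib_left sum_distrib_right mult_ac)
    also have "\<dots> = (\<Sum>c<m. \<Sum>y\<in>F. d c * (cnj (b y c) * \<gamma> y * kernel H z y))" by (rule sum.swap)
    also have "\<dots> = (\<Sum>c<m. (\<lambda>_. d c) * v c) z"
      by (simp add: sum_fun_apply v_def kcomb_apply sum_distrib_left)
    finally show "kcomb F (\<lambda>y. cnj (\<Sum>c<m. b y c * cnj (d c)) * \<gamma> y) z = (\<Sum>c<m. (\<lambda>_. d c) * v c) z" .
  qed
  then have "hs.nrm (kcomb F (\<lambda>y. cnj (\<Sum>c<m. b y c * cnj (d c)) * \<gamma> y)) \<le> (\<Sum>c<m. cmod (d c) * hs.nrm (v c))"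
    using hs.nrm_sum[of "{..<m}" "\<lambda>c. (\<lambda>_. d c) * v c"] v by (simp add: hs.nrm_sc scale_mem)
  also have "\<dots> \<le> sqrt (\<Sum>c<m. (cmod (d c))\<^sup>2) * sqrt (\<Sum>c<m. (hs.nrm (v c))\<^sup>2)"
    unfolding real_sqrt_mult[symmetric] by (rule real_le_rsqrt) (rule Cauchy_Schwarz_ineq_sum)
  also have "sqrt (\<Sum>c<m. (hs.nrm (v c))\<^sup>2) \<le> hs.nrm (kcomb F \<gamma>)"
  proof (rule real_le_lsqrt)
    \<comment> \<open>The defect of the contraction at \<open>\<gamma>\<close> is
      \<open>|w|\<^sup>2 / K(s, s)\<close> by the rank one identity.\<close>
    define w where "w = (\<Sum>z\<in>F. kernel H s z * \<gamma> z)"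
    have "complex_of_real ((hs.nrm (kcomb F \<gamma>))\<^sup>2) - (\<Sum>c<m. complex_of_real ((hs.nrm (v c))\<^sup>2))
      = (\<Sum>y\<in>F. \<Sum>z\<in>F. cnj (\<gamma> y) * \<gamma> z * kernel H y z)
        - (\<Sum>c<m. \<Sum>y\<in>F. \<Sum>z\<in>F. b y c * cnj (\<gamma> y) * (cnj (b z c) * \<gamma> z) * kernel H y z)"
      unfolding v_def hs.ip_self[OF kcomb_mem, symmetric] ip_kcomb[OF kcomb_mem] kcomb_apply
      by (simp add: sum_distrib_left sum_distrib_right mult_ac)
    also have "(\<Sum>c<m. \<Sum>y\<in>F. \<Sum>z\<in>F. b y c * cnj (\<gamma> y) * (cnj (b z c) * \<gamma> z) * kernel H y z)
      = (\<Sum>y\<in>F. \<Sum>c<m. \<Sum>z\<in>F. b y c * cnj (\<gamma> y) * (cnj (b z c) * \<gamma> z) * kernel H y z)" by (rule sum.swap)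
    also have "\<dots> = (\<Sum>y\<in>F. \<Sum>z\<in>F. \<Sum>c<m. b y c * cnj (\<gamma> y) * (cnj (b z c) * \<gamma> z) * kernel H y z)"
      by (intro sum.cong refl sum.swap)
    also have "(\<Sum>y\<in>F. \<Sum>z\<in>F. cnj (\<gamma> y) * \<gamma> z * kernel H y z) - \<dots>
       = (\<Sum>y\<in>F. \<Sum>z\<in>F. cnj (\<gamma> y) * \<gamma> z * ((1 - (\<Sum>c<m. b y c * cnj (b z c))) * kernel H y z))"
      unfolding sum_subtractf[symmetric] by (intro sum.cong refl) (simp add: algebra_simps sum_distrib_left)
    also have "\<dots> = (\<Sum>y\<in>F. \<Sum>z\<in>F. cnj (kernel H s y * \<gamma> y) / kernel H s s * (kernel H s z * \<gamma> z))"
    proof (intro sum.cong refl)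
      fix y z assume "y \<in> F" "z \<in> F"
      then show "cnj (\<gamma> y) * \<gamma> z * ((1 - (\<Sum>c<m. b y c * cnj (b z c))) * kernel H y z) =
          cnj (kernel H s y * \<gamma> y) / kernel H s s * (kernel H s z * \<gamma> z)"
        unfolding bK[OF \<open>y \<in> F\<close> \<open>z \<in> F\<close>] by (simp add: kernel_cnj[of y s])
    qed
    also have "\<dots> = cnj w * w / kernel H s s"
      unfolding w_def cnj_sum sum_product sum_divide_distrib by simp
    also have "\<dots> = complex_of_real ((cmod w)\<^sup>2 / Re (kernel H s s))"
      unfolding of_real_divide complex_norm_square kernel_diag_pos(2)[of s, symmetric] by (simp add: mult.commute)
    finally have "(hs.nrm (kcomb F \<gamma>))\<^sup>2 - (\<Sum>c<m. (hs.nrm (v c))\<^sup>2) = (cmod w)\<^sup>2 / Re (kernel H s s)"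
      by (simp only: of_real_eq_iff flip: of_real_sum of_real_diff)
    moreover have "(cmod w)\<^sup>2 / Re (kernel H s s) \<ge> 0" using kernel_diag_pos(1)[OF ss] by simp
    ultimately show "(\<Sum>c<m. (hs.nrm (v c))\<^sup>2) \<le> (hs.nrm (kcomb F \<gamma>))\<^sup>2" by linarith
  qed simp
  finally show ?thesis by (simp add: mult_left_mono sum_nonneg)
qed

text \<open>On the component of \<open>s\<close> the quotient \<open>k_x / k_s\<close> is a constant
  divided by \<open>1 - \<langle>b y, b x\<rangle>\<close>. By \<open>kernel_quotient_bound\<close>
  the subtracted multiplier has norm at most \<open>r = \<parallel>b x\<parallel> < 1\<close>, so
  the inverse has norm at most \<open>1 / (1 - r)\<close>, as for a Neumann series. In this way
  \<open>k_s\<close> generates the kernel functions of its whole component.\<close>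

lemma kernel_quotient_multiplier:
  assumes np: "complete_np H" and xs: "kernel H x s \<noteq> 0"
  shows "\<exists>f\<in>multipliers H. f * kfun H s = kfun H x"
proof -
  define f where "f y = (if kernel H y s = 0 then 0 else kernel H y x / kernel H y s)" for y
  have sx: "kernel H s x \<noteq> 0" using kernel_sym_ne[OF xs] .
  have ss: "kernel H s s \<noteq> 0" using kernel_diag_ne[OF sx] .
  have xx: "kernel H x x \<noteq> 0" using kernel_diag_ne[OF xs] .
  have "f * kfun H s = kfun H x"
    using kernel_ne_trans[OF np, of _ x s] sx by (auto simp: fun_eq_iff f_def kernel_eq[symmetric])
  moreover have "f \<in> multipliers H"
    unfolding multipliers_def
  proof (intro CollectI ballI)
    fix g assume g: "g \<in> carr H"
    define r where "r = sqrt (1 - (cmod (kernel H x s))\<^sup>2 / (Re (kernel H s s) * Re (kernel H x x)))"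
    define c0 where "c0 = kernel H s x / kernel H s s"
    define C where "C = cmod c0 / (1 - r)"
    have r1: "r < 1"
      unfolding r_def using xs kernel_diag_pos(1)[OF ss] kernel_diag_pos(1)[OF xx] by simp
    have C0: "0 \<le> C" using r1 by (simp add: C_def)
    have main: "cmod (\<Sum>y\<in>F. (f * g) y * cnj (\<beta> y)) \<le> (hs.nrm g * C) * hs.nrm (kcomb F \<beta>)" if F: "finite F" for F \<beta>
    proof -
      define F1 where "F1 = {y \<in> F. kernel H y s \<noteq> 0}"
      define F2 where "F2 = {y \<in> F. kernel H y s = 0}"
      have fin: "finite F1" "finite F2" "F1 \<inter> F2 = {}" and Fu: "F = F1 \<union> F2"
        using F by (auto simp: F1_def F2_def)
      have K0: "kernel H y z = 0" if "y \<in> F1" "z \<in> F2" for y z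
      proof (rule ccontr)
        assume "kernel H y z \<noteq> 0"
        then have "kernel H z s \<noteq> 0"
          using kernel_ne_trans[OF np, of z y s] that(1) kernel_sym_ne by (auto simp: F1_def)
        then show False using that(2) by (simp add: F2_def)
      qed
      have split: "(hs.nrm (kcomb F \<beta>))\<^sup>2 = (hs.nrm (kcomb F1 \<beta>))\<^sup>2 + (hs.nrm (kcomb F2 \<beta>))\<^sup>2"
        unfolding Fu using nrm_kcomb_union[OF fin K0] by blast
      have le: "hs.nrm (kcomb F1 \<beta>) \<le> hs.nrm (kcomb F \<beta>)"
        by (rule power2_le_imp_le) (simp_all add: split)
      obtain b :: "'x \<Rightarrow> nat \<Rightarrow> complex" and m where bK: "\<And>y z. y \<in> insert s (insert x F1) \<Longrightarrow> z \<in> insert s (insert x F1) \<Longrightarrow>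
        (1 - (\<Sum>c<m. b y c * cnj (b z c))) * kernel H y z = kernel H y s * kernel H s z / kernel H s s"
        by (rule np_rows_set[OF np, of "insert s (insert x F1)" s]) (use fin ss xs in \<open>auto simp: F1_def\<close>)
      have r: "sqrt (\<Sum>c<m. (cmod (b x c))\<^sup>2) = r"
        unfolding r_def using np_rows_lt(2)[OF xs ss bK[of x x]] by simp
      define p where "p y = (\<Sum>c<m. b y c * cnj (b x c))" for y
      have fp: "f y * (1 - p y) = c0" "1 - p y \<noteq> 0" if "y \<in> F1" for y
      proof -
        have y: "kernel H y s \<noteq> 0" using that by (simp add: F1_def)
        have e: "(1 - p y) * kernel H y x = kernel H y s * kernel H s x / kernel H s s"
          unfolding p_def using that by (intro bK) auto
        then show "f y * (1 - p y) = c0" using y by (simp add: f_def c0_def field_simps)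
        show "1 - p y \<noteq> 0" using e y sx ss by auto
      qed
      \<comment> \<open>The preimage of \<open>\<beta>\<close> under the adjoint of multiplication
        by \<open>1 - p\<close>; the triangle inequality gives its bound by
        \<open>1 / (1 - r)\<close>.\<close>
      define \<gamma> where "\<gamma> y = \<beta> y / cnj (1 - p y)" for y
      have "kcomb F1 \<beta> = kcomb F1 \<gamma> - kcomb F1 (\<lambda>y. cnj (p y) * \<gamma> y)"
      proof -
        have "\<beta> y = \<gamma> y + (-1) * (cnj (p y) * \<gamma> y)" if "y \<in> F1" for y
        proof -
          have "cnj (1 - p y) \<noteq> 0" using fp(2)[OF that] by (metis complex_cnj_zero_iff)
          then have "\<beta> y = \<gamma> y * cnj (1 - p y)" by (simp add: \<gamma>_def)
          then show ?thesis by (simp add: algebra_simps)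
        qed
        then have "kcomb F1 \<beta> = kcomb F1 (\<lambda>y. \<gamma> y + (-1) * (cnj (p y) * \<gamma> y))" by (rule kcomb_cong)
        then show ?thesis unfolding kcomb_add kcomb_scale by (simp add: fun_eq_iff)
      qed
      then have "hs.nrm (kcomb F1 \<gamma> - kcomb F1 (\<lambda>y. cnj (p y) * \<gamma> y)) = hs.nrm (kcomb F1 \<beta>)" by (simp only:)
      moreover have "hs.nrm (kcomb F1 (\<lambda>y. cnj (p y) * \<gamma> y)) \<le> r * hs.nrm (kcomb F1 \<gamma>)"
        unfolding p_def r[symmetric] by (rule kernel_quotient_bound[OF ss fin(1)]) (rule bK, auto)
      moreover have "hs.nrm (kcomb F1 \<gamma>) \<le> hs.nrm (kcomb F1 \<gamma> - kcomb F1 (\<lambda>y. cnj (p y) * \<gamma> y)) + hs.nrm (kcomb F1 (\<lambda>y. cnj (p y) * \<gamma> y))"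
        using hs.nrm_triangle[of "kcomb F1 \<gamma> - kcomb F1 (\<lambda>y. cnj (p y) * \<gamma> y)" "kcomb F1 (\<lambda>y. cnj (p y) * \<gamma> y)"] by simp
      ultimately have "hs.nrm (kcomb F1 \<gamma>) \<le> hs.nrm (kcomb F1 \<beta>) + r * hs.nrm (kcomb F1 \<gamma>)" by linarith
      then have "(1 - r) * hs.nrm (kcomb F1 \<gamma>) \<le> hs.nrm (kcomb F1 \<beta>)" by (simp add: algebra_simps)
      then have \<gamma>\<beta>: "hs.nrm (kcomb F1 \<gamma>) \<le> hs.nrm (kcomb F1 \<beta>) / (1 - r)" using r1 by (simp add: field_simps)
      have "(\<Sum>y\<in>F. (f * g) y * cnj (\<beta> y)) = (\<Sum>y\<in>F1. (f * g) y * cnj (\<beta> y))"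
        unfolding Fu using fin by (intro sum.mono_neutral_right) (auto simp: f_def F1_def F2_def)
      also have "\<dots> = (\<Sum>y\<in>F1. g y * cnj (cnj c0 * \<gamma> y))"
      proof (intro sum.cong refl)
        fix y assume y: "y \<in> F1"
        have "f y = c0 / (1 - p y)" using fp[OF y] by (simp add: field_simps)
        then show "(f * g) y * cnj (\<beta> y) = g y * cnj (cnj c0 * \<gamma> y)" by (simp add: \<gamma>_def)
      qed
      also have "\<dots> = ip H g (kcomb F1 (\<lambda>y. cnj c0 * \<gamma> y))" by (simp add: ip_kcomb[OF g])
      finally have "cmod (\<Sum>y\<in>F. (f * g) y * cnj (\<beta> y)) \<le> hs.nrm g * hs.nrm (kcomb F1 (\<lambda>y. cnj c0 * \<gamma> y))"
        using hs.cauchy_schwarz[OF g kcomb_mem, of F1 "\<lambda>y. cnj c0 * \<gamma> y"] by simp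
      also have "hs.nrm (kcomb F1 (\<lambda>y. cnj c0 * \<gamma> y)) = cmod c0 * hs.nrm (kcomb F1 \<gamma>)"
        unfolding kcomb_scale by (simp add: hs.nrm_sc)
      also have "hs.nrm g * (cmod c0 * hs.nrm (kcomb F1 \<gamma>)) \<le> hs.nrm g * (cmod c0 * (hs.nrm (kcomb F \<beta>) / (1 - r)))"
        using \<gamma>\<beta> divide_right_mono[OF le, of "1 - r"] r1 g by (intro mult_left_mono) auto
      finally show ?thesis by (simp add: C_def)
    qed
    show "f * g \<in> carr H" by (rule membership(1)[OF main]) (use C0 g in auto)
  qed
  ultimately show ?thesis by blast
qed

lemma connected_diag:
  assumes "countably_connected H" shows "kernel H x x \<noteq> 0"
  using assms kernel_diag_ne unfolding countably_connected_def by blast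

lemma tensor_pull_le:
  assumes g: "strict_mono g" and v: "v \<in> carr H2"
  shows "ht.nrm (\<lambda>n. v (g n)) \<le> ht.nrm v"
proof (rule hs.tensor_memI(2))
  show "v (g i) \<in> carr H" for i using v hs.tensor_memD by blast
  show "0 \<le> ht.nrm v" using v by (rule hs.tensor_nrm_nonneg)
  show "(\<Sum>i<n. (hs.nrm (v (g i)))\<^sup>2) \<le> (ht.nrm v)\<^sup>2" for n
  proof -
    have "(\<Sum>i<n. (hs.nrm (v (g i)))\<^sup>2) = (\<Sum>i\<in>g ` {..<n}. (hs.nrm (v i))\<^sup>2)"
      using strict_mono_imp_inj_on[OF g] by (subst sum.reindex) (auto simp: inj_on_def)
    then show ?thesis using hs.tensor_partial_le[OF v, of "g ` {..<n}"] by simp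
  qed
qed

text \<open>Adding multiples of the kernel functions \<open>k\<^sub>s\<close> to the sequence that is factorized makes the
  common factor cyclic.\<close>

lemma domination:
  assumes np: "complete_np H" and cc: "countably_connected H"
    and a: "a \<in> carr H2" and \<eta>: "0 < \<eta>"
  obtains h where "cyclic_vector H h" "(hs.nrm h)\<^sup>2 \<le> (ht.nrm a)\<^sup>2 + \<eta>"
    "\<And>f. f \<in> multipliers H \<Longrightarrow> (\<lambda>n. f * a n) \<in> carr H2"
    "\<And>f. f \<in> multipliers H \<Longrightarrow> ht.nrm (\<lambda>n. f * a n) \<le> hs.nrm (f * h)"
proof -
  note diag = connected_diag[OF cc]
  obtain S where S: "countable S" "\<And>x. \<exists>s\<in>S. kernel H x s \<noteq> 0" using cc by (auto simp: countably_connected_def)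
  have "S \<noteq> {}" using S(2) by blast
  define e where "e = from_nat_into S"
  have e_surj: "\<exists>n. e n = s" if "s \<in> S" for s
    unfolding e_def using from_nat_into_surj[OF S(1) that] by auto
  \<comment> \<open>The weights make the squared norms of the \<open>b n\<close> sum to at most
    \<open>\<eta>\<close>; this is possible because \<open>S\<close> is countable. The summand
    \<open>1\<close> keeps the denominator positive.\<close>
  define c where "c n = sqrt (\<eta> / 2 ^ Suc n) / (1 + hs.nrm (kfun H (e n)))" for n :: nat
  have k0: "0 \<le> hs.nrm (kfun H y)" for y by simp
  have c: "c n > 0" for n using \<eta> k0[of "e n"] by (simp add: c_def add_pos_nonneg)
  define b where "b n = (\<lambda>_. complex_of_real (c n)) * kfun H (e n)" for n
  have b_n: "(hs.nrm (b n))\<^sup>2 \<le> \<eta> / 2 ^ Suc n" for n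
  proof -
    have "hs.nrm (b n) = c n * hs.nrm (kfun H (e n))"
      unfolding b_def hs.nrm_sc[OF kfun_mem] using c[of n] by simp
    also have "\<dots> = sqrt (\<eta> / 2 ^ Suc n) * (hs.nrm (kfun H (e n)) / (1 + hs.nrm (kfun H (e n))))"
      by (simp add: c_def)
    also have "\<dots> \<le> sqrt (\<eta> / 2 ^ Suc n) * 1"
    proof (rule mult_left_mono)
      have "0 < 1 + hs.nrm (kfun H (e n))" using k0[of "e n"] by linarith
      then show "hs.nrm (kfun H (e n)) / (1 + hs.nrm (kfun H (e n))) \<le> 1" by simp
    qed (use \<eta> in simp)
    also have "\<dots> = sqrt (\<eta> / 2 ^ Suc n)" by simp
    finally have "(hs.nrm (b n))\<^sup>2 \<le> (sqrt (\<eta> / 2 ^ Suc n))\<^sup>2"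
      by (rule power_mono) (simp add: b_def scale_mem)
    then show ?thesis using \<eta> by simp
  qed
  have "(\<Sum>n<N. (hs.nrm (b n))\<^sup>2) \<le> (sqrt \<eta>)\<^sup>2" for N
  proof -
    have "(\<Sum>n<N. (hs.nrm (b n))\<^sup>2) \<le> (\<Sum>n<N. \<eta> / 2 ^ Suc n)" by (intro sum_mono b_n)
    also have "\<dots> = \<eta> * (1 - 1 / 2 ^ N)" by (induction N) (auto simp: field_simps)
    also have "\<dots> \<le> \<eta>" using \<eta> by (simp add: mult_le_cancel_left1)
    finally show ?thesis using \<eta> by simp
  qed
  then have bT: "b \<in> carr H2" "ht.nrm b \<le> sqrt \<eta>"
    using hs.tensor_memI[of b "sqrt \<eta>"] \<eta> by (auto simp: b_def scale_mem)
  define a' where "a' = hs.interleave a b"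
  have a': "a' \<in> carr H2" "(ht.nrm a')\<^sup>2 = (ht.nrm a)\<^sup>2 + (ht.nrm b)\<^sup>2"
    unfolding a'_def using hs.interleave_mem[OF a bT(1)] by auto
  obtain h \<Phi> where h: "h \<in> carr H" "hs.nrm h \<le> ht.nrm a'" and fac: "\<And>n. a' n = \<Phi> n * h"
    and \<Phi>: "\<And>g. g \<in> carr H \<Longrightarrow> (\<lambda>n. \<Phi> n * g) \<in> carr H2 \<and> ht.nrm (\<lambda>n. \<Phi> n * g) \<le> hs.nrm g"
    using column_factorization[OF np diag a'(1)] by blast
  have \<Phi>m: "\<Phi> n \<in> multipliers H" for n
    using \<Phi> hs.tensor_memD by (fastforce simp: multipliers_def)
  have even: "a n = \<Phi> (2 * n) * h" and odd: "b n = \<Phi> (Suc (2 * n)) * h" for n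
    using fac[of "2 * n"] fac[of "Suc (2 * n)"] by (simp_all add: a'_def)
  have ne: "multipliers H \<noteq> {}" "\<forall>f\<in>multipliers H. \<forall>g\<in>multipliers H. f + g \<in> multipliers H"
    "\<forall>f\<in>multipliers H. \<forall>c. (\<lambda>_. c) * f \<in> multipliers H"
    using multipliers_closed by blast+
  note cl = cyclic_subspace_closed[OF h(1) subset_refl ne]
  let ?M = "carr (cyclic_subspace H (multipliers H) h)"
  \<comment> \<open>\<open>k_s\<close> is a multiple of \<open>\<Phi> (Suc (2 * n)) * h\<close>, and
    \<open>k_x\<close> is a multiplier times \<open>k_s\<close>. Only \<open>0\<close> is orthogonal
    to all kernel functions, so \<open>h\<close> is cyclic.\<close>
  have kM: "kfun H x \<in> ?M" for x
  proof -
    obtain s where s: "s \<in> S" "kernel H x s \<noteq> 0" using S by blast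
    obtain n where n: "e n = s" using e_surj[OF s(1)] by blast
    obtain f where f: "f \<in> multipliers H" "f * kfun H s = kfun H x"
      using kernel_quotient_multiplier[OF np s(2)] by blast
    have "(\<lambda>_. complex_of_real (1 / c n)) * (f * \<Phi> (Suc (2 * n))) * h = (\<lambda>_. complex_of_real (1 / c n)) * (f * b n)"
      by (simp add: odd mult.assoc)
    also have "\<dots> = kfun H x"
      unfolding f(2)[symmetric] using c[of n] n by (auto simp: b_def fun_eq_iff)
    finally show ?thesis
      using cl(6)[of "(\<lambda>_. complex_of_real (1 / c n)) * (f * \<Phi> (Suc (2 * n)))"] multipliers_closed f \<Phi>m by metis
  qed
  have "?M = carr H"
  proof
    show "?M \<subseteq> carr H" by (rule cl(1))
    show "carr H \<subseteq> ?M"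
    proof
      fix v assume v: "v \<in> carr H"
      obtain p where p: "p \<in> ?M" "v - p \<in> hs.orth ?M"
      proof -
        have "\<exists>p\<in>?M. v - p \<in> hs.orth ?M"
          by (rule hs.projection_closed) (fact cl(1) cl(2) cl(3) cl(4) cl(5) v)+
        then show thesis using that by blast
      qed
      have "(v - p) x = 0" for x
        using hs.orthD[OF p(2) kM] reproducing'[OF hs.orth_mem[OF p(2)]] by simp
      then have "v = p" by (simp add: fun_eq_iff)
      then show "v \<in> ?M" using p by simp
    qed
  qed
  then have "cyclic_vector H h" using h by (simp add: cyclic_vector_def)
  moreover have "(hs.nrm h)\<^sup>2 \<le> (ht.nrm a)\<^sup>2 + \<eta>"
  proof -
    have "(hs.nrm h)\<^sup>2 \<le> (ht.nrm a')\<^sup>2" using h by (intro power_mono) auto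
    moreover have "(ht.nrm b)\<^sup>2 \<le> (sqrt \<eta>)\<^sup>2" using bT hs.tensor_nrm_nonneg by (intro power_mono) auto
    ultimately show ?thesis using a'(2) \<eta> by simp
  qed
  moreover have "(\<lambda>n. f * a n) \<in> carr H2 \<and> ht.nrm (\<lambda>n. f * a n) \<le> hs.nrm (f * h)"
    if f: "f \<in> multipliers H" for f
  proof -
    have fh: "f * h \<in> carr H" using f h by (simp add: multipliers_def)
    \<comment> \<open>Multipliers commute with the column:
      \<open>f * a n = \<Phi> (2 * n) * (f * h)\<close>, and \<open>\<Phi>\<close> is contractive at
      \<open>f * h\<close>.\<close>
    have eq: "(\<lambda>n. f * a n) = (\<lambda>n. (\<lambda>n. \<Phi> n * (f * h)) (2 * n))"
      by (simp add: even mult_ac)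
    have sm: "strict_mono (\<lambda>n::nat. 2 * n)" by (simp add: strict_mono_def)
    show ?thesis
      unfolding eq using \<Phi>[OF fh] hs.pull_mem[OF sm, of "\<lambda>n. \<Phi> n * (f * h)"] tensor_pull_le[OF sm, of "\<lambda>n. \<Phi> n * (f * h)"]
      by (auto intro: order_trans)
  qed
  ultimately show thesis using that by blast
qed

end

section \<open>A minimax principle\<close>

text \<open>The pairs lying above some \<open>(f x, g x)\<close> form a convex set \<open>Y\<close>.
  If it misses the open negative quadrant, a separating line has a normal with nonnegative
  coordinates, and this normal, scaled to sum \<open>1\<close>, is a weight contradicting
  \<open>wt\<close>.\<close>

lemma two_convexlike:
  fixes f g :: "'g \<Rightarrow> real"
  assumes conv: "\<And>x y t. x \<in> S \<Longrightarrow> y \<in> S \<Longrightarrow> 0 \<le> t \<Longrightarrow> t \<le> 1 \<Longrightarrow>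
      \<exists>z\<in>S. f z \<le> (1 - t) * f x + t * f y \<and> g z \<le> (1 - t) * g x + t * g y"
    and wt: "\<And>m. 0 \<le> m \<Longrightarrow> m \<le> 1 \<Longrightarrow> \<exists>x\<in>S. (1 - m) * f x + m * g x < 0"
  shows "\<exists>x\<in>S. f x < 0 \<and> g x < 0"
proof (rule ccontr)
  assume no: "\<not> (\<exists>x\<in>S. f x < 0 \<and> g x < 0)"
  define Y where "Y = {p :: real \<times> real. \<exists>x\<in>S. f x \<le> fst p \<and> g x \<le> snd p}"
  define Z where "Z = {..<0::real} \<times> {..<0::real}"
  have "convex Y"
    unfolding convex_alt
  proof (intro ballI allI impI)
    fix p q and t :: real assume "p \<in> Y" "q \<in> Y" and t: "0 \<le> t \<and> t \<le> 1"
    then obtain x y where x: "x \<in> S" "f x \<le> fst p" "g x \<le> snd p" and y: "y \<in> S" "f y \<le> fst q" "g y \<le> snd q"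
      by (auto simp: Y_def)
    obtain z where z: "z \<in> S" "f z \<le> (1 - t) * f x + t * f y" "g z \<le> (1 - t) * g x + t * g y"
      using conv[OF x(1) y(1)] t by blast
    have "(1 - t) * f x + t * f y \<le> (1 - t) * fst p + t * fst q" "(1 - t) * g x + t * g y \<le> (1 - t) * snd p + t * snd q"
      using x y t by (auto intro!: add_mono mult_left_mono)
    then show "(1 - t) *\<^sub>R p + t *\<^sub>R q \<in> Y" using z by (auto simp: Y_def intro!: bexI[of _ z])
  qed
  moreover have "convex Z" unfolding Z_def by (intro convex_Times convex_real_interval)
  moreover have "Z \<noteq> {}" unfolding Z_def using lt_ex[of "0::real"] by auto
  moreover have "Y \<noteq> {}" using wt[of 0] by (auto simp: Y_def)
  moreover have "Z \<inter> Y = {}" using no unfolding Y_def Z_def by fastforce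
  ultimately obtain a b where ab: "a \<noteq> 0" "\<forall>p\<in>Z. a \<bullet> p \<le> b" "\<forall>p\<in>Y. b \<le> a \<bullet> p"
    using separating_hyperplane_sets by metis
  obtain p q where a: "a = (p, q)" by force
  have le: "- (p * s + q * r) \<le> b" if "s > 0" "r > 0" for s r
    using ab(2)[rule_format, of "(-s, -r)"] that by (simp add: a Z_def inner_prod_def)
  have p0: "0 \<le> p"
  proof (rule ccontr)
    assume "\<not> 0 \<le> p"
    then have p: "p < 0" by simp
    \<comment> \<open>So large that the point \<open>(-s, -1)\<close> of the quadrant violates the
      separation.\<close>
    define s where "s = max 1 ((\<bar>b\<bar> + \<bar>q\<bar> + 1) / - p)"
    have "s \<ge> (\<bar>b\<bar> + \<bar>q\<bar> + 1) / - p" by (simp add: s_def)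
    then have "- p * s \<ge> \<bar>b\<bar> + \<bar>q\<bar> + 1" using p by (simp add: field_simps)
    moreover have "- (p * s + q * 1) \<le> b" by (rule le) (auto simp: s_def)
    ultimately show False by linarith
  qed
  have q0: "0 \<le> q"
  proof (rule ccontr)
    assume "\<not> 0 \<le> q"
    then have q: "q < 0" by simp
    define s where "s = max 1 ((\<bar>b\<bar> + \<bar>p\<bar> + 1) / - q)"
    have "s \<ge> (\<bar>b\<bar> + \<bar>p\<bar> + 1) / - q" by (simp add: s_def)
    then have "- q * s \<ge> \<bar>b\<bar> + \<bar>p\<bar> + 1" using q by (simp add: field_simps)
    moreover have "- (p * 1 + q * s) \<le> b" by (rule le) (auto simp: s_def)
    ultimately show False by linarith
  qed
  have pq: "p + q > 0" using p0 q0 ab(1) a by (cases "p = 0"; cases "q = 0") (auto simp: zero_prod_def)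
  have b0: "0 \<le> b"
  proof (rule ccontr)
    assume "\<not> 0 \<le> b"
    then have "b < 0" by simp
    define s where "s = - b / (2 * (p + q))"
    have s: "s > 0" using \<open>b < 0\<close> pq by (simp add: s_def divide_neg_pos)
    have "(p + q) * s = - b / 2" using pq unfolding s_def by (simp add: divide_simps)
    then show False using le[OF s s] \<open>b < 0\<close> by (simp add: algebra_simps)
  qed
  define m where "m = q / (p + q)"
  have m: "0 \<le> m" "m \<le> 1" "1 - m = p / (p + q)" using p0 q0 pq by (auto simp: m_def field_simps)
  obtain x where x: "x \<in> S" "(1 - m) * f x + m * g x < 0" using wt[OF m(1,2)] by blast
  have "(f x, g x) \<in> Y" using x by (auto simp: Y_def)
  then have "0 \<le> p * f x + q * g x" using ab(3) b0 by (force simp: a inner_prod_def)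
  moreover have "(1 - m) * f x + m * g x = (p * f x + q * g x) / (p + q)"
    unfolding m(3) by (simp add: m_def add_divide_distrib)
  ultimately show False using x(2) pq by (simp add: divide_less_0_iff)
qed

text \<open>Induction on \<open>J\<close>: the hypothesis is applied on the subset where
  \<open>\<phi> k\<close> is already negative. That subset inherits the convexity condition, and its
  weighted condition is an instance of the case of two functions.\<close>

lemma convexlike_minimax:
  fixes \<phi> :: "'j \<Rightarrow> 'g \<Rightarrow> real"
  assumes "finite J" "J \<noteq> {}"
    and "\<And>x y t. x \<in> S \<Longrightarrow> y \<in> S \<Longrightarrow> 0 \<le> t \<Longrightarrow> t \<le> 1 \<Longrightarrow>
      \<exists>z\<in>S. \<forall>j\<in>J. \<phi> j z \<le> (1 - t) * \<phi> j x + t * \<phi> j y"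
    and "\<And>w. (\<And>j. j \<in> J \<Longrightarrow> 0 \<le> w j) \<Longrightarrow> sum w J = 1 \<Longrightarrow> \<exists>x\<in>S. (\<Sum>j\<in>J. w j * \<phi> j x) < 0"
  shows "\<exists>x\<in>S. \<forall>j\<in>J. \<phi> j x < 0"
  using assms
proof (induction J arbitrary: S rule: finite_ne_induct)
  case (singleton k)
  then show ?case using singleton(2)[of "\<lambda>_. 1"] by auto
next
  case (insert k J)
  define S' where "S' = {x \<in> S. \<phi> k x < 0}"
  have "\<exists>x\<in>S'. \<forall>j\<in>J. \<phi> j x < 0"
  proof (rule insert.IH)
    fix x y and t :: real assume xy: "x \<in> S'" "y \<in> S'" and t: "0 \<le> t" "t \<le> 1"
    obtain z where z: "z \<in> S" "\<forall>j\<in>insert k J. \<phi> j z \<le> (1 - t) * \<phi> j x + t * \<phi> j y"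
      using insert.prems(1)[of x y t] xy t by (auto simp: S'_def)
    have "(1 - t) * \<phi> k x + t * \<phi> k y < 0"
      using xy t convex_bound_lt[of "\<phi> k x" 0 "\<phi> k y" "1 - t" t] by (simp add: S'_def)
    then have "z \<in> S'" using z by (fastforce simp: S'_def)
    then show "\<exists>z\<in>S'. \<forall>j\<in>J. \<phi> j z \<le> (1 - t) * \<phi> j x + t * \<phi> j y" using z by blast
  next
    fix w :: "'j \<Rightarrow> real" assume w: "\<And>j. j \<in> J \<Longrightarrow> 0 \<le> w j" "sum w J = 1"
    define F where "F x = (\<Sum>j\<in>J. w j * \<phi> j x)" for x
    have "\<exists>x\<in>S. F x < 0 \<and> \<phi> k x < 0"
    proof (rule two_convexlike)
      fix x y and t :: real assume xy: "x \<in> S" "y \<in> S" and t: "0 \<le> t" "t \<le> 1"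
      obtain z where z: "z \<in> S" "\<forall>j\<in>insert k J. \<phi> j z \<le> (1 - t) * \<phi> j x + t * \<phi> j y"
        using insert.prems(1)[OF xy t] by blast
      have "F z \<le> (\<Sum>j\<in>J. w j * ((1 - t) * \<phi> j x + t * \<phi> j y))"
        unfolding F_def using z w by (intro sum_mono mult_left_mono) auto
      also have "\<dots> = (1 - t) * F x + t * F y"
        by (simp add: F_def sum.distrib sum_distrib_left distrib_left mult_ac)
      finally show "\<exists>z\<in>S. F z \<le> (1 - t) * F x + t * F y \<and> \<phi> k z \<le> (1 - t) * \<phi> k x + t * \<phi> k y"
        using z by blast
    next
      fix m :: real assume m: "0 \<le> m" "m \<le> 1"
      \<comment> \<open>The weights on \<open>insert k J\<close> that correspond to the weights
        \<open>1 - m\<close> of \<open>F\<close> and \<open>m\<close> of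
        \<open>\<phi> k\<close>.\<close>
      define w' where "w' j = (if j = k then m else (1 - m) * w j)" for j
      have sJ: "(\<Sum>j\<in>J. w' j * h j) = (1 - m) * (\<Sum>j\<in>J. w j * h j)" for h
        unfolding sum_distrib_left using insert.hyps by (intro sum.cong) (auto simp: w'_def)
      have "\<exists>x\<in>S. (\<Sum>j\<in>insert k J. w' j * \<phi> j x) < 0"
        using insert.hyps w m sJ[of "\<lambda>_. 1"] by (intro insert.prems(2)) (auto simp: w'_def)
      then show "\<exists>x\<in>S. (1 - m) * F x + m * \<phi> k x < 0"
        using insert.hyps sJ by (simp add: F_def w'_def add.commute)
    qed
    then show "\<exists>x\<in>S'. (\<Sum>j\<in>J. w j * \<phi> j x) < 0" by (auto simp: S'_def F_def)
  qed
  then show ?case by (auto simp: S'_def)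
qed

section \<open>Membership in a dual algebra\<close>

context rkhs begin

lemma bounded_op_tensor:
  assumes T: "bounded_op H H T" and u: "u \<in> carr H2"
  shows "(\<lambda>n. T (u n)) \<in> carr H2"
proof -
  obtain C where C: "\<And>v. v \<in> carr H \<Longrightarrow> T v \<in> carr H" "\<And>v. v \<in> carr H \<Longrightarrow> hs.nrm (T v) \<le> C * hs.nrm v"
    using T unfolding bounded_op_def by blast
  note un = hs.tensor_memD[OF u]
  have "summable (\<lambda>n. (hs.nrm (T (u n)))\<^sup>2)"
  proof (rule summable_comparison_test)
    show "summable (\<lambda>n. C\<^sup>2 * (hs.nrm (u n))\<^sup>2)" by (rule summable_mult[OF hs.tensor_summable[OF u]])
    have "norm ((hs.nrm (T (u n)))\<^sup>2) \<le> C\<^sup>2 * (hs.nrm (u n))\<^sup>2" for n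
      using power_mono[OF C(2)[OF un] hs.nrm_nonneg[OF C(1)[OF un]], of n 2] by (simp add: power_mult_distrib)
    then show "\<exists>N. \<forall>n\<ge>N. norm ((hs.nrm (T (u n)))\<^sup>2) \<le> C\<^sup>2 * (hs.nrm (u n))\<^sup>2" by blast
  qed
  then show ?thesis using C(1) un by (simp add: hs.tensor_mem_iff)
qed

text \<open>By Cauchy-Schwarz a weak-star functional is controlled by the values of the operator
  along \<open>u\<close>. Finite intersections are handled by interleaving, so one sequence
  suffices, and that is the situation to which \<open>domination\<close> applies.\<close>

lemma weak_star_open_ultrastrong:
  assumes "openin (weak_star_topology H) W" "T0 \<in> W" and T0: "T0 \<in> bounded_ops H"
  shows "\<exists>u\<in>carr H2. \<exists>e>0. \<forall>T\<in>bounded_ops H.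
      ht.nrm (\<lambda>n. T (u n) - T0 (u n)) < e \<longrightarrow> T \<in> W"
proof -
  have "generate_topology_on {{T \<in> bounded_ops H. (\<Sum>n. ip H (T (u n)) (v n)) \<in> U} | u v U.
       u \<in> carr H2 \<and> v \<in> carr H2 \<and> open U} W"
    using assms(1) unfolding weak_star_topology_def openin_topology_generated_by_iff .
  then show ?thesis using assms(2)
  proof (induction rule: generate_topology_on.induct)
    case Empty
    then show ?case by simp
  next
    case (Int a b)
    obtain u e where u: "u \<in> carr H2" "e > 0"
      "\<And>T. T \<in> bounded_ops H \<Longrightarrow> ht.nrm (\<lambda>n. T (u n) - T0 (u n)) < e \<Longrightarrow> T \<in> a"
      using Int by blast
    obtain u' e' where u': "u' \<in> carr H2" "e' > 0"
      "\<And>T. T \<in> bounded_ops H \<Longrightarrow> ht.nrm (\<lambda>n. T (u' n) - T0 (u' n)) < e' \<Longrightarrow> T \<in> b"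
      using Int by blast
    show ?case
    proof (intro bexI[of _ "hs.interleave u u'"] exI[of _ "min e e'"] conjI ballI impI)
      show "min e e' > 0" using u u' by simp
      show "hs.interleave u u' \<in> carr H2" by (rule hs.interleave_mem[OF u(1) u'(1)])
      fix T assume T: "T \<in> bounded_ops H"
        and lt: "ht.nrm (\<lambda>n. T (hs.interleave u u' n) - T0 (hs.interleave u u' n)) < min e e'"
      have bT: "bounded_op H H T" "bounded_op H H T0" using T T0 by (auto simp: bounded_ops_def)
      let ?d = "\<lambda>u n. T (u n) - T0 (u n)"
      have d: "?d w \<in> carr H2" if "w \<in> carr H2" for w
        using ht.diff_mem[OF bounded_op_tensor[OF bT(1) that] bounded_op_tensor[OF bT(2) that]]
        by (simp add: fun_diff_def)
      have eq: "?d (hs.interleave u u') = hs.interleave (?d u) (?d u')"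
        by (simp add: hs.interleave_def fun_eq_iff)
      have sq: "(ht.nrm (?d u))\<^sup>2 + (ht.nrm (?d u'))\<^sup>2 = (ht.nrm (?d (hs.interleave u u')))\<^sup>2"
        unfolding eq using hs.interleave_mem(2)[OF d[OF u(1)] d[OF u'(1)]] by simp
      have nn: "0 \<le> ht.nrm (?d (hs.interleave u u'))"
        by (rule hs.tensor_nrm_nonneg[OF d[OF hs.interleave_mem(1)[OF u(1) u'(1)]]])
      have "ht.nrm (?d u) \<le> ht.nrm (?d (hs.interleave u u'))"
        by (rule power2_le_imp_le[OF _ nn]) (simp flip: sq)
      moreover have "ht.nrm (?d u') \<le> ht.nrm (?d (hs.interleave u u'))"
        by (rule power2_le_imp_le[OF _ nn]) (simp flip: sq)
      ultimately show "T \<in> a \<inter> b" using u(3)[OF T] u'(3)[OF T] lt by simp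
    qed
  next
    case (UN K)
    then obtain k where k: "k \<in> K" "T0 \<in> k" by blast
    obtain u e where "u \<in> carr H2" "e > 0"
      "\<forall>T\<in>bounded_ops H. ht.nrm (\<lambda>n. T (u n) - T0 (u n)) < e \<longrightarrow> T \<in> k"
      using UN.IH[OF k] by blast
    then show ?case using k(1) by blast
  next
    case (Basis s)
    then obtain u v U where s: "s = {T \<in> bounded_ops H. (\<Sum>n. ip H (T (u n)) (v n)) \<in> U}"
      and u: "u \<in> carr H2" and v: "v \<in> carr H2" and U: "open U" by blast
    have "(\<Sum>n. ip H (T0 (u n)) (v n)) \<in> U" using Basis s by simp
    then obtain r where r: "r > 0" "ball (\<Sum>n. ip H (T0 (u n)) (v n)) r \<subseteq> U" using U open_contains_ball by blast
    have v0: "0 \<le> ht.nrm v" by (rule hs.tensor_nrm_nonneg[OF v])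
    show ?case
    proof (intro bexI[OF _ u] exI[of _ "r / (ht.nrm v + 1)"] conjI ballI impI)
      show "r / (ht.nrm v + 1) > 0" using r v0 by simp
      fix T assume T: "T \<in> bounded_ops H"
        and lt: "ht.nrm (\<lambda>n. T (u n) - T0 (u n)) < r / (ht.nrm v + 1)"
      have bT: "bounded_op H H T" "bounded_op H H T0" using T T0 by (auto simp: bounded_ops_def)
      note m = bounded_op_tensor[OF bT(1) u] bounded_op_tensor[OF bT(2) u]
      have eq: "(\<lambda>n. T (u n)) - (\<lambda>n. T0 (u n)) = (\<lambda>n. T (u n) - T0 (u n))" by (simp add: fun_diff_def)
      have dm: "(\<lambda>n. T (u n) - T0 (u n)) \<in> carr H2" using ht.diff_mem[OF m] by (simp only: eq)
      have "cmod (ip H2 (\<lambda>n. T (u n)) v - ip H2 (\<lambda>n. T0 (u n)) v)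
          = cmod (ip H2 (\<lambda>n. T (u n) - T0 (u n)) v)"
        using ht.ip_diff[OF m v] by (simp only: eq)
      also have "\<dots> \<le> ht.nrm (\<lambda>n. T (u n) - T0 (u n)) * ht.nrm v"
        by (rule ht.cauchy_schwarz[OF dm v])
      also have "\<dots> \<le> ht.nrm (\<lambda>n. T (u n) - T0 (u n)) * (ht.nrm v + 1)"
        using hs.tensor_nrm_nonneg[OF dm] by (intro mult_left_mono) auto
      also have "\<dots> < r" using lt v0 by (simp add: pos_less_divide_eq)
      finally have "(\<Sum>n. ip H (T (u n)) (v n)) \<in> ball (\<Sum>n. ip H (T0 (u n)) (v n)) r"
        by (simp add: hs.ip_tensor dist_norm norm_minus_commute)
      then show "T \<in> s" using T r(2) s by auto
    qed
  qed
qed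

lemma mult_op_bounded:
  assumes "f \<in> multipliers H" "\<And>v. v \<in> carr H \<Longrightarrow> hs.nrm (f * v) \<le> C * hs.nrm v"
  shows "mult_op H f \<in> bounded_ops H"
proof -
  have "bounded_op H H (mult_op H f)"
    unfolding bounded_op_def mult_op_def using assms by (auto simp: multipliers_def intro!: exI[of _ C])
  then show ?thesis
    unfolding bounded_ops_def mult_op_def by (auto simp: add_mem scale_mem distrib_left mult.left_commute)
qed

text \<open>Otherwise closedness gives one sequence \<open>u\<close> along which no element of
  \<open>A\<close> is close to \<open>f\<close>. A cyclic \<open>h\<close> dominating
  \<open>u\<close> turns an approximation of \<open>f * h\<close> by \<open>g * h\<close> into an
  approximation of \<open>f\<close> by \<open>g\<close> along \<open>u\<close>.\<close>

lemma dual_algebra_membership: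
  assumes np: "complete_np H" and cc: "countably_connected H" and A: "dual_algebra H A"
    and f: "f \<in> multipliers H" "\<And>v. v \<in> carr H \<Longrightarrow> hs.nrm (f * v) \<le> C * hs.nrm v"
    and cyc: "\<And>h. cyclic_vector H h \<Longrightarrow> f * h \<in> carr (cyclic_subspace H A h)"
  shows "f \<in> A"
proof -
  have AM: "A \<subseteq> multipliers H" and closed: "closedin (weak_star_topology H) (mult_op H ` A)"
    using A by (auto simp: dual_algebra_def)
  have fb: "mult_op H f \<in> bounded_ops H" by (rule mult_op_bounded[OF f])
  have top: "topspace (weak_star_topology H) = bounded_ops H"
  proof -
    have "\<Union>{{T \<in> bounded_ops H. (\<Sum>n. ip H (T (u n)) (v n)) \<in> U} | u v U.
       u \<in> carr H2 \<and> v \<in> carr H2 \<and> open U} = bounded_ops H" (is "\<Union>?B = _")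
    proof
      have "{T \<in> bounded_ops H. (\<Sum>n. ip H (T ((0 :: nat \<Rightarrow> 'x \<Rightarrow> complex) n)) ((0 :: nat \<Rightarrow> 'x \<Rightarrow> complex) n)) \<in> UNIV} \<in> ?B"
        using ht.zero_mem open_UNIV by blast
      then show "bounded_ops H \<subseteq> \<Union>?B" by auto
    qed auto
    then show ?thesis unfolding weak_star_topology_def topology_generated_by_topspace .
  qed
  have "mult_op H f \<in> mult_op H ` A"
  proof (rule ccontr)
    assume no: "mult_op H f \<notin> mult_op H ` A"
    have op: "openin (weak_star_topology H) (bounded_ops H - mult_op H ` A)"
      using closed unfolding closedin_def top by blast
    obtain u e where u: "u \<in> carr H2" "e > 0"
      "\<And>T. T \<in> bounded_ops H \<Longrightarrow> ht.nrm (\<lambda>n. T (u n) - mult_op H f (u n)) < e \<Longrightarrow> T \<notin> mult_op H ` A"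
      using weak_star_open_ultrastrong[OF op _ fb] no fb by blast
    obtain h where h: "cyclic_vector H h"
      and dom: "\<And>g. g \<in> multipliers H \<Longrightarrow> ht.nrm (\<lambda>n. g * u n) \<le> hs.nrm (g * h)"
    proof (rule domination[OF np cc u(1) zero_less_one])
      fix h assume 1: "cyclic_vector H h"
        and 2: "\<And>g. g \<in> multipliers H \<Longrightarrow> ht.nrm (\<lambda>n. g * u n) \<le> hs.nrm (g * h)"
      show thesis by (rule that[OF 1 2])
    qed
    have hH: "h \<in> carr H" using h by (simp add: cyclic_vector_def)
    obtain g where g: "g \<in> A" "hs.nrm (f * h - g * h) < e"
      using cyc[OF h] cyclic_subspace_carr[OF hH, of A "f * h"] AM hH u(2) by (auto simp: multipliers_def)
    have "mult_op H g \<in> bounded_ops H" using closed g unfolding closedin_def top by blast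
    moreover have "ht.nrm (\<lambda>n. mult_op H g (u n) - mult_op H f (u n)) < e"
    proof -
      have gf: "g + (\<lambda>_. -1) * f \<in> multipliers H" using AM g f multipliers_closed by blast
      have gh: "g * h \<in> carr H" "f * h \<in> carr H" using AM g f hH by (auto simp: multipliers_def)
      have "(\<lambda>n. mult_op H g (u n) - mult_op H f (u n)) = (\<lambda>n. (g + (\<lambda>_. -1) * f) * u n)"
        using hs.tensor_memD[OF u(1)] by (simp add: mult_op_def fun_eq_iff algebra_simps)
      then have "ht.nrm (\<lambda>n. mult_op H g (u n) - mult_op H f (u n)) \<le> hs.nrm ((g + (\<lambda>_. -1) * f) * h)"
        using dom[OF gf] by simp
      also have "(g + (\<lambda>_. -1) * f) * h = g * h - f * h" by (simp add: fun_eq_iff algebra_simps)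
      also have "hs.nrm (g * h - f * h) < e" using g(2) hs.nrm_diff_commute[OF gh] by simp
      finally show ?thesis .
    qed
    ultimately show False using u(3) g(1) by blast
  qed
  then obtain g where g: "g \<in> A" "mult_op H f = mult_op H g" by blast
  \<comment> \<open>The operator determines the values of a multiplier because
    \<open>kfun H x x \<noteq> 0\<close>.\<close>
  have "f x = g x" for x
  proof -
    have "f * kfun H x = g * kfun H x" using fun_cong[OF g(2), of "kfun H x"] by (simp add: mult_op_def)
    then have "f x * kfun H x x = g x * kfun H x x" by (metis times_fun_apply)
    moreover have "kfun H x x \<noteq> 0" using connected_diag[OF cc, of x] by (simp add: kernel_eq)
    ultimately show ?thesis by simp
  qed
  then have "f = g" by blast
  then show ?thesis using g by simp
qed

end

section \<open>The Toeplitz corona theorem\<close>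

text \<open>Finite support keeps \<open>row_op F G\<close> a finite sum of products in
  \<open>A\<close>; an infinite column appears only as the final limit.\<close>

definition finite_columns :: "('x \<Rightarrow> complex) set \<Rightarrow> (nat \<Rightarrow> 'x \<Rightarrow> complex) set"
  where "finite_columns A = {G. (\<forall>i. G i \<in> A) \<and> (\<exists>N. \<forall>i\<ge>N. G i = 0)}"

lemma row_op_finite: "(\<And>i. i \<ge> N \<Longrightarrow> h i = 0) \<Longrightarrow> row_op F h = (\<Sum>i<N. F i * h i)"
  unfolding row_op_def
proof
  fix x assume 0: "\<And>i. i \<ge> N \<Longrightarrow> h i = 0"
  have "(\<Sum>i. F i x * h i x) = (\<Sum>i<N. F i x * h i x)"
    by (rule suminf_finite) (use 0 in \<open>auto simp: not_less\<close>)
  then show "(\<Sum>i. F i x * h i x) = (\<Sum>i<N. F i * h i) x" by (simp add: sum_fun_apply)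
qed

lemma row_op_col_op:
  assumes "G \<in> finite_columns A" shows "row_op F (col_op G h) = row_op F G * h"
proof -
  obtain N where N: "\<And>i. i \<ge> N \<Longrightarrow> G i = 0" using assms by (auto simp: finite_columns_def)
  show ?thesis
    using row_op_finite[of N G F] row_op_finite[of N "col_op G h" F] N
    by (simp add: col_op_def sum_distrib_right mult.assoc)
qed

locale corona = rkhs H for H :: "('x \<Rightarrow> complex) hspace" +
  fixes A :: "('x \<Rightarrow> complex) set" and F :: "nat \<Rightarrow> 'x \<Rightarrow> complex" and \<delta> :: real
  assumes np: "complete_np H" and cc: "countably_connected H" and A: "dual_algebra H A"
    and F: "F \<in> row_space H A" and \<delta>: "\<delta> > 0"
    and lower: "\<And>h L. cyclic_vector H h \<Longrightarrow> L = cyclic_subspace H A h \<Longrightarrow>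
           op_le L (\<lambda>u. (\<lambda>_. complex_of_real (\<delta>\<^sup>2)) * u)
                   (\<lambda>u. row_op F (adj (tensor_l2 L) L (row_op F) u))"
begin

lemma AM: "A \<subseteq> multipliers H" and A1: "1 \<in> A" and A_add: "\<forall>f\<in>A. \<forall>g\<in>A. f + g \<in> A"
  and A_mult: "f \<in> A \<Longrightarrow> g \<in> A \<Longrightarrow> f * g \<in> A" and A_scale: "\<forall>f\<in>A. \<forall>c. (\<lambda>_. c) * f \<in> A"
  using A by (auto simp: dual_algebra_def)

lemma A_ne: "A \<noteq> {}" using A1 by blast

lemma A_zero: "0 \<in> A"
proof -
  have "(\<lambda>_. 0) * 1 \<in> A" using A_scale A1 by blast
  moreover have "(\<lambda>_. 0) * 1 = (0 :: 'x \<Rightarrow> complex)" by (simp add: fun_eq_iff)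
  ultimately show ?thesis by simp
qed

lemma A_sum: "(\<And>i. i \<in> I \<Longrightarrow> f i \<in> A) \<Longrightarrow> sum f I \<in> A"
  by (induction I rule: infinite_finite_induct) (auto simp: A_zero A_add)

lemma A_mem: "f \<in> A \<Longrightarrow> u \<in> carr H \<Longrightarrow> f * u \<in> carr H"
  using AM by (auto simp: multipliers_def)

lemma F_A: "F i \<in> A" using F by (simp add: row_space_def)

lemma F_mem: "w \<in> carr H2 \<Longrightarrow> row_op F w \<in> carr H"
  using F by (simp add: row_space_def bounded_op_def)

lemma F_bounded: "\<exists>C\<ge>0. \<forall>w\<in>carr H2. hs.nrm (row_op F w) \<le> C * ht.nrm w"
proof -
  obtain C where C: "\<forall>w\<in>carr H2. hs.nrm (row_op F w) \<le> C * ht.nrm w"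
    using F by (auto simp: row_space_def bounded_op_def)
  have "hs.nrm (row_op F w) \<le> \<bar>C\<bar> * ht.nrm w" if "w \<in> carr H2" for w
    using C that mult_right_mono[OF abs_ge_self hs.tensor_nrm_nonneg[OF that], of C] by fastforce
  then show ?thesis by (intro exI[of _ "\<bar>C\<bar>"]) auto
qed

lemma F_sums: "w \<in> carr H2 \<Longrightarrow> (\<lambda>i. F i x * w i x) sums row_op F w x"
  using F by (simp add: row_space_def row_op_def summable_sums)

lemma F_add:
  assumes "u \<in> carr H2" "v \<in> carr H2"
  shows "row_op F (u + v) = row_op F u + row_op F v"
proof
  fix x
  have "(\<lambda>i. F i x * (u + v) i x) sums (row_op F u x + row_op F v x)"
    using sums_add[OF F_sums[OF assms(1)] F_sums[OF assms(2)]] by (simp add: distrib_left)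
  then show "row_op F (u + v) x = (row_op F u + row_op F v) x"
    using sums_unique2[OF F_sums[OF ht.add_mem[OF assms]]] by (metis plus_fun_apply)
qed

lemma F_scale:
  assumes "u \<in> carr H2"
  shows "row_op F (\<lambda>i. (\<lambda>_. c) * u i) = (\<lambda>_. c) * row_op F u"
proof
  fix x
  have s: "(\<lambda>i. F i x * ((\<lambda>_. c) * u i) x) sums (c * row_op F u x)"
    using sums_mult[OF F_sums[OF assms], of c] by (simp add: mult_ac)
  show "row_op F (\<lambda>i. (\<lambda>_. c) * u i) x = ((\<lambda>_. c) * row_op F u) x"
    using sums_unique2[OF F_sums[OF ht.sc_mem[OF assms]] s] by simp
qed

abbreviation FC :: "(nat \<Rightarrow> 'x \<Rightarrow> complex) set" where "FC \<equiv> finite_columns A"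

lemma FC_row: "G \<in> FC \<Longrightarrow> row_op F G \<in> A"
proof -
  assume G: "G \<in> FC"
  obtain N where N: "\<And>i. i \<ge> N \<Longrightarrow> G i = 0" using G by (auto simp: finite_columns_def)
  have "row_op F G = (\<Sum>i<N. F i * G i)" using N by (rule row_op_finite)
  also have "\<dots> \<in> A" by (intro A_sum A_mult F_A) (use G in \<open>simp add: finite_columns_def\<close>)
  finally show ?thesis .
qed

lemma FC_col: "G \<in> FC \<Longrightarrow> u \<in> carr H \<Longrightarrow> col_op G u \<in> carr H2"
proof -
  assume G: "G \<in> FC" and u: "u \<in> carr H"
  obtain N where N: "\<And>i. i \<ge> N \<Longrightarrow> G i = 0" using G by (auto simp: finite_columns_def)
  show ?thesis
    by (rule hs.finite_support_mem[of _ N]) (use N G u A_mem in \<open>auto simp: col_op_def finite_columns_def\<close>)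
qed

lemma FC_comb:
  assumes "G \<in> FC" "G' \<in> FC" shows "(\<lambda>i. (\<lambda>_. c) * G i + (\<lambda>_. d) * G' i) \<in> FC"
proof -
  obtain N N' where "\<And>i. i \<ge> N \<Longrightarrow> G i = 0" "\<And>i. i \<ge> N' \<Longrightarrow> G' i = 0"
    using assms by (auto simp: finite_columns_def)
  then have "\<forall>i\<ge>max N N'. (\<lambda>_. c) * G i + (\<lambda>_. d) * G' i = 0" by simp
  then have "\<exists>N. \<forall>i\<ge>N. (\<lambda>_. c) * G i + (\<lambda>_. d) * G' i = 0" by (rule exI)
  moreover have "(\<lambda>_. c) * G i + (\<lambda>_. d) * G' i \<in> A" for i
    using assms A_add A_scale unfolding finite_columns_def by blast
  ultimately show ?thesis unfolding finite_columns_def by blast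
qed

lemma FC_scale:
  assumes "G \<in> FC" shows "(\<lambda>i. (\<lambda>_. c) * G i) \<in> FC"
  using FC_comb[OF assms assms, of c 0] by (simp add: fun_eq_iff plus_fun_def times_fun_def)

lemma FC_zero: "(\<lambda>_. 0) \<in> FC"
  using A_zero by (simp add: finite_columns_def)

text \<open>For a cyclic vector \<open>h\<close>, the point nearest to \<open>h\<close> among the \<open>F G h\<close> with
  \<open>\<parallel>G h\<parallel> \<le> \<parallel>h\<parallel> / \<delta>\<close> is \<open>h\<close> itself, by the lower bound on \<open>L = \<AA>[h]\<close>.\<close>

lemma approximate_solution:
  assumes h: "cyclic_vector H h" and e: "e > 0"
  obtains G where "G \<in> FC" "ht.nrm (col_op G h) \<le> hs.nrm h / \<delta>"
    "hs.nrm (row_op F G * h - h) < e"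
proof -
  have hH: "h \<in> carr H" using h by (simp add: cyclic_vector_def)
  define L where "L = cyclic_subspace H A h"
  note L = cyclic_subspace_closed[OF hH AM A_ne A_add A_scale, folded L_def]
  have L_upd: "L = H\<lparr>carr := carr L\<rparr>" by (simp add: L_def cyclic_subspace_def)
  have "hilbert (H\<lparr>carr := carr L\<rparr>) (\<lambda>c f. (\<lambda>_. c) * f)"
    by (rule hs.subspace_hilbert) (fact L(1) L(2) L(3) L(4) L(5))+
  then have Lh: "hilbert L (\<lambda>c f. (\<lambda>_. c) * f)" by (simp only: L_upd[symmetric])
  interpret l: hilbert L "\<lambda>c f. (\<lambda>_. c) * f" by (rule Lh)
  interpret lt: hilbert "tensor_l2 L" "\<lambda>c h i. (\<lambda>_. c) * h i" by (rule l.tensor_hilbert)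
  have [simp]: "ip L = ip H" "hnorm L = hs.nrm" "hnorm (tensor_l2 L) = ht.nrm" "ip (tensor_l2 L) = ip H2"
    by (simp_all add: L_def)
  have LT: "w \<in> carr H2" if "w \<in> carr (tensor_l2 L)" for w
    using that L(1) by (auto simp: hs.tensor_mem_iff l.tensor_mem_iff)
  have GL: "col_op G h \<in> carr (tensor_l2 L)" if "G \<in> FC" for G
    using FC_col[OF that hH] L(6) that by (auto simp: hs.tensor_mem_iff l.tensor_mem_iff col_op_def finite_columns_def)
  have h_L: "h \<in> carr L" using L(6)[OF A1] by simp
  define c where "c = hs.nrm h / \<delta>"
  have c0: "0 \<le> c" using \<delta> hH by (simp add: c_def)
  define M where "M = {row_op F G * h | G. G \<in> FC \<and> ht.nrm (col_op G h) \<le> c}"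
  have M_L: "M \<subseteq> carr L" using FC_row L(6) by (auto simp: M_def)
  have M_H: "M \<subseteq> carr H" using M_L L(1) by blast
  have row0: "row_op F (\<lambda>_. 0) * h = 0" by (simp add: row_op_def fun_eq_iff)
  have col0: "col_op (\<lambda>_. 0) h = 0" by (simp add: col_op_def fun_eq_iff)
  have M0: "0 \<in> M"
    unfolding M_def using FC_zero row0 col0 c0 by (auto intro!: exI[of _ "\<lambda>_. 0"])
  have lin: "row_op F (\<lambda>i. (\<lambda>_. a) * G i + (\<lambda>_. b) * G' i) * h = (\<lambda>_. a) * (row_op F G * h) + (\<lambda>_. b) * (row_op F G' * h)"
    and linc: "col_op (\<lambda>i. (\<lambda>_. a) * G i + (\<lambda>_. b) * G' i) h = (\<lambda>i. (\<lambda>_. a) * col_op G h i) + (\<lambda>i. (\<lambda>_. b) * col_op G' h i)"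
    if "G \<in> FC" "G' \<in> FC" for a b G G'
  proof -
    show cl: "col_op (\<lambda>i. (\<lambda>_. a) * G i + (\<lambda>_. b) * G' i) h = (\<lambda>i. (\<lambda>_. a) * col_op G h i) + (\<lambda>i. (\<lambda>_. b) * col_op G' h i)"
      by (simp add: col_op_def fun_eq_iff algebra_simps)
    show "row_op F (\<lambda>i. (\<lambda>_. a) * G i + (\<lambda>_. b) * G' i) * h = (\<lambda>_. a) * (row_op F G * h) + (\<lambda>_. b) * (row_op F G' * h)"
      unfolding row_op_col_op[OF FC_comb[OF that], symmetric] row_op_col_op[OF that(1), symmetric]
        row_op_col_op[OF that(2), symmetric] cl
      using F_add[OF ht.sc_mem[OF FC_col[OF that(1) hH]] ht.sc_mem[OF FC_col[OF that(2) hH]]]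
        F_scale[OF FC_col[OF that(1) hH]] F_scale[OF FC_col[OF that(2) hH]] by simp
  qed
  have conv: "u + (\<lambda>_. complex_of_real t) * (v - u) \<in> M" if uv: "u \<in> M" "v \<in> M" and t: "0 \<le> t" "t \<le> 1" for u v t
  proof -
    obtain G G' where G: "G \<in> FC" "ht.nrm (col_op G h) \<le> c" "u = row_op F G * h"
      and G': "G' \<in> FC" "ht.nrm (col_op G' h) \<le> c" "v = row_op F G' * h"
      using uv unfolding M_def by blast
    let ?G = "\<lambda>i. (\<lambda>_. complex_of_real (1 - t)) * G i + (\<lambda>_. complex_of_real t) * G' i"
    note m = FC_col[OF G(1) hH] FC_col[OF G'(1) hH]
    have "ht.nrm (col_op ?G h) \<le> ht.nrm (\<lambda>i. (\<lambda>_. complex_of_real (1 - t)) * col_op G h i)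
        + ht.nrm (\<lambda>i. (\<lambda>_. complex_of_real t) * col_op G' h i)"
      unfolding linc[OF G(1) G'(1)] by (rule ht.nrm_triangle[OF ht.sc_mem[OF m(1)] ht.sc_mem[OF m(2)]])
    also have "\<dots> = (1 - t) * ht.nrm (col_op G h) + t * ht.nrm (col_op G' h)"
      unfolding ht.nrm_sc[OF m(1)] ht.nrm_sc[OF m(2)] norm_of_real using t by simp
    also have "\<dots> \<le> (1 - t) * c + t * c" using G(2) G'(2) t by (intro add_mono mult_left_mono) auto
    also have "\<dots> = c" by (simp add: algebra_simps)
    finally have "ht.nrm (col_op ?G h) \<le> c" .
    moreover have "u + (\<lambda>_. complex_of_real t) * (v - u) = row_op F ?G * h"
      unfolding lin[OF G(1) G'(1)] G(3) G'(3) by (simp add: fun_eq_iff algebra_simps)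
    ultimately show ?thesis using FC_comb[OF G(1) G'(1)] by (auto simp: M_def)
  qed
  obtain \<sigma> p where \<sigma>: "\<And>n. \<sigma> n \<in> M" and p: "p \<in> carr H" "(\<lambda>n. hs.nrm (\<sigma> n - p)) \<longlonglongrightarrow> 0"
    and near: "\<And>y. y \<in> M \<Longrightarrow> Re (ip H (y - p) (h - p)) \<le> 0"
    using hs.nearest_point[OF M_H _ hH conv] M0 by blast
  have pL: "p \<in> carr L" by (rule L(5)[OF subsetD[OF M_L \<sigma>] p])
  \<comment> \<open>The residual of the nearest point; the goal is \<open>k = 0\<close>.\<close>
  define k where "k = h - p"
  have kL: "k \<in> carr L" unfolding k_def by (rule l.diff_mem[OF h_L pL])
  have kH: "k \<in> carr H" using kL L(1) by blast
  have yk: "Re (ip H y k) \<le> Re (ip H p k)" if "y \<in> M" for y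
    using near[OF that] that M_H p(1) kH unfolding k_def[symmetric] by (auto simp: hs.ip_diff)
  obtain CF where CF: "CF \<ge> 0" "\<And>w. w \<in> carr H2 \<Longrightarrow> hs.nrm (row_op F w) \<le> CF * ht.nrm w"
    using F_bounded by blast
  \<comment> \<open>\<open>adj\<close> is a definite description, so existence and uniqueness are
    supplied first, by Riesz on \<open>L\<close>.\<close>
  define v where "v = adj (tensor_l2 L) L (row_op F) k"
  have v: "v \<in> carr (tensor_l2 L)" "\<And>w. w \<in> carr (tensor_l2 L) \<Longrightarrow> ip H (row_op F w) k = ip H2 w v"
  proof -
    obtain v0 where v0: "v0 \<in> carr (tensor_l2 L)"
      and "\<And>w a. w \<in> carr (tensor_l2 L) \<and> a = ip H (row_op F w) k \<Longrightarrow> a = ip (tensor_l2 L) w v0"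
    proof (rule lt.riesz_relation[of "\<lambda>w a. w \<in> carr (tensor_l2 L) \<and> a = ip H (row_op F w) k" "CF * hs.nrm k"])
      show "0 \<in> carr (tensor_l2 L) \<and> 0 = ip H (row_op F 0) k"
      proof -
        have "row_op F 0 = 0" by (simp add: row_op_def fun_eq_iff)
        then show ?thesis using kH by simp
      qed
      show "u + w \<in> carr (tensor_l2 L) \<and> a + b = ip H (row_op F (u + w)) k"
        if "u \<in> carr (tensor_l2 L) \<and> a = ip H (row_op F u) k" "w \<in> carr (tensor_l2 L) \<and> b = ip H (row_op F w) k" for u w a b
        using that LT F_add F_mem kH by (simp add: hs.ip_add)
      show "(\<lambda>i. (\<lambda>_. d) * u i) \<in> carr (tensor_l2 L) \<and> d * a = ip H (row_op F (\<lambda>i. (\<lambda>_. d) * u i)) k"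
        if "u \<in> carr (tensor_l2 L) \<and> a = ip H (row_op F u) k" for u a d
        using that LT F_scale F_mem kH lt.sc_mem by (simp add: hs.ip_sc)
      show "u \<in> carr (tensor_l2 L) \<and> cmod a \<le> CF * hs.nrm k * hnorm (tensor_l2 L) u"
        if "u \<in> carr (tensor_l2 L) \<and> a = ip H (row_op F u) k" for u a
      proof -
        have u: "u \<in> carr H2" using that LT by blast
        have "cmod a \<le> hs.nrm (row_op F u) * hs.nrm k" using that hs.cauchy_schwarz[OF F_mem[OF u] kH] by simp
        also have "\<dots> \<le> CF * ht.nrm u * hs.nrm k" by (rule mult_right_mono[OF CF(2)[OF u]]) (use kH in simp)
        finally show ?thesis using that by (simp add: mult_ac)
      qed
    qed (use CF kH in auto)
    then have 1: "v0 \<in> carr (tensor_l2 L) \<and> (\<forall>w\<in>carr (tensor_l2 L). ip L (row_op F w) k = ip (tensor_l2 L) w v0)" by simp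
    have "v = v0"
      unfolding v_def adj_def
    proof (rule the_equality)
      fix v' assume v': "v' \<in> carr (tensor_l2 L) \<and> (\<forall>w\<in>carr (tensor_l2 L). ip L (row_op F w) k = ip (tensor_l2 L) w v')"
      have "ip (tensor_l2 L) w v' = ip (tensor_l2 L) w v0" if "w \<in> carr (tensor_l2 L)" for w using v' 1 that by metis
      then have "ip (tensor_l2 L) v' w = ip (tensor_l2 L) v0 w" if "w \<in> carr (tensor_l2 L)" for w
        using that lt.ip_cnj[of w v'] lt.ip_cnj[of w v0] v' 1 by metis
      then show "v' = v0" using v' 1 by (intro lt.eqI) auto
    qed (rule 1)
    then show "v \<in> carr (tensor_l2 L)" "\<And>w. w \<in> carr (tensor_l2 L) \<Longrightarrow> ip H (row_op F w) k = ip H2 w v"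
      using 1 by auto
  qed
  have vH: "v \<in> carr H2" using v LT by blast
  have v0: "0 \<le> ht.nrm v" by (rule hs.tensor_nrm_nonneg[OF vH])
  have vk: "\<delta> * hs.nrm k \<le> ht.nrm v"
  proof -
    have "0 \<le> ip L (row_op F v - (\<lambda>_. complex_of_real (\<delta>\<^sup>2)) * k) k"
      using lower[OF h L_def] kL unfolding op_le_def v_def by blast
    then have "0 \<le> Re (ip H (row_op F v) k) - Re (complex_of_real (\<delta>\<^sup>2) * ip H k k)"
      using hs.ip_diff[OF F_mem[OF vH] scale_mem[OF kH] kH] hs.ip_sc[OF kH kH] by (simp add: less_eq_complex_def)
    then have "\<delta>\<^sup>2 * (hs.nrm k)\<^sup>2 \<le> (ht.nrm v)\<^sup>2"
      unfolding v(2)[OF v(1)] ht.ip_self[OF vH] hs.ip_self[OF kH] by (simp flip: of_real_power of_real_mult)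
    then have "(\<delta> * hs.nrm k)\<^sup>2 \<le> (ht.nrm v)\<^sup>2" by (simp add: power_mult_distrib)
    then show ?thesis using v0 by (rule power2_le_imp_le)
  qed
  have pk0: "0 \<le> Re (ip H p k)" using yk[OF M0] kH by simp
  \<comment> \<open>Rescaling \<open>G\<close> so that the norm at \<open>h\<close> is exactly
    \<open>c\<close> lands in \<open>M\<close>, where the obtuse angle condition \<open>yk\<close>
    applies.\<close>
  have bound: "c * Re (ip H2 (col_op G h) v) \<le> Re (ip H p k) * ht.nrm (col_op G h)" if G: "G \<in> FC" for G
  proof (cases "ht.nrm (col_op G h) = 0")
    case True
    then have "col_op G h = 0" using ht.nrm_eq_0[OF FC_col[OF G hH]] by blast
    then show ?thesis using True vH by simp
  next
    case False
    define r where "r = ht.nrm (col_op G h)"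
    have r: "r > 0" using False hs.tensor_nrm_nonneg[OF FC_col[OF G hH]] by (simp add: r_def)
    define t where "t = complex_of_real (c / r)"
    let ?G = "\<lambda>i. (\<lambda>_. t) * G i"
    have col: "col_op ?G h = (\<lambda>i. (\<lambda>_. t) * col_op G h i)" by (simp add: col_op_def mult.assoc)
    have "ht.nrm (col_op ?G h) = c"
      unfolding col ht.nrm_sc[OF FC_col[OF G hH]] r_def[symmetric] using r c0 by (simp add: t_def norm_divide)
    then have "row_op F ?G * h \<in> M" using FC_scale[OF G] by (auto simp: M_def)
    then have "Re (ip H (row_op F ?G * h) k) \<le> Re (ip H p k)" by (rule yk)
    also have "ip H (row_op F ?G * h) k = ip H2 (col_op ?G h) v"
      unfolding row_op_col_op[OF FC_scale[OF G], symmetric] by (rule v(2)[OF GL[OF FC_scale[OF G]]])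
    also have "\<dots> = t * ip H2 (col_op G h) v"
      unfolding col by (rule ht.ip_sc[OF FC_col[OF G hH] vH])
    finally have "c / r * Re (ip H2 (col_op G h) v) \<le> Re (ip H p k)" by (simp add: t_def)
    then show ?thesis using r unfolding r_def[symmetric] by (simp add: field_simps)
  qed
  have dense: "\<exists>G\<in>FC. ht.nrm (col_op G h - v) < d" if d: "d > 0" for d
  proof -
    have sm: "summable (\<lambda>i. (hs.nrm (v i))\<^sup>2)" by (rule hs.tensor_summable[OF vH])
    obtain N where N: "\<And>n. n \<ge> N \<Longrightarrow> norm (\<Sum>i. (hs.nrm (v (i + n)))\<^sup>2) < d\<^sup>2 / 4"
      using suminf_exist_split[OF _ sm, of "d\<^sup>2 / 4"] d by auto
    \<comment> \<open>The \<open>N\<close> approximated entries contribute at most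
      \<open>N * (d / (2 * (N + 1)))\<^sup>2 \<le> d\<^sup>2 / 4\<close> to the squared distance,
      the tail of \<open>v\<close> less than \<open>d\<^sup>2 / 4\<close>.\<close>
    have "\<exists>f\<in>A. hs.nrm (v i - f * h) < d / (2 * (real N + 1))" for i
    proof -
      have "v i \<in> carr L" using l.tensor_memD[OF v(1)] .
      moreover have "d / (2 * (real N + 1)) > 0" using d by simp
      ultimately show ?thesis using cyclic_subspace_carr[OF hH, of A "v i"] A_mem[OF _ hH] unfolding L_def by blast
    qed
    then obtain g where g: "\<And>i. g i \<in> A" "\<And>i. hs.nrm (v i - g i * h) < d / (2 * (real N + 1))" by metis
    define G where "G i = (if i < N then g i else 0)" for i
    have G: "G \<in> FC" using g A_zero by (auto simp: finite_columns_def G_def intro!: exI[of _ N])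
    have m: "v - col_op G h \<in> carr H2" by (rule ht.diff_mem[OF vH FC_col[OF G hH]])
    have "(ht.nrm (v - col_op G h))\<^sup>2 = (\<Sum>i. (hs.nrm ((v - col_op G h) (i + N)))\<^sup>2) + (\<Sum>i<N. (hs.nrm ((v - col_op G h) i))\<^sup>2)"
      unfolding hs.tensor_nrm_sq[OF m] by (rule suminf_split_initial_segment[OF hs.tensor_summable[OF m]])
    also have "(\<Sum>i. (hs.nrm ((v - col_op G h) (i + N)))\<^sup>2) = (\<Sum>i. (hs.nrm (v (i + N)))\<^sup>2)"
      by (simp add: col_op_def G_def)
    also have "\<dots> < d\<^sup>2 / 4" using N[of N] by simp
    also have "(\<Sum>i<N. (hs.nrm ((v - col_op G h) i))\<^sup>2) \<le> (\<Sum>i<N. (d / (2 * (real N + 1)))\<^sup>2)"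
    proof (rule sum_mono)
      fix i assume "i \<in> {..<N}"
      then have eq: "(v - col_op G h) i = v i - g i * h" by (simp add: col_op_def G_def)
      have "v i - g i * h \<in> carr H" using hs.tensor_memD[OF vH] A_mem[OF g(1) hH] by blast
      then show "(hs.nrm ((v - col_op G h) i))\<^sup>2 \<le> (d / (2 * (real N + 1)))\<^sup>2"
        unfolding eq using g(2)[of i] by (intro power_mono) auto
    qed
    also have "\<dots> = d\<^sup>2 / 4 * (real N / (real N + 1)\<^sup>2)" 
    proof -
      have "(d / (2 * y))\<^sup>2 = d\<^sup>2 / 4 / y\<^sup>2" for y by (simp add: power_divide power_mult_distrib)
      then show ?thesis by (simp only:) simp
    qed
    also have "\<dots> \<le> d\<^sup>2 / 4 * 1"
    proof (rule mult_left_mono)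
      have "real N \<le> (real N + 1)\<^sup>2" by (simp add: power2_eq_square algebra_simps)
      then show "real N / (real N + 1)\<^sup>2 \<le> 1" by (simp add: divide_le_eq_1)
    qed simp
    also have "d\<^sup>2 / 4 + d\<^sup>2 / 4 * 1 < d\<^sup>2" using d by simp
    finally have "(ht.nrm (v - col_op G h))\<^sup>2 < d\<^sup>2" by (simp only:)
    then have "ht.nrm (v - col_op G h) < d" by (rule power2_less_imp_less) (use d in simp)
    then show ?thesis using G ht.nrm_diff_commute[OF vH FC_col[OF G hH]] by (intro bexI[of _ G]) auto
  qed
  have "\<exists>G\<in>FC. ht.nrm (col_op G h - v) < 1 / Suc n" for n by (rule dense) simp
  then obtain Gn where Gn: "\<And>n. Gn n \<in> FC" "\<And>n. ht.nrm (col_op (Gn n) h - v) < 1 / Suc n" by metis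
  have Gm: "col_op (Gn n) h \<in> carr H2" for n by (rule FC_col[OF Gn(1) hH])
  have lim: "(\<lambda>n. ht.nrm (col_op (Gn n) h - v)) \<longlonglongrightarrow> 0"
  proof (rule tendsto_sandwich[OF _ _ tendsto_const LIMSEQ_inverse_real_of_nat])
    show "\<forall>\<^sub>F n in sequentially. 0 \<le> ht.nrm (col_op (Gn n) h - v)"
      using hs.tensor_nrm_nonneg[OF ht.diff_mem[OF Gm vH]] by simp
    show "\<forall>\<^sub>F n in sequentially. ht.nrm (col_op (Gn n) h - v) \<le> inverse (real (Suc n))"
      using Gn(2) by (simp add: less_imp_le inverse_eq_divide del: of_nat_Suc)
  qed
  have "c * Re (ip H2 v v) \<le> Re (ip H p k) * ht.nrm v"
  proof (rule LIMSEQ_le)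
    show "(\<lambda>n. c * Re (ip H2 (col_op (Gn n) h) v)) \<longlonglongrightarrow> c * Re (ip H2 v v)"
      by (intro tendsto_intros ht.ip_tendsto Gm vH lim)
    show "(\<lambda>n. Re (ip H p k) * ht.nrm (col_op (Gn n) h)) \<longlonglongrightarrow> Re (ip H p k) * ht.nrm v"
      by (intro tendsto_intros ht.nrm_tendsto Gm vH lim)
  qed (use bound Gn in blast)
  then have cv: "c * ht.nrm v \<le> Re (ip H p k)"
    using v0 pk0 unfolding ht.ip_self[OF vH] by (cases "ht.nrm v = 0") (auto simp: power2_eq_square)
  \<comment> \<open>The chain ends in \<open>\<parallel>h\<parallel> \<parallel>k\<parallel> \<le>
    \<parallel>h\<parallel> \<parallel>k\<parallel> - \<parallel>k\<parallel>\<^sup>2\<close>; the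
    radius \<open>c = \<parallel>h\<parallel> / \<delta>\<close> is chosen to make its two ends
    match.\<close>
  have "hs.nrm h * hs.nrm k = c * (\<delta> * hs.nrm k)" using \<delta> by (simp add: c_def)
  also have "\<dots> \<le> c * ht.nrm v" by (rule mult_left_mono[OF vk c0])
  also have "\<dots> \<le> Re (ip H p k)" by (rule cv)
  also have "\<dots> = Re (ip H h k) - (hs.nrm k)\<^sup>2"
  proof -
    have "p = h - k" by (simp add: k_def)
    then show ?thesis using hs.ip_diff[OF hH kH kH] hs.ip_self[OF kH] by simp
  qed
  also have "Re (ip H h k) \<le> hs.nrm h * hs.nrm k"
    using hs.cauchy_schwarz[OF hH kH] complex_Re_le_cmod order_trans by blast
  finally have "(hs.nrm k)\<^sup>2 \<le> 0" by simp
  then have "k = 0" using hs.nrm_eq_0[OF kH] by simp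
  then have "p = h" by (simp add: k_def)
  then obtain n where n: "hs.nrm (\<sigma> n - h) < e"
    using p(2) e order_tendstoD(2)[OF p(2) e] by (auto simp: eventually_sequentially)
  obtain G where "G \<in> FC" "ht.nrm (col_op G h) \<le> c" "\<sigma> n = row_op F G * h"
    using \<sigma>[of n] by (auto simp: M_def)
  then show thesis using that n by (simp add: c_def)
qed

section \<open>From one cyclic vector to finitely many vectors\<close>

lemma FC_row_comb:
  assumes "G \<in> FC" "G' \<in> FC"
  shows "row_op F (\<lambda>i. (\<lambda>_. c) * G i + (\<lambda>_. d) * G' i) = (\<lambda>_. c) * row_op F G + (\<lambda>_. d) * row_op F G'"
proof -
  obtain N N' where N: "\<And>i. i \<ge> N \<Longrightarrow> G i = 0" "\<And>i. i \<ge> N' \<Longrightarrow> G' i = 0"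
    using assms by (auto simp: finite_columns_def)
  define M where "M = max N N'"
  have M: "G i = 0" "G' i = 0" if "i \<ge> M" for i using that N by (auto simp: M_def)
  have 0: "(\<lambda>_. c) * G i + (\<lambda>_. d) * G' i = 0" if "i \<ge> M" for i using M[OF that] by simp
  have "row_op F (\<lambda>i. (\<lambda>_. c) * G i + (\<lambda>_. d) * G' i) = (\<Sum>i<M. F i * ((\<lambda>_. c) * G i + (\<lambda>_. d) * G' i))"
    "row_op F G = (\<Sum>i<M. F i * G i)" "row_op F G' = (\<Sum>i<M. F i * G' i)"
    using 0 M by (intro row_op_finite; simp)+
  then show ?thesis by (simp add: sum_distrib_left algebra_simps sum.distrib)
qed

lemma (in prehilbert) nrm_sq_convex:
  assumes p: "p \<in> carr S" and q: "q \<in> carr S" and t: "0 \<le> t" "t \<le> 1"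
  shows "(nrm (sc (complex_of_real (1 - t)) p + sc (complex_of_real t) q))\<^sup>2 \<le> (1 - t) * (nrm p)\<^sup>2 + t * (nrm q)\<^sup>2"
proof -
  have "nrm (sc (complex_of_real (1 - t)) p + sc (complex_of_real t) q) \<le> (1 - t) * nrm p + t * nrm q"
    using nrm_triangle[OF sc_mem[OF p] sc_mem[OF q], of "complex_of_real (1 - t)" "complex_of_real t"]
    unfolding nrm_sc[OF p] nrm_sc[OF q] norm_of_real using t by simp
  then have "(nrm (sc (complex_of_real (1 - t)) p + sc (complex_of_real t) q))\<^sup>2 \<le> ((1 - t) * nrm p + t * nrm q)\<^sup>2"
    using p q by (intro power_mono) auto
  also have "\<dots> = (1 - t) * (nrm p)\<^sup>2 + t * (nrm q)\<^sup>2 - t * (1 - t) * (nrm p - nrm q)\<^sup>2"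
    by (simp add: power2_eq_square algebra_simps)
  also have "\<dots> \<le> (1 - t) * (nrm p)\<^sup>2 + t * (nrm q)\<^sup>2" using t by simp
  finally show ?thesis .
qed

text \<open>This is \<open>domination\<close> for the finite sequence of the vectors
  \<open>sqrt (w u) u\<close>, which turns weights into squared norms.\<close>

lemma weighted_domination:
  assumes U: "finite U" "U \<subseteq> carr H" and w: "\<And>u. u \<in> U \<Longrightarrow> 0 \<le> w u" and \<eta>: "\<eta> > 0"
  obtains h where "cyclic_vector H h" "(hs.nrm h)\<^sup>2 \<le> (\<Sum>u\<in>U. w u * (hs.nrm u)\<^sup>2) + \<eta>"
    "\<And>f. f \<in> multipliers H \<Longrightarrow> (\<Sum>u\<in>U. w u * (hs.nrm (f * u))\<^sup>2) \<le> (hs.nrm (f * h))\<^sup>2"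
proof -
  obtain n and e :: "nat \<Rightarrow> 'x \<Rightarrow> complex" where e: "bij_betw e {..<n} U"
    using ex_bij_betw_nat_finite[OF U(1)] by (auto simp: atLeast0LessThan)
  have eU: "e i \<in> U" if "i < n" for i using e that by (auto simp: bij_betw_def)
  have eH: "e i \<in> carr H" if "i < n" for i using eU[OF that] U by blast
  define a where "a i = (if i < n then (\<lambda>_. complex_of_real (sqrt (w (e i)))) * e i else 0)" for i
  have aT: "a \<in> carr H2"
    by (rule hs.finite_support_mem[of _ n]) (use eH in \<open>auto simp: a_def scale_mem\<close>)
  have fa: "(ht.nrm (\<lambda>i. f * a i))\<^sup>2 = (\<Sum>u\<in>U. w u * (hs.nrm (f * u))\<^sup>2)"
    if m: "(\<lambda>i. f * a i) \<in> carr H2" and f: "f \<in> multipliers H" for f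
  proof -
    have "(ht.nrm (\<lambda>i. f * a i))\<^sup>2 = (\<Sum>i. (hs.nrm (f * a i))\<^sup>2)"
      by (rule hs.tensor_nrm_sq[OF m])
    also have "\<dots> = (\<Sum>i<n. (hs.nrm (f * a i))\<^sup>2)"
      by (rule suminf_finite) (auto simp: a_def)
    also have "\<dots> = (\<Sum>i<n. w (e i) * (hs.nrm (f * e i))\<^sup>2)"
    proof (intro sum.cong refl)
      fix i assume "i \<in> {..<n}"
      then have i: "i < n" by simp
      have "f * e i \<in> carr H" using f eH[OF i] by (simp add: multipliers_def)
      moreover have "f * a i = (\<lambda>_. complex_of_real (sqrt (w (e i)))) * (f * e i)"
        using i by (simp add: a_def mult.left_commute)
      ultimately have "hs.nrm (f * a i) = sqrt (w (e i)) * hs.nrm (f * e i)"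
        using w[OF eU[OF i]] by (simp add: hs.nrm_sc)
      then show "(hs.nrm (f * a i))\<^sup>2 = w (e i) * (hs.nrm (f * e i))\<^sup>2"
        using w[OF eU[OF i]] by (simp add: power_mult_distrib)
    qed
    also have "\<dots> = (\<Sum>u\<in>U. w u * (hs.nrm (f * u))\<^sup>2)"
      by (rule sum.reindex_bij_betw[OF e])
    finally show ?thesis .
  qed
  have one: "(\<lambda>i. 1 * a i) = a" by simp
  have a_nrm: "(ht.nrm a)\<^sup>2 = (\<Sum>u\<in>U. w u * (hs.nrm u)\<^sup>2)"
    using fa[of 1, unfolded one, OF aT multipliers_closed(4)] by simp
  show thesis
  proof (rule domination[OF np cc aT \<eta>])
    fix h assume 1: "cyclic_vector H h" "(hs.nrm h)\<^sup>2 \<le> (ht.nrm a)\<^sup>2 + \<eta>"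
      and 2: "\<And>f. f \<in> multipliers H \<Longrightarrow> (\<lambda>n. f * a n) \<in> carr H2"
      and 3: "\<And>f. f \<in> multipliers H \<Longrightarrow> ht.nrm (\<lambda>n. f * a n) \<le> hs.nrm (f * h)"
    have "(\<Sum>u\<in>U. w u * (hs.nrm (f * u))\<^sup>2) \<le> (hs.nrm (f * h))\<^sup>2" if f: "f \<in> multipliers H" for f
      unfolding fa[OF 2[OF f] f, symmetric] by (rule power_mono[OF 3[OF f] hs.tensor_nrm_nonneg[OF 2[OF f]]])
    with 1 show thesis unfolding a_nrm by (intro that)
  qed
qed

text \<open>Norm bound and equation are merged into one function \<open>\<phi> u\<close>, convex in
  \<open>G\<close>, with the defect of the equation as a penalty. Minimax reduces to weighted sums
  of these, which are dominated at a single cyclic vector, where \<open>approximate_solution\<close>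
  applies.\<close>

lemma finitely_many_vectors:
  assumes U: "finite U" "U \<subseteq> carr H" and \<epsilon>: "\<epsilon> > 0"
  shows "\<exists>G\<in>FC. \<forall>u\<in>U. (ht.nrm (col_op G u))\<^sup>2 \<le> (hs.nrm u)\<^sup>2 / \<delta>\<^sup>2 + \<epsilon> \<and> hs.nrm (row_op F G * u - u) \<le> \<epsilon>"
proof (cases "U = {}")
  case True
  then show ?thesis using FC_zero by blast
next
  case False
  \<comment> \<open>Negativity of \<open>\<phi> u G\<close> bounds the penalty by
    \<open>\<parallel>u\<parallel>\<^sup>2 / \<delta>\<^sup>2 + \<epsilon>\<close>, and
    \<open>C\<close> is chosen so that this is at most
    \<open>C * \<epsilon>\<^sup>2\<close>.\<close>
  define C where "C = ((\<Sum>u\<in>U. (hs.nrm u)\<^sup>2) / \<delta>\<^sup>2 + \<epsilon>) / \<epsilon>\<^sup>2"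
  have "0 \<le> (\<Sum>u\<in>U. (hs.nrm u)\<^sup>2) / \<delta>\<^sup>2" by (simp add: sum_nonneg)
  then have C: "C > 0" using \<epsilon> unfolding C_def by (intro divide_pos_pos) auto
  define \<phi> where "\<phi> u G = (ht.nrm (col_op G u))\<^sup>2 + C * (hs.nrm (row_op F G * u - u))\<^sup>2 - (hs.nrm u)\<^sup>2 / \<delta>\<^sup>2 - \<epsilon>" for u G
  have uH: "u \<in> carr H" if "u \<in> U" for u using that U by blast
  have rm: "row_op F G * u - u \<in> carr H" if "G \<in> FC" "u \<in> carr H" for G u
    using A_mem[OF FC_row[OF that(1)] that(2)] that(2) by blast
  have "\<exists>G\<in>FC. \<forall>u\<in>U. \<phi> u G < 0"
  proof (rule convexlike_minimax[OF U(1) False])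
    fix G G' and t :: real assume G: "G \<in> FC" "G' \<in> FC" and t: "0 \<le> t" "t \<le> 1"
    let ?G = "\<lambda>i. (\<lambda>_. complex_of_real (1 - t)) * G i + (\<lambda>_. complex_of_real t) * G' i"
    have "\<phi> u ?G \<le> (1 - t) * \<phi> u G + t * \<phi> u G'" if u: "u \<in> U" for u
    proof -
      note m = FC_col[OF G(1) uH[OF u]] FC_col[OF G(2) uH[OF u]]
      have c1: "col_op ?G u = (\<lambda>i. (\<lambda>_. complex_of_real (1 - t)) * col_op G u i) + (\<lambda>i. (\<lambda>_. complex_of_real t) * col_op G' u i)"
        by (simp add: col_op_def fun_eq_iff algebra_simps)
      have c2: "row_op F ?G * u - u = (\<lambda>_. complex_of_real (1 - t)) * (row_op F G * u - u) + (\<lambda>_. complex_of_real t) * (row_op F G' * u - u)"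
        unfolding FC_row_comb[OF G] by (simp add: fun_eq_iff algebra_simps)
      have i1: "(ht.nrm (col_op ?G u))\<^sup>2 \<le> (1 - t) * (ht.nrm (col_op G u))\<^sup>2 + t * (ht.nrm (col_op G' u))\<^sup>2"
        unfolding c1 by (rule ht.nrm_sq_convex[OF m t])
      have i2: "C * (hs.nrm (row_op F ?G * u - u))\<^sup>2 \<le> C * ((1 - t) * (hs.nrm (row_op F G * u - u))\<^sup>2 + t * (hs.nrm (row_op F G' * u - u))\<^sup>2)"
        unfolding c2 by (intro mult_left_mono hs.nrm_sq_convex rm G uH u t) (use C in simp)
      have "(1 - t) * \<phi> u G + t * \<phi> u G' = ((1 - t) * (ht.nrm (col_op G u))\<^sup>2 + t * (ht.nrm (col_op G' u))\<^sup>2)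
         + C * ((1 - t) * (hs.nrm (row_op F G * u - u))\<^sup>2 + t * (hs.nrm (row_op F G' * u - u))\<^sup>2) - (hs.nrm u)\<^sup>2 / \<delta>\<^sup>2 - \<epsilon>"
      proof -
        obtain X where X: "(hs.nrm u)\<^sup>2 / \<delta>\<^sup>2 = X" by simp
        show ?thesis unfolding \<phi>_def X by (simp add: algebra_simps)
      qed
      then show ?thesis using i1 i2 by (simp add: \<phi>_def)
    qed
    then show "\<exists>z\<in>FC. \<forall>u\<in>U. \<phi> u z \<le> (1 - t) * \<phi> u G + t * \<phi> u G'" using FC_comb[OF G] by blast
  next
    fix w :: "('x \<Rightarrow> complex) \<Rightarrow> real" assume w: "\<And>u. u \<in> U \<Longrightarrow> 0 \<le> w u" "sum w U = 1"
    \<comment> \<open>Error budget: the excess norm of \<open>h\<close> costs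
      \<open>\<eta> / \<delta>\<^sup>2 = \<epsilon> / 4\<close>, and the penalty at the distance
      \<open>d\<close> below costs \<open>C * d\<^sup>2 = \<epsilon> / 4\<close>, together less than
      \<open>\<epsilon>\<close>.\<close>
    define \<eta> where "\<eta> = \<epsilon> * \<delta>\<^sup>2 / 4"
    have \<eta>: "\<eta> > 0" using \<epsilon> \<delta> by (simp add: \<eta>_def)
    obtain h where h: "cyclic_vector H h" "(hs.nrm h)\<^sup>2 \<le> (\<Sum>u\<in>U. w u * (hs.nrm u)\<^sup>2) + \<eta>"
      and dom: "\<And>f. f \<in> multipliers H \<Longrightarrow> (\<Sum>u\<in>U. w u * (hs.nrm (f * u))\<^sup>2) \<le> (hs.nrm (f * h))\<^sup>2"
    proof (rule weighted_domination[where w = w, OF U w(1) \<eta>])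
      fix h assume 1: "cyclic_vector H h" "(hs.nrm h)\<^sup>2 \<le> (\<Sum>u\<in>U. w u * (hs.nrm u)\<^sup>2) + \<eta>"
        and 2: "\<And>f. f \<in> multipliers H \<Longrightarrow> (\<Sum>u\<in>U. w u * (hs.nrm (f * u))\<^sup>2) \<le> (hs.nrm (f * h))\<^sup>2"
      show thesis by (rule that[OF 1 2])
    qed
    have hH: "h \<in> carr H" using h by (simp add: cyclic_vector_def)
    define d where "d = sqrt (\<epsilon> / (4 * C))"
    have d: "d > 0" using \<epsilon> C by (simp add: d_def)
    obtain G where G: "G \<in> FC" "ht.nrm (col_op G h) \<le> hs.nrm h / \<delta>" "hs.nrm (row_op F G * h - h) < d"
      by (rule approximate_solution[OF h(1) d]) (rule that)
    have Gi: "G i \<in> multipliers H" for i using G(1) AM by (auto simp: finite_columns_def)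
    obtain N where N: "\<And>i. i \<ge> N \<Longrightarrow> G i = 0" using G(1) by (auto simp: finite_columns_def)
    have col: "(ht.nrm (col_op G u))\<^sup>2 = (\<Sum>i<N. (hs.nrm (G i * u))\<^sup>2)" if "u \<in> carr H" for u
    proof -
      have "(\<Sum>i. (hs.nrm (col_op G u i))\<^sup>2) = (\<Sum>i<N. (hs.nrm (col_op G u i))\<^sup>2)"
        by (rule suminf_finite) (auto simp: col_op_def N not_less)
      then show ?thesis using hs.tensor_nrm_sq[OF FC_col[OF G(1) that]] by (simp add: col_op_def)
    qed
    have "(\<Sum>u\<in>U. w u * (ht.nrm (col_op G u))\<^sup>2) = (\<Sum>u\<in>U. \<Sum>i<N. w u * (hs.nrm (G i * u))\<^sup>2)"
      by (intro sum.cong refl) (simp add: col[OF uH] sum_distrib_left)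
    also have "\<dots> = (\<Sum>i<N. \<Sum>u\<in>U. w u * (hs.nrm (G i * u))\<^sup>2)" by (rule sum.swap)
    also have "\<dots> \<le> (\<Sum>i<N. (hs.nrm (G i * h))\<^sup>2)" by (intro sum_mono dom Gi)
    also have "\<dots> = (ht.nrm (col_op G h))\<^sup>2" by (rule col[OF hH, symmetric])
    also have "\<dots> \<le> (hs.nrm h / \<delta>)\<^sup>2" by (intro power_mono G(2) hs.tensor_nrm_nonneg FC_col G(1) hH)
    also have "\<dots> \<le> ((\<Sum>u\<in>U. w u * (hs.nrm u)\<^sup>2) + \<eta>) / \<delta>\<^sup>2"
      unfolding power_divide by (rule divide_right_mono[OF h(2)]) simp
    also have "\<dots> = (\<Sum>u\<in>U. w u * (hs.nrm u)\<^sup>2) / \<delta>\<^sup>2 + \<epsilon> / 4"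
      using \<delta> by (simp add: \<eta>_def field_simps)
    finally have s1: "(\<Sum>u\<in>U. w u * (ht.nrm (col_op G u))\<^sup>2) \<le> (\<Sum>u\<in>U. w u * (hs.nrm u)\<^sup>2) / \<delta>\<^sup>2 + \<epsilon> / 4" .
    define f where "f = row_op F G + (\<lambda>_. -1) * 1"
    have f: "f \<in> multipliers H" unfolding f_def using FC_row[OF G(1)] AM multipliers_closed by blast
    have fu: "f * u = row_op F G * u - u" for u by (simp add: f_def fun_eq_iff algebra_simps)
    have "(\<Sum>u\<in>U. w u * (hs.nrm (row_op F G * u - u))\<^sup>2) \<le> (hs.nrm (row_op F G * h - h))\<^sup>2"
      using dom[OF f] unfolding fu .
    also have "\<dots> \<le> d\<^sup>2" by (rule power_mono) (use G(3) hs.nrm_nonneg[OF rm[OF G(1) hH]] in auto)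
    also have "\<dots> = \<epsilon> / (4 * C)" using \<epsilon> C by (simp add: d_def)
    finally have s2: "C * (\<Sum>u\<in>U. w u * (hs.nrm (row_op F G * u - u))\<^sup>2) \<le> \<epsilon> / 4"
      using C by (simp add: field_simps)
    have "(\<Sum>u\<in>U. w u * \<phi> u G) = (\<Sum>u\<in>U. w u * (ht.nrm (col_op G u))\<^sup>2)
        + C * (\<Sum>u\<in>U. w u * (hs.nrm (row_op F G * u - u))\<^sup>2) - (\<Sum>u\<in>U. w u * (hs.nrm u)\<^sup>2) / \<delta>\<^sup>2 - \<epsilon> * sum w U"
      by (simp add: \<phi>_def algebra_simps sum.distrib sum_subtractf sum_distrib_left sum_divide_distrib)
    then have "(\<Sum>u\<in>U. w u * \<phi> u G) < 0" using s1 s2 w(2) \<epsilon> by simp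
    then show "\<exists>G\<in>FC. (\<Sum>u\<in>U. w u * \<phi> u G) < 0" using G(1) by blast
  qed
  then obtain G where G: "G \<in> FC" "\<And>u. u \<in> U \<Longrightarrow> \<phi> u G < 0" by blast
  show ?thesis
  proof (intro bexI[OF _ G(1)] ballI conjI)
    fix u assume u: "u \<in> U"
    have c0: "0 \<le> C * (hs.nrm (row_op F G * u - u))\<^sup>2" using C by simp
    then show "(ht.nrm (col_op G u))\<^sup>2 \<le> (hs.nrm u)\<^sup>2 / \<delta>\<^sup>2 + \<epsilon>"
      using G(2)[OF u] by (simp add: \<phi>_def)
    have "C * (hs.nrm (row_op F G * u - u))\<^sup>2 \<le> (hs.nrm u)\<^sup>2 / \<delta>\<^sup>2 + \<epsilon>"
      using G(2)[OF u] zero_le_power2[of "ht.nrm (col_op G u)"] unfolding \<phi>_def by linarith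
    also have "\<dots> \<le> (\<Sum>u\<in>U. (hs.nrm u)\<^sup>2) / \<delta>\<^sup>2 + \<epsilon>"
      using member_le_sum[OF u, of "\<lambda>u. (hs.nrm u)\<^sup>2"] U by (intro add_right_mono divide_right_mono) auto
    also have "\<dots> = C * \<epsilon>\<^sup>2" using \<epsilon> by (simp add: C_def)
    finally have "(hs.nrm (row_op F G * u - u))\<^sup>2 \<le> \<epsilon>\<^sup>2" using C by simp
    then show "hs.nrm (row_op F G * u - u) \<le> \<epsilon>" by (rule power2_le_imp_le) (use \<epsilon> in simp)
  qed
qed

section \<open>Passage to the limit\<close>

text \<open>
  Closedness refers to the product topology, so \<open>B\<close> is a pointwise cluster point of the sesquilinear
  forms of columns that are good at more and more vectors.
\<close>

definition approximable :: "(('x \<Rightarrow> complex) \<times> (nat \<Rightarrow> 'x \<Rightarrow> complex) \<Rightarrow> complex) \<Rightarrow> bool"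
  where "approximable B \<longleftrightarrow> (\<forall>P R \<epsilon>. finite P \<longrightarrow> P \<subseteq> carr H \<times> carr H2 \<longrightarrow> 0 < \<epsilon> \<longrightarrow> closed {f. R f} \<longrightarrow>
      (\<forall>f. \<forall>G\<in>FC. (\<forall>u v. (u, v) \<in> P \<longrightarrow> f (u, v) = ip H2 (col_op G u) v \<and>
          (ht.nrm (col_op G u))\<^sup>2 \<le> (hs.nrm u)\<^sup>2 / \<delta>\<^sup>2 + \<epsilon> \<and> hs.nrm (row_op F G * u - u) \<le> \<epsilon>) \<longrightarrow> R f) \<longrightarrow> R B)"

lemma approximableD:
  assumes "approximable B" "finite P" "P \<subseteq> carr H \<times> carr H2" "0 < \<epsilon>" "closed {f. R f}"
    "\<And>f G. G \<in> FC \<Longrightarrow> (\<And>u v. (u, v) \<in> P \<Longrightarrow> f (u, v) = ip H2 (col_op G u) v \<and>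
          (ht.nrm (col_op G u))\<^sup>2 \<le> (hs.nrm u)\<^sup>2 / \<delta>\<^sup>2 + \<epsilon> \<and> hs.nrm (row_op F G * u - u) \<le> \<epsilon>) \<Longrightarrow> R f"
  shows "R B"
proof -
  have "\<forall>f. \<forall>G\<in>FC. (\<forall>u v. (u, v) \<in> P \<longrightarrow> f (u, v) = ip H2 (col_op G u) v \<and>
          (ht.nrm (col_op G u))\<^sup>2 \<le> (hs.nrm u)\<^sup>2 / \<delta>\<^sup>2 + \<epsilon> \<and> hs.nrm (row_op F G * u - u) \<le> \<epsilon>) \<longrightarrow> R f"
    using assms(6) by simp
  then show ?thesis
    using assms(1)[unfolded approximable_def, THEN spec[of _ P], THEN spec[of _ R], THEN spec[of _ \<epsilon>]] assms(2-5) by simp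
qed

text \<open>A requirement is indexed by a pair of vectors and a number \<open>n\<close> encoding the
  tolerance \<open>1 / Suc n\<close>. Finitely many of them are met by one column, taken from
  \<open>finitely_many_vectors\<close> at the strictest tolerance.\<close>

lemma approximable_exists: "\<exists>B. approximable B"
proof -
  define X where "X = carr H \<times> carr H2"
  define good :: "real \<Rightarrow> (nat \<Rightarrow> 'x \<Rightarrow> complex) \<Rightarrow> (('x \<Rightarrow> complex) \<times> (nat \<Rightarrow> 'x \<Rightarrow> complex) \<Rightarrow> complex) \<Rightarrow> ('x \<Rightarrow> complex) \<times> (nat \<Rightarrow> 'x \<Rightarrow> complex) \<Rightarrow> bool"
    where "good \<epsilon> G f p \<longleftrightarrow> f p = ip H2 (col_op G (fst p)) (snd p) \<and>
        (ht.nrm (col_op G (fst p)))\<^sup>2 \<le> (hs.nrm (fst p))\<^sup>2 / \<delta>\<^sup>2 + \<epsilon> \<and>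
        hs.nrm (row_op F G * fst p - fst p) \<le> \<epsilon>" for \<epsilon> G f p
  define Q where "Q E f \<longleftrightarrow> (\<exists>G\<in>FC. \<forall>q\<in>E. fst q \<in> X \<longrightarrow> good (1 / Suc (snd q)) G f (fst q))" for E f
  \<comment> \<open>Tolerances are at most \<open>1\<close>, and
    \<open>\<parallel>u\<parallel>\<^sup>2 / \<delta>\<^sup>2 + 1 \<le> (\<parallel>u\<parallel> /
    \<delta> + 1)\<^sup>2\<close>; Cauchy-Schwarz gives the rest.\<close>
  define D where "D p = (if p \<in> X then (hs.nrm (fst p) / \<delta> + 1) * ht.nrm (snd p) else 0)" for p
  obtain B where "\<And>p. cmod (B p) \<le> D p"
    and B: "\<And>E R. finite E \<Longrightarrow> closed {f. R f} \<Longrightarrow> (\<And>f. Q E f \<Longrightarrow> R f) \<Longrightarrow> R B"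
  proof (rule compactness_principle[of Q D])
    show "Q E f" if "E \<subseteq> E'" "Q E' f" for E E' f using that unfolding Q_def by blast
    fix E :: "((('x \<Rightarrow> complex) \<times> (nat \<Rightarrow> 'x \<Rightarrow> complex)) \<times> nat) set" assume E: "finite E"
    define U where "U = fst ` (fst ` E \<inter> X)"
    have U: "finite U" "U \<subseteq> carr H" using E by (auto simp: U_def X_def)
    define N where "N = Max (insert 0 (snd ` E))"
    have N: "snd q \<le> N" if "q \<in> E" for q using E that by (auto simp: N_def)
    obtain G where G: "G \<in> FC" "\<And>u. u \<in> U \<Longrightarrow> (ht.nrm (col_op G u))\<^sup>2 \<le> (hs.nrm u)\<^sup>2 / \<delta>\<^sup>2 + 1 / Suc N
        \<and> hs.nrm (row_op F G * u - u) \<le> 1 / Suc N"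
      using finitely_many_vectors[OF U, of "1 / Suc N"] by auto
    define f where "f p = (if p \<in> fst ` E \<inter> X then ip H2 (col_op G (fst p)) (snd p) else 0)" for p
    have "good (1 / Suc (snd q)) G f (fst q)" if q: "q \<in> E" "fst q \<in> X" for q
    proof -
      have u: "fst (fst q) \<in> U" using q by (auto simp: U_def)
      have le: "1 / real (Suc N) \<le> 1 / real (Suc (snd q))" using N[OF q(1)] by (intro divide_left_mono) auto
      have "f (fst q) = ip H2 (col_op G (fst (fst q))) (snd (fst q))" using q by (simp add: f_def)
      then show ?thesis unfolding good_def using G(2)[OF u] le by linarith
    qed
    then have "Q E f" unfolding Q_def using G(1) by blast
    moreover have "cmod (f p) \<le> D p" for p
    proof (cases "p \<in> fst ` E \<inter> X")
      case True
      have u: "fst p \<in> U" "fst p \<in> carr H" "snd p \<in> carr H2" using True by (auto simp: U_def X_def)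
      have d0: "0 \<le> hs.nrm (fst p) / \<delta>" using u \<delta> by simp
      have "1 / real (Suc N) \<le> 1" by simp
      then have "(ht.nrm (col_op G (fst p)))\<^sup>2 \<le> (hs.nrm (fst p) / \<delta>)\<^sup>2 + 1"
        using G(2)[OF u(1)] unfolding power_divide by linarith
      also have "\<dots> \<le> (hs.nrm (fst p) / \<delta> + 1)\<^sup>2" using d0 by (simp add: power2_sum)
      finally have "ht.nrm (col_op G (fst p)) \<le> hs.nrm (fst p) / \<delta> + 1"
        by (rule power2_le_imp_le) (use d0 in simp)
      then have "ht.nrm (col_op G (fst p)) * ht.nrm (snd p) \<le> D p"
        using True hs.tensor_nrm_nonneg[OF u(3)] by (simp add: D_def mult_right_mono)
      then show ?thesis
        using ht.cauchy_schwarz[OF FC_col[OF G(1) u(2)] u(3)] True by (simp add: f_def)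
    next
      case False
      then show ?thesis using \<delta> hs.tensor_nrm_nonneg by (auto simp: f_def D_def X_def)
    qed
    ultimately show "\<exists>f. Q E f \<and> (\<forall>p. cmod (f p) \<le> D p)" by blast
  next
    fix g assume 1: "\<And>p. cmod (g p) \<le> D p"
      and 2: "\<And>E R. finite E \<Longrightarrow> closed {f. R f} \<Longrightarrow> (\<And>f. Q E f \<Longrightarrow> R f) \<Longrightarrow> R g"
    show thesis by (rule that[of g]) (fact 1, fact 2)
  qed
  have "approximable B"
    unfolding approximable_def
  proof (intro allI impI)
    fix P :: "(('x \<Rightarrow> complex) \<times> (nat \<Rightarrow> 'x \<Rightarrow> complex)) set" and R and \<epsilon> :: real
    assume P: "finite P" "P \<subseteq> carr H \<times> carr H2" and \<epsilon>: "0 < \<epsilon>" and R: "closed {f. R f}"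
      and imp: "\<forall>f. \<forall>G\<in>FC. (\<forall>u v. (u, v) \<in> P \<longrightarrow> f (u, v) = ip H2 (col_op G u) v \<and>
          (ht.nrm (col_op G u))\<^sup>2 \<le> (hs.nrm u)\<^sup>2 / \<delta>\<^sup>2 + \<epsilon> \<and> hs.nrm (row_op F G * u - u) \<le> \<epsilon>) \<longrightarrow> R f"
    obtain n where n: "1 / Suc n < \<epsilon>" using nat_approx_posE[OF \<epsilon>] by blast
    show "R B"
    proof (rule B[of "(\<lambda>p. (p, n)) ` P", OF _ R])
      fix f assume "Q ((\<lambda>p. (p, n)) ` P) f"
      then obtain G where G: "G \<in> FC" "\<And>p. p \<in> P \<Longrightarrow> p \<in> X \<Longrightarrow> good (1 / Suc n) G f p" unfolding Q_def by auto
      show "R f"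
      proof (rule imp[rule_format, OF G(1)])
        fix u v assume uv: "(u, v) \<in> P"
        then have "good (1 / Suc n) G f (u, v)" using P(2) by (intro G(2)) (auto simp: X_def)
        then show "f (u, v) = ip H2 (col_op G u) v \<and>
          (ht.nrm (col_op G u))\<^sup>2 \<le> (hs.nrm u)\<^sup>2 / \<delta>\<^sup>2 + \<epsilon> \<and> hs.nrm (row_op F G * u - u) \<le> \<epsilon>"
          using n unfolding good_def fst_conv snd_conv by linarith
      qed
    qed (use P in simp)
  qed
  then show ?thesis by blast
qed

text \<open>A cluster form \<open>B\<close> is bounded by \<open>1 / \<delta>\<close>, so
  \<open>B (u, v) = \<langle>T u, v\<rangle>\<close>. What is needed of \<open>T\<close> consists of
  closed conditions on finitely many values of \<open>B\<close>, all valid for finite columns: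
  \<open>T\<close> multiplies by a column \<open>G\<close>, the entries map \<open>h\<close> into
  \<open>\<AA>[h]\<close>, and \<open>F G = 1\<close> up to the tolerance.\<close>

lemma corona_solution:
  "\<exists>G \<in> col_space H A. (\<forall>x. (\<lambda>i. F i x * G i x) sums 1) \<and> op_norm H H2 (col_op G) \<le> inverse \<delta>"
proof -
  obtain B where "approximable B" using approximable_exists by blast
  note B = approximableD[OF this]
  have B_add: "B (u, v + v') = B (u, v) + B (u, v')"
    if u: "u \<in> carr H" and v: "v \<in> carr H2" "v' \<in> carr H2" for u v v'
  proof (rule B[of "{(u, v + v'), (u, v), (u, v')}" 1])
    show "closed {f :: _ \<Rightarrow> complex. f (u, v + v') = f (u, v) + f (u, v')}"
      by (intro closed_Collect_eq continuous_intros continuous_on_eval)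
    fix f G assume G: "G \<in> FC" and *: "\<And>u' v''. (u', v'') \<in> {(u, v + v'), (u, v), (u, v')} \<Longrightarrow> f (u', v'') = ip H2 (col_op G u') v'' \<and>
          (ht.nrm (col_op G u'))\<^sup>2 \<le> (hs.nrm u')\<^sup>2 / \<delta>\<^sup>2 + 1 \<and> hs.nrm (row_op F G * u' - u') \<le> 1"
    have "f (u, v + v') = ip H2 (col_op G u) (v + v')" "f (u, v) = ip H2 (col_op G u) v"
      "f (u, v') = ip H2 (col_op G u) v'" using * by blast+
    then show "f (u, v + v') = f (u, v) + f (u, v')" using ht.ip_add_right[OF v FC_col[OF G u]] by metis
  qed (use u v ht.add_mem[OF v] in auto)
  have B_scale: "B (u, (\<lambda>i. (\<lambda>_. c) * v i)) = cnj c * B (u, v)"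
    if u: "u \<in> carr H" and v: "v \<in> carr H2" for u v c
  proof (rule B[of "{(u, (\<lambda>i. (\<lambda>_. c) * v i)), (u, v)}" 1])
    show "closed {f. f (u, (\<lambda>i. (\<lambda>_. c) * v i)) = cnj c * f (u, v)}"
      by (intro closed_Collect_eq continuous_intros continuous_on_eval)
    fix f G assume G: "G \<in> FC" and *: "\<And>u' v''. (u', v'') \<in> {(u, (\<lambda>i. (\<lambda>_. c) * v i)), (u, v)} \<Longrightarrow> f (u', v'') = ip H2 (col_op G u') v'' \<and>
          (ht.nrm (col_op G u'))\<^sup>2 \<le> (hs.nrm u')\<^sup>2 / \<delta>\<^sup>2 + 1 \<and> hs.nrm (row_op F G * u' - u') \<le> 1"
    have "f (u, (\<lambda>i. (\<lambda>_. c) * v i)) = ip H2 (col_op G u) (\<lambda>i. (\<lambda>_. c) * v i)" "f (u, v) = ip H2 (col_op G u) v"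
      using * by blast+
    then show "f (u, (\<lambda>i. (\<lambda>_. c) * v i)) = cnj c * f (u, v)" using ht.ip_sc_right[OF v FC_col[OF G u], of c] by (simp only:)
  qed (use u v ht.sc_mem[OF v] in auto)
  have B_le: "cmod (B (u, v)) \<le> hs.nrm u / \<delta> * ht.nrm v"
    if u: "u \<in> carr H" and v: "v \<in> carr H2" for u v
  proof -
    have v0: "0 \<le> ht.nrm v" by (rule hs.tensor_nrm_nonneg[OF v])
    \<comment> \<open>\<open>B\<close> satisfies the bound for every tolerance, so letting
      \<open>\<epsilon>\<close> tend to \<open>0\<close> gives the exact constant.\<close>
    have eps: "(cmod (B (u, v)))\<^sup>2 \<le> ((hs.nrm u)\<^sup>2 / \<delta>\<^sup>2 + \<epsilon>) * (ht.nrm v)\<^sup>2" if \<epsilon>: "0 < \<epsilon>" for \<epsilon>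
    proof (rule B[of "{(u, v)}" \<epsilon>])
      show "closed {f. (cmod (f (u, v)))\<^sup>2 \<le> ((hs.nrm u)\<^sup>2 / \<delta>\<^sup>2 + \<epsilon>) * (ht.nrm v)\<^sup>2}"
        by (intro closed_Collect_le continuous_intros continuous_on_eval)
      fix f G assume G: "G \<in> FC" and *: "\<And>u' v'. (u', v') \<in> {(u, v)} \<Longrightarrow> f (u', v') = ip H2 (col_op G u') v' \<and>
          (ht.nrm (col_op G u'))\<^sup>2 \<le> (hs.nrm u')\<^sup>2 / \<delta>\<^sup>2 + \<epsilon> \<and> hs.nrm (row_op F G * u' - u') \<le> \<epsilon>"
      have fe: "f (u, v) = ip H2 (col_op G u) v" and le: "(ht.nrm (col_op G u))\<^sup>2 \<le> (hs.nrm u)\<^sup>2 / \<delta>\<^sup>2 + \<epsilon>"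
        using *[of u v] by auto
      have "(cmod (f (u, v)))\<^sup>2 \<le> (ht.nrm (col_op G u) * ht.nrm v)\<^sup>2"
        unfolding fe by (rule power_mono[OF ht.cauchy_schwarz[OF FC_col[OF G u] v]]) simp
      also have "\<dots> \<le> ((hs.nrm u)\<^sup>2 / \<delta>\<^sup>2 + \<epsilon>) * (ht.nrm v)\<^sup>2"
        unfolding power_mult_distrib by (rule mult_right_mono[OF le]) simp
      finally show "(cmod (f (u, v)))\<^sup>2 \<le> ((hs.nrm u)\<^sup>2 / \<delta>\<^sup>2 + \<epsilon>) * (ht.nrm v)\<^sup>2" .
    qed (use u v \<epsilon> in auto)
    have "(\<lambda>n. ((hs.nrm u)\<^sup>2 / \<delta>\<^sup>2 + inverse (real (Suc n))) * (ht.nrm v)\<^sup>2) \<longlonglongrightarrow> ((hs.nrm u)\<^sup>2 / \<delta>\<^sup>2 + 0) * (ht.nrm v)\<^sup>2"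
      by (intro tendsto_intros LIMSEQ_inverse_real_of_nat)
    then have "(cmod (B (u, v)))\<^sup>2 \<le> ((hs.nrm u)\<^sup>2 / \<delta>\<^sup>2 + 0) * (ht.nrm v)\<^sup>2"
      by (rule LIMSEQ_le_const) (use eps in \<open>auto simp del: of_nat_Suc\<close>)
    then have "(cmod (B (u, v)))\<^sup>2 \<le> (hs.nrm u / \<delta> * ht.nrm v)\<^sup>2"
      by (simp add: power_mult_distrib power_divide)
    then show ?thesis by (rule power2_le_imp_le) (use u v0 \<delta> in simp)
  qed
  have "\<exists>l\<in>carr H2. ht.nrm l \<le> hs.nrm u / \<delta> \<and> (\<forall>v\<in>carr H2. B (u, v) = ip H2 l v)"
    if u: "u \<in> carr H" for u
  proof -
    obtain l where l: "l \<in> carr H2" "ht.nrm l \<le> hs.nrm u / \<delta>"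
      and lB: "\<And>v a. v \<in> carr H2 \<and> a = cnj (B (u, v)) \<Longrightarrow> a = ip H2 v l"
    proof (rule ht.riesz_relation[of "\<lambda>v a. v \<in> carr H2 \<and> a = cnj (B (u, v))" "hs.nrm u / \<delta>"])
      show "0 \<in> carr H2 \<and> 0 = cnj (B (u, 0))"
        using B_le[OF u ht.zero_mem] ht.zero_mem by simp
      have "cmod a \<le> hs.nrm u / \<delta> * ht.nrm v" if "v \<in> carr H2 \<and> a = cnj (B (u, v))" for v a
        using that B_le[OF u] by simp
      then show "v \<in> carr H2 \<and> cmod a \<le> hs.nrm u / \<delta> * ht.nrm v"
        if "v \<in> carr H2 \<and> a = cnj (B (u, v))" for v a using that by blast
      show "v + v' \<in> carr H2 \<and> a + a' = cnj (B (u, v + v'))"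
        if "v \<in> carr H2 \<and> a = cnj (B (u, v))" "v' \<in> carr H2 \<and> a' = cnj (B (u, v'))" for v v' a a'
        using that B_add[OF u] ht.add_mem by simp
      show "(\<lambda>i. (\<lambda>_. c) * v i) \<in> carr H2 \<and> c * a = cnj (B (u, (\<lambda>i. (\<lambda>_. c) * v i)))"
        if "v \<in> carr H2 \<and> a = cnj (B (u, v))" for v a c
        using that B_scale[OF u] ht.sc_mem by simp
      show "0 \<le> hs.nrm u / \<delta>" using u \<delta> by simp
    qed (rule that)
    have "B (u, v) = ip H2 l v" if v: "v \<in> carr H2" for v
    proof -
      have "cnj (B (u, v)) = ip H2 v l" using lB v by blast
      then have "cnj (B (u, v)) = cnj (ip H2 l v)" using ht.ip_cnj[OF l(1) v] by simp
      then show ?thesis by simp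
    qed
    then show ?thesis using l by blast
  qed
  then obtain T where T: "\<And>u. u \<in> carr H \<Longrightarrow> T u \<in> carr H2" "\<And>u. u \<in> carr H \<Longrightarrow> ht.nrm (T u) \<le> hs.nrm u / \<delta>"
    "\<And>u v. u \<in> carr H \<Longrightarrow> v \<in> carr H2 \<Longrightarrow> B (u, v) = ip H2 (T u) v" by metis
  note diag = connected_diag[OF cc]
  have e_mem: "hs.single i (kfun H x) \<in> carr H2" for i x by (rule hs.single_mem[OF kfun_mem])
  have coord: "ip H2 w (hs.single i (kfun H x)) = w i x" if "w \<in> carr H2" for w i x
    using hs.ip_single[OF kfun_mem that] reproducing[OF hs.tensor_memD[OF that]] by simp
  \<comment> \<open>The \<open>i\<close>-th entry of \<open>T k_x\<close>, evaluated at
    \<open>x\<close> and divided by \<open>k_x(x)\<close>.\<close>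
  define G where "G i x = B (kfun H x, hs.single i (kfun H x)) / kernel H x x" for i x
  have TG: "T u i = G i * u" if u: "u \<in> carr H" for u i
  proof
    fix x
    \<comment> \<open>Multiplied out, the condition is linear in two values of \<open>B\<close>,
      hence closed; for a finite column both sides equal
      \<open>G' i x * u x * k_x(x)\<close>.\<close>
    have "B (u, hs.single i (kfun H x)) * kernel H x x = B (kfun H x, hs.single i (kfun H x)) * u x"
    proof (rule B[of "{(u, hs.single i (kfun H x)), (kfun H x, hs.single i (kfun H x))}" 1])
      show "closed {f. f (u, hs.single i (kfun H x)) * kernel H x x = f (kfun H x, hs.single i (kfun H x)) * u x}"
        by (intro closed_Collect_eq continuous_intros continuous_on_eval)
      fix f G' assume G': "G' \<in> FC" and *: "\<And>u' v'. (u', v') \<in> {(u, hs.single i (kfun H x)), (kfun H x, hs.single i (kfun H x))} \<Longrightarrow>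
          f (u', v') = ip H2 (col_op G' u') v' \<and>
          (ht.nrm (col_op G' u'))\<^sup>2 \<le> (hs.nrm u')\<^sup>2 / \<delta>\<^sup>2 + 1 \<and> hs.nrm (row_op F G' * u' - u') \<le> 1"
      have "f (u, hs.single i (kfun H x)) = G' i x * u x" "f (kfun H x, hs.single i (kfun H x)) = G' i x * kfun H x x"
        using *[of u] *[of "kfun H x"] coord[OF FC_col[OF G' u]] coord[OF FC_col[OF G' kfun_mem]] by (simp_all add: col_op_def)
      then show "f (u, hs.single i (kfun H x)) * kernel H x x = f (kfun H x, hs.single i (kfun H x)) * u x"
        by (simp add: kernel_eq)
    qed (use u e_mem in auto)
    then have "B (u, hs.single i (kfun H x)) = G i x * u x" using diag[of x] by (simp add: G_def field_simps)
    then show "T u i x = (G i * u) x" using T(3)[OF u e_mem] coord[OF T(1)[OF u]] by simp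
  qed
  have colG: "col_op G u = T u" if "u \<in> carr H" for u
    using TG[OF that] by (simp add: col_op_def fun_eq_iff)
  have G_A: "G i \<in> A" for i
  proof (rule dual_algebra_membership[OF np cc A])
    have Gu: "G i * u \<in> carr H" if "u \<in> carr H" for u
      using hs.tensor_memD[OF T(1)[OF that], of i] by (simp add: TG[OF that])
    then show "G i \<in> multipliers H" by (simp add: multipliers_def)
    show "hs.nrm (G i * u) \<le> inverse \<delta> * hs.nrm u" if "u \<in> carr H" for u
      using order_trans[OF hs.tensor_coord_le[OF T(1)[OF that], of i] T(2)[OF that]] by (simp add: TG[OF that] divide_inverse mult.commute)
    fix h assume "cyclic_vector H h"
    then have h: "h \<in> carr H" by (simp add: cyclic_vector_def)
    let ?L = "carr (cyclic_subspace H A h)"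
    note L = cyclic_subspace_closed[OF h AM A_ne A_add A_scale]
    have "hs.orth (hs.orth ?L) \<subseteq> ?L"
      by (rule hs.orth_orth_closed) (fact L(1) L(2) L(3) L(4) L(5))+
    \<comment> \<open>For \<open>z\<close> orthogonal to \<open>\<AA>[h]\<close> the pairing with
      \<open>z\<close> in slot \<open>i\<close> vanishes for every finite column, hence for
      \<open>B\<close>.\<close>
    moreover have "G i * h \<in> hs.orth (hs.orth ?L)"
    proof -
      have "ip H z (G i * h) = 0" if z: "z \<in> hs.orth ?L" for z
      proof -
        have zH: "z \<in> carr H" using z hs.orth_mem by blast
        note sz = hs.single_mem[OF zH, of i]
        have "B (h, hs.single i z) = 0"
        proof (rule B[of "{(h, hs.single i z)}" 1])
          show "closed {f :: _ \<Rightarrow> complex. f (h, hs.single i z) = 0}"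
            by (intro closed_Collect_eq continuous_intros continuous_on_eval)
          fix f G' assume G': "G' \<in> FC" and *: "\<And>u' v'. (u', v') \<in> {(h, hs.single i z)} \<Longrightarrow>
              f (u', v') = ip H2 (col_op G' u') v' \<and>
              (ht.nrm (col_op G' u'))\<^sup>2 \<le> (hs.nrm u')\<^sup>2 / \<delta>\<^sup>2 + 1 \<and> hs.nrm (row_op F G' * u' - u') \<le> 1"
          have "G' i * h \<in> ?L" using L(6) G' by (simp add: finite_columns_def)
          then have "ip H (G' i * h) z = 0" using hs.orthD[OF z] by blast
          then show "f (h, hs.single i z) = 0"
            using *[of h "hs.single i z"] hs.ip_single[OF zH FC_col[OF G' h], of i] by (simp add: col_op_def)
        qed (use h sz in auto)
        then have "ip H (G i * h) z = 0"
          using T(3)[OF h sz] hs.ip_single[OF zH T(1)[OF h], of i] by (simp add: TG[OF h])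
        then show ?thesis using ip_cnj[OF Gu[OF h] zH] by simp
      qed
      then show ?thesis using Gu[OF h] by (simp add: hs.orth_def)
    qed
    ultimately show "G i * h \<in> ?L" by blast
  qed
  have FG: "(\<lambda>i. F i x * G i x) sums 1" for x
  proof -
    let ?k = "kfun H x"
    obtain C where C: "C \<ge> 0" "\<And>w. w \<in> carr H2 \<Longrightarrow> hs.nrm (row_op F w) \<le> C * ht.nrm w"
      using F_bounded by blast
    \<comment> \<open>\<open>v\<close> represents the functional
      \<open>w \<mapsto> (F w)(x)\<close>, so the infinite sum at \<open>x\<close> is visible in the
      single value \<open>B (k_x, v)\<close>.\<close>
    obtain v where v: "v \<in> carr H2"
      and vF: "\<And>w a. w \<in> carr H2 \<and> a = row_op F w x \<Longrightarrow> a = ip H2 w v"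
    proof (rule ht.riesz_relation[of "\<lambda>w a. w \<in> carr H2 \<and> a = row_op F w x" "C * hs.nrm ?k"])
      show "0 \<in> carr H2 \<and> 0 = row_op F 0 x" using ht.zero_mem by (simp add: row_op_def)
      show "w + w' \<in> carr H2 \<and> a + a' = row_op F (w + w') x"
        if "w \<in> carr H2 \<and> a = row_op F w x" "w' \<in> carr H2 \<and> a' = row_op F w' x" for w w' a a'
        using that F_add ht.add_mem by simp
      show "(\<lambda>i. (\<lambda>_. c) * w i) \<in> carr H2 \<and> c * a = row_op F (\<lambda>i. (\<lambda>_. c) * w i) x"
        if "w \<in> carr H2 \<and> a = row_op F w x" for w a c
        using that F_scale ht.sc_mem by simp
      show "w \<in> carr H2 \<and> cmod a \<le> C * hs.nrm ?k * ht.nrm w"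
        if w: "w \<in> carr H2 \<and> a = row_op F w x" for w a
      proof -
        have "cmod a \<le> hs.nrm (row_op F w) * hs.nrm ?k" using eval_le[OF F_mem] w by simp
        also have "\<dots> \<le> C * ht.nrm w * hs.nrm ?k" using C(2) w by (intro mult_right_mono) auto
        finally show ?thesis using w by (simp add: mult_ac)
      qed
      show "0 \<le> C * hs.nrm ?k" using C by simp
    qed (rule that)
    have vF': "ip H2 w v = row_op F w x" if "w \<in> carr H2" for w using vF that by metis
    have near: "cmod (B (?k, v) - ?k x) \<le> \<epsilon> * hs.nrm ?k" if \<epsilon>: "0 < \<epsilon>" for \<epsilon>
    proof (rule B[of "{(?k, v)}" \<epsilon>])
      show "closed {f. cmod (f (?k, v) - ?k x) \<le> \<epsilon> * hs.nrm ?k}"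
        by (intro closed_Collect_le continuous_intros continuous_on_eval)
      fix f G' assume G': "G' \<in> FC" and *: "\<And>u' v'. (u', v') \<in> {(?k, v)} \<Longrightarrow>
              f (u', v') = ip H2 (col_op G' u') v' \<and>
              (ht.nrm (col_op G' u'))\<^sup>2 \<le> (hs.nrm u')\<^sup>2 / \<delta>\<^sup>2 + \<epsilon> \<and> hs.nrm (row_op F G' * u' - u') \<le> \<epsilon>"
      have m: "row_op F G' * ?k - ?k \<in> carr H" using A_mem[OF FC_row[OF G'] kfun_mem] by blast
      have "f (?k, v) - ?k x = (row_op F G' * ?k - ?k) x"
        using *[of ?k v] vF'[OF FC_col[OF G' kfun_mem]] by (simp add: row_op_col_op[OF G'])
      then have "cmod (f (?k, v) - ?k x) \<le> hs.nrm (row_op F G' * ?k - ?k) * hs.nrm ?k"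
        using eval_le[OF m] by simp
      also have "\<dots> \<le> \<epsilon> * hs.nrm ?k" using *[of ?k v] by (intro mult_right_mono) auto
      finally show "cmod (f (?k, v) - ?k x) \<le> \<epsilon> * hs.nrm ?k" .
    qed (use v \<epsilon> in auto)
    have "(\<lambda>n. inverse (real (Suc n)) * hs.nrm ?k) \<longlonglongrightarrow> 0 * hs.nrm ?k"
      by (intro tendsto_intros LIMSEQ_inverse_real_of_nat)
    then have "cmod (B (?k, v) - ?k x) \<le> 0 * hs.nrm ?k"
      by (rule LIMSEQ_le_const) (use near in \<open>auto simp del: of_nat_Suc\<close>)
    then have "B (?k, v) = ?k x" by simp
    then have "row_op F (T ?k) x = ?k x" using T(3)[OF kfun_mem v] vF'[OF T(1)[OF kfun_mem]] by simp
    then have "(\<lambda>i. F i x * (G i x * ?k x)) sums ?k x"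
      using F_sums[OF T(1)[OF kfun_mem], of x x] by (simp add: TG)
    from sums_divide[OF this, of "?k x"] show ?thesis
      using diag[of x] by (simp add: kernel_eq)
  qed
  have "G \<in> col_space H A"
    unfolding col_space_def bounded_op_def using G_A T colG
    by (auto intro!: exI[of _ "inverse \<delta>"] simp: divide_inverse mult.commute)
  moreover have "op_norm H H2 (col_op G) \<le> inverse \<delta>"
    unfolding op_norm_def
  proof (rule cSUP_least)
    show "{v \<in> carr H. hs.nrm v \<le> 1} \<noteq> {}" using zero_mem hs.nrm_zero by (auto intro!: exI[of _ 0])
    fix u assume "u \<in> {v \<in> carr H. hs.nrm v \<le> 1}"
    then have u: "u \<in> carr H" "hs.nrm u \<le> 1" by auto
    have "ht.nrm (T u) \<le> 1 / \<delta>"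
      using T(2)[OF u(1)] divide_right_mono[OF u(2), of \<delta>] \<delta> by linarith
    then show "ht.nrm (col_op G u) \<le> inverse \<delta>" unfolding colG[OF u(1)] by (simp add: divide_inverse)
  qed
  ultimately show ?thesis using FG by blast
qed

end

theorem theorem5p2:
  fixes H :: "('x \<Rightarrow> complex) hspace"
    and A :: "('x \<Rightarrow> complex) set"
    and F :: "nat \<Rightarrow> 'x \<Rightarrow> complex"
    and \<delta> :: real
  assumes "rkhs H" and "complete_np H" and "countably_connected H"
    and "dual_algebra H A"
    and "F \<in> row_space H A" and "\<delta> > 0"
    and "\<And>h L. cyclic_vector H h \<Longrightarrow> L = cyclic_subspace H A h \<Longrightarrow>
           op_le L (\<lambda>u. (\<lambda>_. complex_of_real (\<delta>\<^sup>2)) * u)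
                   (\<lambda>u. row_op F (adj (tensor_l2 L) L (row_op F) u))"
  shows "\<exists>G \<in> col_space H A.
           (\<forall>x. (\<lambda>i. F i x * G i x) sums 1) \<and> op_norm H (tensor_l2 H) (col_op G) \<le> inverse \<delta>"
proof -
  interpret rkhs H by fact
  interpret corona H A F \<delta>
  proof unfold_locales
    show "op_le L (\<lambda>u. (\<lambda>_. complex_of_real (\<delta>\<^sup>2)) * u) (\<lambda>u. row_op F (adj (tensor_l2 L) L (row_op F) u))"
      if "cyclic_vector H h" "L = cyclic_subspace H A h" for h L
      using assms(7)[OF that] .
  qed (fact assms)+
  show ?thesis by (rule corona_solution)
qed

end
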